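(* For every $n\in\mathbb{Z}$, the group $U_n/\{t^k\}_{k\in\mathbb{Z}}$ can be described as follows. (1) The group $U_n/\{t^k\}_{k\in\mathbb{Z}}$ is finite precisely when $n=2,1,0,-1$, or $n=-p^k$ for a prime $p$ and $k\ge1$, and $$U_n/\{t^k\}_{k\in\mathbb{Z}}\cong\begin{cases}\{1\}&\text{if }n=-1,0,\\ \mathbb{Z}/2\mathbb{Z}&\text{if }n=1,2\text{ or }n=-p^k\text{ with }k\text{ odd},\\ \mathbb{Z}/4\mathbb{Z}&\text{if }n=-p^k\text{ with }k\geq 2\text{ even}.\end{cases}$$ (2) In all other cases, $U_n/\{t^k\}_{k\in\mathbb{Z}}$ is infinite and $$\mathrm{rk}\left(U_n/\{t^k\}_{k\in\mathbb{Z}}\right)=\begin{cases}\Omega(n)&\text{if }\Delta_n\text{ is irreducible and }n>0,\\ \Omega(n)-1&\text{if }\Delta_n\text{ is irreducible and }n<0,\text{ or if }\Delta_n\text{ is reducible.}\end{cases}$$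
   Context: For $n\in\mathbb{Z}$, $\Delta_n:=nt-(2n+1)+nt^{-1}\in\mathbb{Z}[t^{\pm1}]$. The ring $\mathbb{Z}[t^{\pm1}]/(\Delta_n)$ carries the involution induced by $\overline{p(t)}=p(t^{-1})$, and $U_n:=\{u\in\mathbb{Z}[t^{\pm1}]/(\Delta_n)\mid u\overline{u}=1\}$ is its group of unitary units. $\{t^k\}_{k\in\mathbb{Z}}$ denotes the subgroup of $U_n$ generated by the class of $t$. $\Omega(n)$ is the number of (distinct) positive primes dividing $n$. $\mathrm{rk}$ denotes the rank of an abelian group. *)

theory Defs
  imports
    "HOL-Algebra.QuotRing"
    "HOL-Algebra.Elementary_Groups"
    "HOL-Algebra.Algebraic_Closure_Type"
    "HOL-Library.Poly_Mapping"
    "HOL-Library.Extended_Nat"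
begin

text \<open>
  Finitely supported functions \<open>int \<Rightarrow>\<^sub>0 int\<close> with the convolution product form the group ring
  of the infinite cyclic group, i.e. the ring of integral Laurent polynomials;
  \<open>Poly_Mapping.single k c\<close> is the monomial with coefficient \<open>c\<close> and exponent \<open>k\<close>.
\<close>
type_synonym laurent = "int \<Rightarrow>\<^sub>0 int"

abbreviation laurent_ring :: "laurent ring" where
  "laurent_ring \<equiv> ring_of_type_algebra"

definition Delta :: "int \<Rightarrow> laurent" where
  "Delta n = Poly_Mapping.single 1 n - Poly_Mapping.single 0 (2 * n + 1) + Poly_Mapping.single (- 1) n"

definition laurent_conj :: "laurent \<Rightarrow> laurent" where
  "laurent_conj p = Poly_Mapping.map_key uminus p"

definition Delta_ideal :: "int \<Rightarrow> laurent set" where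
  "Delta_ideal n = genideal laurent_ring {Delta n}"

definition alexander_ring :: "int \<Rightarrow> laurent set ring" where
  "alexander_ring n = laurent_ring Quot Delta_ideal n"

definition residue_class :: "int \<Rightarrow> laurent \<Rightarrow> laurent set" where
  "residue_class n p = Delta_ideal n +>\<^bsub>laurent_ring\<^esub> p"

text \<open>
  Elements of the quotient ring are cosets, and the induced involution maps a coset to its image;
  that this is the coset of the conjugate is \<open>quot_conj_residue_class\<close> below.
\<close>
definition quot_conj :: "laurent set \<Rightarrow> laurent set" where
  "quot_conj u = laurent_conj ` u"

definition unitary_units :: "int \<Rightarrow> laurent set set" where
  "unitary_units n = {u \<in> carrier (alexander_ring n).
     u \<otimes>\<^bsub>alexander_ring n\<^esub> quot_conj u = \<one>\<^bsub>alexander_ring n\<^esub>}"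

definition unitary_group :: "int \<Rightarrow> laurent set monoid" where
  "unitary_group n = \<lparr>carrier = unitary_units n, monoid.mult = monoid.mult (alexander_ring n),
     one = \<one>\<^bsub>alexander_ring n\<^esub>\<rparr>"

definition t_powers :: "int \<Rightarrow> laurent set set" where
  "t_powers n = generate (unitary_group n) {residue_class n (Poly_Mapping.single 1 1)}"

definition unitary_quotient :: "int \<Rightarrow> laurent set set monoid" where
  "unitary_quotient n = unitary_group n Mod t_powers n"

definition int_independent :: "('a, 'b) monoid_scheme \<Rightarrow> 'a set \<Rightarrow> bool" where
  "int_independent G S \<longleftrightarrow> finite S \<and> S \<subseteq> carrier G \<and>
     (\<forall>c :: 'a \<Rightarrow> int. (\<Otimes>\<^bsub>G\<^esub>s\<in>S. s [^]\<^bsub>G\<^esub> c s) = \<one>\<^bsub>G\<^esub> \<longrightarrow> (\<forall>s\<in>S. c s = 0))"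

text \<open>
  The rank of an abelian group is the supremum of the sizes of its finite subsets that are
  linearly independent over the integers; it is \<open>\<infinity>\<close> if these sizes are unbounded.
\<close>
definition group_rank :: "('a, 'b) monoid_scheme \<Rightarrow> enat" where
  "group_rank G = (SUP S \<in> {S. int_independent G S}. enat (card S))"

definition num_primes :: "int \<Rightarrow> nat" where
  "num_primes n = card {p :: nat. Factorial_Ring.prime p \<and> int p dvd n}"

lemma inj_uminus_int: "inj (uminus :: int \<Rightarrow> int)"
  by (simp add: inj_def)

lemma lookup_laurent_conj [simp]:
  "Poly_Mapping.lookup (laurent_conj p) k = Poly_Mapping.lookup p (- k)"
  by (simp add: laurent_conj_def Poly_Mapping.map_key.rep_eq[OF inj_uminus_int])

lemma laurent_conj_conj [simp]: "laurent_conj (laurent_conj p) = p"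
  by (rule poly_mapping_eqI) simp

lemma laurent_conj_add: "laurent_conj (p + q) = laurent_conj p + laurent_conj q"
  by (rule poly_mapping_eqI) (simp add: lookup_add)

lemma laurent_conj_single [simp]:
  "laurent_conj (Poly_Mapping.single k c) = Poly_Mapping.single (- k) c"
  by (rule poly_mapping_eqI) (auto simp: lookup_single when_def)

lemma laurent_induct [case_names zero single add]:
  fixes p :: laurent
  assumes "P 0" "\<And>k c. P (Poly_Mapping.single k c)" "\<And>p q. P p \<Longrightarrow> P q \<Longrightarrow> P (p + q)"
  shows "P p"
proof (induction p rule: update_induct)
  case const
  show ?case using assms(1) by simp
next
  case (update f a b)
  have "Poly_Mapping.update a b f = f + Poly_Mapping.single a b"
    using update(1,2)
    by (intro poly_mapping_eqI) (auto simp: lookup_update lookup_add lookup_single when_def in_keys_iff)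
  then show ?case using assms(2,3) update by simp
qed

lemma laurent_conj_mult: "laurent_conj (p * q) = laurent_conj p * laurent_conj q"
proof (induction p rule: laurent_induct)
  case zero
  have "laurent_conj 0 = 0" by (rule poly_mapping_eqI) simp
  then show ?case by simp
next
  case (single k c)
  show ?case
  proof (induction q rule: laurent_induct)
    case zero
    have "laurent_conj 0 = 0" by (rule poly_mapping_eqI) simp
    then show ?case by simp
  next
    case (single l d)
    show ?case by (simp add: mult_single)
  next
    case (add p q)
    then show ?case by (simp add: distrib_left laurent_conj_add)
  qed
next
  case (add p q)
  then show ?case by (simp add: distrib_right laurent_conj_add)
qed

lemma laurent_conj_one [simp]: "laurent_conj 1 = 1"
  using laurent_conj_single[of 0 1] by simp

lemma laurent_conj_Delta [simp]: "laurent_conj (Delta n) = Delta n"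
  by (rule poly_mapping_eqI)
     (auto simp: Delta_def lookup_add lookup_minus lookup_single when_def)

lemma laurent_ring_simps [simp]:
  "carrier laurent_ring = UNIV" "monoid.mult laurent_ring = (*)" "\<one>\<^bsub>laurent_ring\<^esub> = 1"
  "\<zero>\<^bsub>laurent_ring\<^esub> = 0" "add laurent_ring = (+)"
  by (simp_all add: ring_of_type_algebra_def fun_eq_iff)

interpretation laurent: cring laurent_ring
  by (rule cring_from_type_algebra)

lemma Delta_ideal_eq: "Delta_ideal n = {q * Delta n | q. True}"
  using laurent.cgenideal_eq_genideal[of "Delta n"]
  by (simp add: Delta_ideal_def cgenideal_def)

lemma ideal_Delta_ideal: "ideal (Delta_ideal n) laurent_ring"
  unfolding Delta_ideal_def by (rule laurent.genideal_ideal) simp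

lemma cring_alexander_ring: "cring (alexander_ring n)"
  unfolding alexander_ring_def
  by (rule ideal.quotient_is_cring[OF ideal_Delta_ideal laurent.is_cring])

lemma residue_class_eq: "residue_class n p = {q * Delta n + p | q. True}"
  by (auto simp: residue_class_def a_r_coset_def' Delta_ideal_eq)

lemma quot_conj_residue_class: "quot_conj (residue_class n p) = residue_class n (laurent_conj p)"
proof -
  have "quot_conj (residue_class n p) \<subseteq> residue_class n (laurent_conj p)" for p
    by (auto simp: quot_conj_def residue_class_eq laurent_conj_add laurent_conj_mult)
  moreover have "residue_class n (laurent_conj p) \<subseteq> quot_conj (residue_class n p)"
  proof
    fix x assume "x \<in> residue_class n (laurent_conj p)"
    then have "laurent_conj x \<in> residue_class n p"
      by (auto simp: residue_class_eq laurent_conj_add laurent_conj_mult)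
    then show "x \<in> quot_conj (residue_class n p)"
      unfolding quot_conj_def by (metis image_eqI laurent_conj_conj)
  qed
  ultimately show ?thesis by blast
qed

lemma carrier_alexander_ring: "carrier (alexander_ring n) = range (residue_class n)"
  by (auto simp: alexander_ring_def FactRing_def A_RCOSETS_defs a_r_coset_def residue_class_def)

lemma mult_residue_class:
  "residue_class n p \<otimes>\<^bsub>alexander_ring n\<^esub> residue_class n q = residue_class n (p * q)"
  using ideal.rcoset_mult_add[OF ideal_Delta_ideal, of p q n]
  by (simp add: alexander_ring_def FactRing_def residue_class_def)

lemma one_alexander_ring: "\<one>\<^bsub>alexander_ring n\<^esub> = residue_class n 1"
  by (simp add: alexander_ring_def FactRing_def residue_class_def)

lemma residue_class_in_unitary_units_iff:
  "residue_class n p \<in> unitary_units n \<longleftrightarrow> residue_class n (p * laurent_conj p) = residue_class n 1"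
  by (auto simp: unitary_units_def carrier_alexander_ring quot_conj_residue_class
      mult_residue_class one_alexander_ring)

lemma comm_group_unitary_group: "comm_group (unitary_group n)"
proof (rule comm_groupI)
  have rep: "\<exists>p. x = residue_class n p" if "x \<in> carrier (unitary_group n)" for x
    using that by (auto simp: unitary_group_def unitary_units_def carrier_alexander_ring)
  have mem: "residue_class n p \<in> carrier (unitary_group n) \<longleftrightarrow>
      residue_class n (p * laurent_conj p) = residue_class n 1" for p
    by (simp add: unitary_group_def residue_class_in_unitary_units_iff)
  have mul: "residue_class n p \<otimes>\<^bsub>unitary_group n\<^esub> residue_class n q = residue_class n (p * q)" for p q
    by (simp add: unitary_group_def mult_residue_class)
  have one: "\<one>\<^bsub>unitary_group n\<^esub> = residue_class n 1"
    by (simp add: unitary_group_def one_alexander_ring)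
  show "\<one>\<^bsub>unitary_group n\<^esub> \<in> carrier (unitary_group n)"
    by (simp add: one mem)
  fix x assume x: "x \<in> carrier (unitary_group n)"
  then obtain p where p: "x = residue_class n p" using rep by blast
  show "\<one>\<^bsub>unitary_group n\<^esub> \<otimes>\<^bsub>unitary_group n\<^esub> x = x"
    by (simp add: one p mul)
  have "residue_class n (laurent_conj p) \<in> carrier (unitary_group n)"
    using x by (simp add: p mem mult.commute)
  moreover have "residue_class n (laurent_conj p) \<otimes>\<^bsub>unitary_group n\<^esub> x = \<one>\<^bsub>unitary_group n\<^esub>"
    using x by (simp add: p mem mul one mult.commute)
  ultimately show "\<exists>y\<in>carrier (unitary_group n). y \<otimes>\<^bsub>unitary_group n\<^esub> x = \<one>\<^bsub>unitary_group n\<^esub>"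
    by blast
  fix y assume y: "y \<in> carrier (unitary_group n)"
  then obtain q where q: "y = residue_class n q" using rep by blast
  show "x \<otimes>\<^bsub>unitary_group n\<^esub> y = y \<otimes>\<^bsub>unitary_group n\<^esub> x"
    by (simp add: p q mul mult.commute)
  have "residue_class n (p * q * laurent_conj (p * q))
      = residue_class n (p * laurent_conj p) \<otimes>\<^bsub>unitary_group n\<^esub> residue_class n (q * laurent_conj q)"
    by (simp add: mul laurent_conj_mult mult_ac)
  also have "\<dots> = residue_class n 1 \<otimes>\<^bsub>unitary_group n\<^esub> residue_class n 1"
    using x y by (simp only: p q mem)
  finally show "x \<otimes>\<^bsub>unitary_group n\<^esub> y \<in> carrier (unitary_group n)"
    by (simp add: p q mul mem)
  fix z assume "z \<in> carrier (unitary_group n)"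
  then obtain r where r: "z = residue_class n r" using rep by blast
  show "x \<otimes>\<^bsub>unitary_group n\<^esub> y \<otimes>\<^bsub>unitary_group n\<^esub> z = x \<otimes>\<^bsub>unitary_group n\<^esub> (y \<otimes>\<^bsub>unitary_group n\<^esub> z)"
    by (simp add: p q r mul mult.assoc)
qed

lemma t_in_unitary_group: "residue_class n (Poly_Mapping.single 1 1) \<in> carrier (unitary_group n)"
  by (simp add: unitary_group_def residue_class_in_unitary_units_iff mult_single)

lemma subgroup_t_powers: "subgroup (t_powers n) (unitary_group n)"
  unfolding t_powers_def
  using comm_group_unitary_group t_in_unitary_group
  by (intro group.generate_is_subgroup) (auto simp: comm_group_def)

lemma comm_group_unitary_quotient: "comm_group (unitary_quotient n)"
  unfolding unitary_quotient_def
  by (intro comm_group.abelian_FactGroup comm_group_unitary_group subgroup_t_powers)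

end

theory Submission
  imports Defs "HOL-Analysis.Kronecker_Approximation_Theorem" "HOL-Number_Theory.Residues"
begin

text \<open>
  For \<open>n \<noteq> 0\<close> put \<open>w = n (t - 1)\<close>. Then \<open>w\<^sup>2 = w + n\<close>, the involution is \<open>w \<mapsto> 1 - w\<close>, \<open>n\<close> is invertible,
  and \<open>t = - w / (1 - w)\<close>; so the unitary units are the elements of norm \<open>1\<close> in \<open>\<int>[1/n][w]\<close>, an order of
  discriminant \<open>4 n + 1\<close>. Such an element is determined by its image under one embedding, as the other
  image is the inverse; hence they form a group of complex numbers, also when \<open>4 n + 1\<close> is a square.

  Every prime \<open>p\<close> dividing \<open>n\<close> splits as \<open>(p, w) (p, 1 - w)\<close>, and the valuations at the \<open>(p, w)\<close> map the
  norm-one group to a free abelian group. The kernel consists of the norm-one elements of \<open>\<int>[w]\<close>, which are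
  \<open>\<plusminus>1\<close> if \<open>n < -1\<close> or \<open>4 n + 1\<close> is a square, and \<open>\<plusminus>\<epsilon>\<^sup>k\<close> for a fundamental unit if \<open>n > 0\<close> and \<open>4 n + 1\<close> is not a
  square. The image has full rank: Dirichlet approximation gives elements of small norm in powers of
  \<open>(p, w)\<close>, and two of them that agree in norm and residue have a quotient that is a unit away from \<open>p\<close>.
  Since \<open>t\<close> has positive valuation at every \<open>(p, w)\<close>, dividing by it lowers the rank by one.

  For \<open>n = - p\<^sup>k\<close> the norm form is so steep that the only norm-one elements with valuation at most \<open>k / 2\<close>
  in absolute value are \<open>\<plusminus>1\<close> and, if \<open>k\<close> is even, \<open>\<plusminus>s\<close> and \<open>\<plusminus>s\<inverse>\<close> with \<open>s = w / p\<^bsup>k/2\<^esup>\<close> and \<open>s\<^sup>2 = - t\<close>.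
\<close>

section \<open>Rank of abelian groups\<close>

text \<open>The count behind the ranks: every prime divisor of \<open>n\<close> contributes one, a
  unit of infinite order in \<open>\<int>[w]\<close> one more, and \<open>t\<close> takes one away
  when it has infinite order. The count is zero for \<open>-p^k\<close> and for
  \<open>2 = 1 * 2\<close>, with one prime and only the units \<open>1\<close> and
  \<open>-1\<close>, and for \<open>1\<close>, where there is no prime and \<open>t\<close> itself
  is the unit.

  The obstacle is a square \<open>4 n + 1\<close>. Then \<open>w\<close> is an integer, and a
  complex number no longer determines its coordinates \<open>a\<close>, \<open>b\<close>. Identities
  are therefore carried in pairs, one under each embedding. A pair can be compared coordinate by
  coordinate, and divisibility of coordinates then does the work of ideals and localizations.

  One pigeonhole argument plays the part of the finite class group and of the unit theorem: among
  infinitely many elements of bounded norm (for the primes: bounded after removal of a power of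
  \<open>p\<close>), two agree in that norm \<open>c\<close> and modulo \<open>c\<close>, so that
  \<open>c\<close> divides the product of one with the conjugate of the other. For square
  \<open>4 n + 1\<close> nonzero elements may have norm \<open>0\<close>; there Euler's theorem
  supplies the elements instead.\<close>

lemma exists_int_relation:
  fixes A :: "'j \<Rightarrow> 's \<Rightarrow> int"
  assumes "finite J" "finite S" "card J < card S"
  shows "\<exists>c. (\<forall>j\<in>J. (\<Sum>s\<in>S. c s * A j s) = 0) \<and> (\<exists>s\<in>S. c s \<noteq> 0)"
  using assms
proof (induction J arbitrary: S A rule: finite_induct)
  case empty
  then have "S \<noteq> {}" by auto
  then show ?case by (intro exI[of _ "\<lambda>_. 1"]) auto
next
  case (insert j J)
  show ?case
  proof (cases "\<forall>s\<in>S. A j s = 0")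
    case True
    moreover obtain c where "\<forall>i\<in>J. (\<Sum>s\<in>S. c s * A i s) = 0" "\<exists>s\<in>S. c s \<noteq> 0"
      using insert.IH[of S A] insert.prems insert.hyps by auto
    ultimately show ?thesis by (intro exI[of _ c]) auto
  next
    case False
    then obtain s0 where s0: "s0 \<in> S" "A j s0 \<noteq> 0" by auto
    define S' where "S' = S - {s0}"
    have S': "finite S'" "s0 \<notin> S'" "S = insert s0 S'"
      using insert.prems s0 by (auto simp: S'_def)
    \<comment> \<open>Fraction-free Gaussian elimination: row \<open>j\<close> with pivot
      \<open>A j s0\<close> clears column \<open>s0\<close> from the other rows by
      cross-multiplication.\<close>
    have "card J < card S'"
      using insert.prems insert.hyps S' by simp
    then obtain c where c: "\<forall>i\<in>J. (\<Sum>s\<in>S'. c s * (A j s0 * A i s - A j s * A i s0)) = 0"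
      and nz: "\<exists>s\<in>S'. c s \<noteq> 0"
      using insert.IH[of S' "\<lambda>i s. A j s0 * A i s - A j s * A i s0"] S'(1) by auto
    \<comment> \<open>The coefficient at \<open>s0\<close> solves row \<open>j\<close>; scaling all
      others by the pivot keeps it an integer.\<close>
    define c' where "c' = (\<lambda>s. if s = s0 then - (\<Sum>s\<in>S'. c s * A j s) else A j s0 * c s)"
    have sum_c': "(\<Sum>s\<in>S. c' s * A i s) =
        - (\<Sum>s\<in>S'. c s * A j s) * A i s0 + (\<Sum>s\<in>S'. A j s0 * c s * A i s)" for i
    proof -
      have "(\<Sum>s\<in>S'. c' s * A i s) = (\<Sum>s\<in>S'. A j s0 * c s * A i s)"
        using S'(2) by (intro sum.cong) (auto simp: c'_def)
      then show ?thesis using S' by (simp add: c'_def)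
    qed
    have "(\<Sum>s\<in>S. c' s * A i s) = 0" if "i \<in> insert j J" for i
    proof (cases "i = j")
      case True
      show ?thesis unfolding sum_c' True
        by (simp add: sum_distrib_left sum_distrib_right mult_ac)
    next
      case False
      then have "(\<Sum>s\<in>S'. c s * (A j s0 * A i s - A j s * A i s0)) = 0"
        using c that by auto
      then show ?thesis unfolding sum_c'
        by (simp add: right_diff_distrib sum_subtractf sum_distrib_left sum_distrib_right mult_ac)
    qed
    moreover have "\<exists>s\<in>S. c' s \<noteq> 0"
      using nz s0 S' by (auto simp: c'_def)
    ultimately show ?thesis by blast
  qed
qed

context comm_group
begin

lemma hom_integer_group_finprod_pow:
  fixes c :: "'s \<Rightarrow> int"
  assumes "\<psi> \<in> hom G integer_group" "finite S" "f \<in> S \<rightarrow> carrier G"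
  shows "\<psi> (\<Otimes>s\<in>S. f s [^] c s) = (\<Sum>s\<in>S. c s * \<psi> (f s))"
proof -
  interpret h: group_hom G integer_group \<psi>
    using assms(1) by (simp add: group_hom_def group_hom_axioms_def is_group)
  show ?thesis
    using assms(2,3)
  proof (induction S rule: finite_induct)
    case empty
    then show ?case using h.hom_one by simp
  next
    case (insert s S)
    have [simp]: "f s \<in> carrier G" and fS: "f \<in> S \<rightarrow> carrier G" "(\<lambda>s. f s [^] c s) \<in> S \<rightarrow> carrier G"
      using insert.prems by auto
    have "\<psi> (f s [^] c s \<otimes> (\<Otimes>s\<in>S. f s [^] c s)) = \<psi> (f s [^] c s) + \<psi> (\<Otimes>s\<in>S. f s [^] c s)"
      using fS by (subst h.hom_mult) auto
    also have "\<psi> (f s [^] c s) = c s * \<psi> (f s)"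
      by (simp add: h.hom_int_pow)
    finally show ?case
      using insert.IH[OF fS(1)] insert.hyps fS by (simp add: finprod_insert)
  qed
qed

lemma finprod_pow_add:
  fixes c d :: "'s \<Rightarrow> int"
  assumes "finite S" "f \<in> S \<rightarrow> carrier G"
  shows "(\<Otimes>s\<in>S. f s [^] (c s + d s)) = (\<Otimes>s\<in>S. f s [^] c s) \<otimes> (\<Otimes>s\<in>S. f s [^] d s)"
proof -
  have "(\<Otimes>s\<in>S. f s [^] (c s + d s)) = (\<Otimes>s\<in>S. f s [^] c s \<otimes> f s [^] d s)"
    using assms by (intro finprod_cong') (auto simp: Pi_iff int_pow_mult)
  then show ?thesis using assms by (subst (asm) finprod_multf) auto
qed

lemma finprod_pow_mult:
  fixes c :: "'s \<Rightarrow> int" and m :: int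
  assumes "finite S" "f \<in> S \<rightarrow> carrier G"
  shows "(\<Otimes>s\<in>S. f s [^] (m * c s)) = (\<Otimes>s\<in>S. f s [^] c s) [^] m"
  using assms
proof (induction S rule: finite_induct)
  case (insert s S)
  have [simp]: "f s \<in> carrier G" and fS: "f \<in> S \<rightarrow> carrier G"
      "(\<lambda>s. f s [^] c s) \<in> S \<rightarrow> carrier G" "(\<lambda>s. f s [^] (m * c s)) \<in> S \<rightarrow> carrier G"
    using insert.prems by auto
  have "f s [^] (m * c s) = (f s [^] c s) [^] m"
    by (simp add: int_pow_pow mult.commute)
  then show ?case
    using insert fS by (simp add: finprod_insert int_pow_distrib)
qed simp

lemma int_independentD:
  fixes c :: "'a \<Rightarrow> int"
  assumes "int_independent G S" "(\<Otimes>s\<in>S. s [^] c s) = \<one>" "s \<in> S"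
  shows "c s = 0"
  using assms unfolding int_independent_def by blast

text \<open>Stated for an indexed family because the elements to which it is applied come from a
  choice function. Independence makes the family injective by itself: two equal members satisfy the
  relation with coefficients \<open>1\<close> and \<open>- 1\<close>.\<close>

lemma group_rank_ge_card:
  fixes f :: "'s \<Rightarrow> 'a"
  assumes A: "finite A" "f \<in> A \<rightarrow> carrier G"
    and indep: "\<And>c :: 's \<Rightarrow> int. (\<Otimes>s\<in>A. f s [^] c s) = \<one> \<Longrightarrow> \<forall>s\<in>A. c s = 0"
  shows "enat (card A) \<le> group_rank G"
proof -
  have inj: "inj_on f A"
  proof (rule inj_onI, rule ccontr)
    fix a b assume ab: "a \<in> A" "b \<in> A" "f a = f b" "a \<noteq> b"
    define c :: "'s \<Rightarrow> int" where "c = (\<lambda>s. if s = a then 1 else if s = b then - 1 else 0)"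
    have [simp]: "f a \<in> carrier G" "f b \<in> carrier G" using A ab by auto
    have "(\<Otimes>s\<in>A. f s [^] c s) = (\<Otimes>s\<in>{a, b}. f s [^] c s)"
      using A ab by (intro finprod_mono_neutral_cong_right) (auto simp: c_def)
    also have "\<dots> = f a \<otimes> inv f b"
      using ab by (subst finprod_insert) (auto simp: c_def int_pow_neg)
    also have "\<dots> = \<one>" using ab by simp
    finally have "c a = 0" using indep ab by blast
    then show False by (simp add: c_def)
  qed
  have "int_independent G (f ` A)"
    unfolding int_independent_def
  proof (intro conjI allI impI ballI)
    fix c :: "'a \<Rightarrow> int" and s assume "(\<Otimes>s\<in>f ` A. s [^] c s) = \<one>" and s: "s \<in> f ` A"
    then have "(\<Otimes>s\<in>A. f s [^] c (f s)) = \<one>"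
      using A inj by (subst (asm) finprod_reindex) auto
    then show "c s = 0" using indep[of "\<lambda>s. c (f s)"] s by blast
  qed (use A in auto)
  then have "enat (card (f ` A)) \<le> group_rank G"
    unfolding group_rank_def by (intro SUP_upper) simp
  then show ?thesis by (simp add: card_image inj)
qed

text \<open>With more elements than homomorphisms, some nontrivial combination is killed by all of
  them. It is torsion, so a multiple of its coefficient vector is a true relation.\<close>

lemma group_rank_le_card:
  fixes \<psi> :: "'j \<Rightarrow> 'a \<Rightarrow> int"
  assumes J: "finite J" "\<And>j. j \<in> J \<Longrightarrow> \<psi> j \<in> hom G integer_group"
    and tors: "\<And>g. g \<in> carrier G \<Longrightarrow> (\<And>j. j \<in> J \<Longrightarrow> \<psi> j g = 0) \<Longrightarrow> \<exists>m::int. m \<noteq> 0 \<and> g [^] m = \<one>"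
  shows "group_rank G \<le> enat (card J)"
  unfolding group_rank_def
proof (rule SUP_least, simp, rule ccontr)
  fix S assume S: "int_independent G S" and "\<not> card S \<le> card J"
  then have fin: "finite S" "(\<lambda>s. s) \<in> S \<rightarrow> carrier G" and "card J < card S"
    by (auto simp: int_independent_def)
  then obtain c where c: "\<forall>j\<in>J. (\<Sum>s\<in>S. c s * \<psi> j s) = 0" "\<exists>s\<in>S. c s \<noteq> 0"
    using exists_int_relation[of J S \<psi>] J(1) by blast
  define g where "g = (\<Otimes>s\<in>S. s [^] c s)"
  have "g \<in> carrier G" using fin(2) by (auto simp: g_def intro!: finprod_closed)
  moreover have "\<psi> j g = 0" if "j \<in> J" for j
    using hom_integer_group_finprod_pow[OF J(2)[OF that] fin] c(1) that by (simp add: g_def)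
  ultimately obtain m :: int where m: "m \<noteq> 0" "g [^] m = \<one>" using tors by blast
  then have "(\<Otimes>s\<in>S. s [^] (m * c s)) = \<one>"
    using finprod_pow_mult[OF fin] by (simp add: g_def)
  then have "m * c s = 0" if "s \<in> S" for s
    using int_independentD[OF S, of "\<lambda>s. m * c s"] that by blast
  then show False using m c(2) by auto
qed

text \<open>Here a combination killed by all homomorphisms is only commensurable with a power of
  \<open>e\<close>. Two such combinations that are not proportional are needed, so that
  \<open>e\<close> can be eliminated between them.\<close>

lemma group_rank_le_Suc_card:
  fixes \<psi> :: "'j \<Rightarrow> 'a \<Rightarrow> int"
  assumes J: "finite J" "\<And>j. j \<in> J \<Longrightarrow> \<psi> j \<in> hom G integer_group" and e: "e \<in> carrier G"
    and ker: "\<And>g. g \<in> carrier G \<Longrightarrow> (\<And>j. j \<in> J \<Longrightarrow> \<psi> j g = 0) \<Longrightarrow>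
      \<exists>(m::int) k::int. m \<noteq> 0 \<and> g [^] m = e [^] k"
  shows "group_rank G \<le> enat (Suc (card J))"
  unfolding group_rank_def
proof (rule SUP_least, simp, rule ccontr)
  fix S assume S: "int_independent G S" and "\<not> card S \<le> Suc (card J)"
  then have fin: "finite S" "(\<lambda>s. s) \<in> S \<rightarrow> carrier G" and card: "Suc (card J) < card S"
    by (auto simp: int_independent_def)
  \<comment> \<open>As \<open>S\<close> has at least \<open>card J + 2\<close> elements, one of them
    can be left out and a relation still exists.\<close>
  have rel: "\<exists>c::'a \<Rightarrow> int. c s0 = 0 \<and> (\<exists>s\<in>S. c s \<noteq> 0) \<and>
      (\<exists>(m::int) k::int. m \<noteq> 0 \<and> (\<Otimes>s\<in>S. s [^] c s) [^] m = e [^] k)" if s0: "s0 \<in> S" for s0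
  proof -
    have "card J < card (S - {s0})" using card fin s0 by simp
    then obtain c where c: "\<forall>j\<in>J. (\<Sum>s\<in>S - {s0}. c s * \<psi> j s) = 0" "\<exists>s\<in>S - {s0}. c s \<noteq> 0"
      using exists_int_relation[of J "S - {s0}" \<psi>] J(1) fin(1) by blast
    define c' where "c' = c(s0 := 0)"
    have c': "(\<Sum>s\<in>S. c' s * \<psi> j s) = (\<Sum>s\<in>S - {s0}. c s * \<psi> j s)" for j
      using fin(1) s0 by (subst sum.remove[of S s0]) (auto simp: c'_def intro!: sum.cong)
    define g where "g = (\<Otimes>s\<in>S. s [^] c' s)"
    have "g \<in> carrier G" using fin(2) by (auto simp: g_def intro!: finprod_closed)
    moreover have "\<psi> j g = 0" if "j \<in> J" for j
      using hom_integer_group_finprod_pow[OF J(2)[OF that] fin] c(1) c' that by (simp add: g_def)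
    ultimately show ?thesis
      using ker[of g] c(2) by (intro exI[of _ c']) (auto simp: c'_def g_def)
  qed
  obtain s0 where "s0 \<in> S" using card by fastforce
  with rel obtain c :: "'a \<Rightarrow> int" and m k :: int
    where c: "\<exists>s\<in>S. c s \<noteq> 0" and m: "m \<noteq> 0" "(\<Otimes>s\<in>S. s [^] c s) [^] m = e [^] k" by metis
  then obtain s1 where s1: "s1 \<in> S" "c s1 \<noteq> 0" by blast
  \<comment> \<open>The second relation avoids \<open>s1\<close>, where the first is nonzero, so the
    two are not proportional.\<close>
  with rel obtain c' :: "'a \<Rightarrow> int" and m' k' :: int
    where c': "c' s1 = 0" "\<exists>s\<in>S. c' s \<noteq> 0" and m': "m' \<noteq> 0" "(\<Otimes>s\<in>S. s [^] c' s) [^] m' = e [^] k'"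
    by metis
  define g where "g = (\<Otimes>s\<in>S. s [^] c s)"
  define g' where "g' = (\<Otimes>s\<in>S. s [^] c' s)"
  have g: "g \<in> carrier G" "g' \<in> carrier G"
    using fin(2) by (auto simp: g_def g'_def intro!: finprod_closed)
  show False
  proof (cases "k' = 0")
    case True
    then have "(\<Otimes>s\<in>S. s [^] (m' * c' s)) = \<one>"
      using finprod_pow_mult[OF fin] m' by simp
    then have "m' * c' s = 0" if "s \<in> S" for s
      using int_independentD[OF S, of "\<lambda>s. m' * c' s"] that by blast
    then show False using m' c'(2) by auto
  next
    case False
    \<comment> \<open>Raise both combinations to the same power of \<open>e\<close> and
      divide.\<close>
    have "g [^] (m * k') = (g [^] m) [^] k'" using g by (simp add: int_pow_pow)
    also have "\<dots> = e [^] (k * k')" using m e by (simp add: g_def int_pow_pow)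
    also have "\<dots> = (g' [^] m') [^] k" using m' e by (simp add: g'_def int_pow_pow mult.commute)
    also have "\<dots> = g' [^] (m' * k)" using g by (simp add: int_pow_pow)
    finally have "g [^] (m * k') \<otimes> g' [^] (- (m' * k)) = \<one>"
      using g by (simp add: int_pow_neg)
    then have "(\<Otimes>s\<in>S. s [^] (m * k' * c s + - (m' * k) * c' s)) = \<one>"
      unfolding finprod_pow_add[OF fin] finprod_pow_mult[OF fin] g_def g'_def .
    then have "m * k' * c s1 + - (m' * k) * c' s1 = 0"
      using int_independentD[OF S, of "\<lambda>s. m * k' * c s + - (m' * k) * c' s"] s1 by blast
    then show False using s1 c' m False by auto
  qed
qed

lemma finite_imp_group_rank_0:
  assumes "finite (carrier G)"
  shows "group_rank G = 0"
proof -
  have "group_rank G \<le> enat (card ({} :: nat set))"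
  proof (rule group_rank_le_card[where \<psi> = "\<lambda>_ _. 0"])
    fix g assume "g \<in> carrier G"
    then have "g [^] int (Coset.order G) = \<one>"
      using pow_order_eq_1 by (simp add: int_pow_int)
    then show "\<exists>m::int. m \<noteq> 0 \<and> g [^] m = \<one>"
      using assms order_gt_0_iff_finite by (intro exI[of _ "int (Coset.order G)"]) auto
  qed auto
  then show ?thesis by (simp add: zero_enat_def[symmetric])
qed

text \<open>The matrix of values \<open>\<psi> i (f j)\<close> is diagonal with nonzero diagonal,
  which gives independence at once.\<close>

lemma group_rank_eq_card:
  fixes \<psi> :: "'j \<Rightarrow> 'a \<Rightarrow> int"
  assumes J: "finite J" "\<And>j. j \<in> J \<Longrightarrow> \<psi> j \<in> hom G integer_group"
    and tors: "\<And>g. g \<in> carrier G \<Longrightarrow> (\<And>j. j \<in> J \<Longrightarrow> \<psi> j g = 0) \<Longrightarrow> \<exists>m::int. m \<noteq> 0 \<and> g [^] m = \<one>"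
    and f: "f \<in> J \<rightarrow> carrier G" "\<And>j. j \<in> J \<Longrightarrow> \<psi> j (f j) \<noteq> 0"
      "\<And>i j. i \<in> J \<Longrightarrow> j \<in> J \<Longrightarrow> i \<noteq> j \<Longrightarrow> \<psi> i (f j) = 0"
  shows "group_rank G = enat (card J)"
proof (rule antisym)
  show "enat (card J) \<le> group_rank G"
  proof (rule group_rank_ge_card[OF J(1) f(1)], rule ballI)
    fix c :: "'j \<Rightarrow> int" and i assume one: "(\<Otimes>s\<in>J. f s [^] c s) = \<one>" and i: "i \<in> J"
    have "\<psi> i \<one> = 0"
      using group_hom.hom_one[of G integer_group "\<psi> i"] J(2)[OF i] is_group
      by (simp add: group_hom_def group_hom_axioms_def)
    then have "0 = (\<Sum>s\<in>J. c s * \<psi> i (f s))"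
      using hom_integer_group_finprod_pow[OF J(2)[OF i] J(1) f(1), of c] one by simp
    also have "\<dots> = (\<Sum>s\<in>{i}. c s * \<psi> i (f s))"
      using i f(3) J(1) by (intro sum.mono_neutral_right) auto
    finally show "c i = 0" using f(2)[OF i] by simp
  qed
qed (rule group_rank_le_card[OF J tors])

lemma group_rank_eq_Suc_card:
  fixes \<psi> :: "'j \<Rightarrow> 'a \<Rightarrow> int"
  assumes J: "finite J" "\<And>j. j \<in> J \<Longrightarrow> \<psi> j \<in> hom G integer_group"
    and e: "e \<in> carrier G" "\<And>j. j \<in> J \<Longrightarrow> \<psi> j e = 0" "\<And>m::int. e [^] m = \<one> \<Longrightarrow> m = 0"
    and ker: "\<And>g. g \<in> carrier G \<Longrightarrow> (\<And>j. j \<in> J \<Longrightarrow> \<psi> j g = 0) \<Longrightarrow>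
      \<exists>(m::int) k::int. m \<noteq> 0 \<and> g [^] m = e [^] k"
    and f: "f \<in> J \<rightarrow> carrier G" "\<And>j. j \<in> J \<Longrightarrow> \<psi> j (f j) \<noteq> 0"
      "\<And>i j. i \<in> J \<Longrightarrow> j \<in> J \<Longrightarrow> i \<noteq> j \<Longrightarrow> \<psi> i (f j) = 0"
  shows "group_rank G = enat (Suc (card J))"
proof (rule antisym)
  define f' where "f' = case_option e f"
  define A where "A = insert None (Some ` J)"
  have A: "finite A" "f' \<in> A \<rightarrow> carrier G" "card A = Suc (card J)"
    using J(1) e(1) f(1) by (auto simp: A_def f'_def card_image)
  have "enat (card A) \<le> group_rank G"
  proof (rule group_rank_ge_card[OF A(1,2)])
    fix c :: "'j option \<Rightarrow> int" assume one: "(\<Otimes>s\<in>A. f' s [^] c s) = \<one>"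
    have c: "c (Some i) = 0" if i: "i \<in> J" for i
    proof -
      have "\<psi> i \<one> = 0"
        using group_hom.hom_one[of G integer_group "\<psi> i"] J(2)[OF i] is_group
        by (simp add: group_hom_def group_hom_axioms_def)
      then have "0 = (\<Sum>s\<in>A. c s * \<psi> i (f' s))"
        using hom_integer_group_finprod_pow[OF J(2)[OF i] A(1,2), of c] one by simp
      moreover have f0: "\<psi> i (f j) = 0" if "j \<in> J" "j \<noteq> i" for j
        using f(3)[OF i, of j] that by auto
      have "(\<Sum>s\<in>A. c s * \<psi> i (f' s)) = (\<Sum>s\<in>{Some i}. c s * \<psi> i (f' s))"
        using i J(1) e(2) A by (intro sum.mono_neutral_right) (auto simp: A_def f'_def, use f0 in blast)
      ultimately show "c (Some i) = 0" using f(2)[OF i] by (simp add: f'_def)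
    qed
    have "(\<Otimes>s\<in>A. f' s [^] c s) = (\<Otimes>s\<in>{None}. f' s [^] c s)"
      using A e(1) c by (intro finprod_mono_neutral_cong_right) (auto simp: A_def f'_def)
    then have "e [^] c None = \<one>" using one e(1) by (simp add: finprod_insert f'_def)
    then show "\<forall>s\<in>A. c s = 0" using c e(3) by (auto simp: A_def)
  qed
  then show "enat (Suc (card J)) \<le> group_rank G" by (simp add: A(3))
qed (rule group_rank_le_Suc_card[OF J e(1) ker])

lemma iso_integer_mod_group:
  assumes x: "x \<in> carrier G" "carrier G = range (\<lambda>k::int. x [^] k)" and N: "N > 0"
    and ord: "\<And>k::int. x [^] k = \<one> \<longleftrightarrow> int N dvd k"
  shows "G \<cong> integer_mod_group N"
proof -
  have eq: "x [^] (k::int) = x [^] l \<longleftrightarrow> int N dvd k - l" for k l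
    unfolding ord[symmetric] int_pow_diff[OF x(1)] using x(1)
    by (metis int_pow_closed inv_closed inv_equality inv_inv r_inv)
  have mod: "x [^] (k mod int N) = x [^] k" for k
    by (simp add: eq mod_eq_dvd_iff[symmetric])
  have "(\<lambda>k::int. x [^] k) \<in> iso (integer_mod_group N) G"
    unfolding iso_def
  proof (intro CollectI conjI)
    show "(\<lambda>k::int. x [^] k) \<in> hom (integer_mod_group N) G"
      using x(1) by (auto simp: hom_def mod int_pow_mult)
    show "bij_betw (\<lambda>k::int. x [^] k) (carrier (integer_mod_group N)) (carrier G)"
      unfolding bij_betw_def
    proof
      show "inj_on (\<lambda>k::int. x [^] k) (carrier (integer_mod_group N))"
        using N by (auto simp: inj_on_def carrier_integer_mod_group eq mod_eq_dvd_iff[symmetric])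
      show "(\<lambda>k::int. x [^] k) ` carrier (integer_mod_group N) = carrier G"
      proof
        show "carrier G \<subseteq> (\<lambda>k::int. x [^] k) ` carrier (integer_mod_group N)"
        proof
          fix g assume "g \<in> carrier G"
          then obtain k :: int where "g = x [^] k" using x(2) by auto
          then have "g = x [^] (k mod int N)" by (simp add: mod)
          then show "g \<in> (\<lambda>k::int. x [^] k) ` carrier (integer_mod_group N)"
            using N by (auto simp: carrier_integer_mod_group)
        qed
      qed (use x(1) in auto)
    qed
  qed
  then show ?thesis
    using group.iso_sym[OF group_integer_mod_group] by (auto simp: is_iso_def)
qed

end

section \<open>Evaluation of Laurent polynomials modulo \<open>Delta n\<close>\<close>

definition laurent_eval :: "complex \<Rightarrow> laurent \<Rightarrow> complex" where
  "laurent_eval x p = (\<Sum>k\<in>Poly_Mapping.keys p. of_int (Poly_Mapping.lookup p k) * x powi k)"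

lemma laurent_eval_superset:
  assumes "finite A" "Poly_Mapping.keys p \<subseteq> A"
  shows "laurent_eval x p = (\<Sum>k\<in>A. of_int (Poly_Mapping.lookup p k) * x powi k)"
  unfolding laurent_eval_def using assms
  by (intro sum.mono_neutral_left) (auto simp: in_keys_iff)

lemma laurent_eval_zero [simp]: "laurent_eval x 0 = 0"
  by (simp add: laurent_eval_def)

lemma laurent_eval_add: "laurent_eval x (p + q) = laurent_eval x p + laurent_eval x q"
proof -
  let ?A = "Poly_Mapping.keys p \<union> Poly_Mapping.keys q"
  have "finite ?A" "Poly_Mapping.keys (p + q) \<subseteq> ?A"
    using Poly_Mapping.keys_add[of p q] by auto
  then show ?thesis
    by (simp add: laurent_eval_superset[where A = ?A] lookup_add algebra_simps sum.distrib)
qed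

lemma laurent_eval_single [simp]: "laurent_eval x (Poly_Mapping.single k c) = of_int c * x powi k"
  by (subst laurent_eval_superset[of "{k}"]) auto

lemma laurent_eval_one [simp]: "laurent_eval x 1 = 1"
  using laurent_eval_single[of x 0 1] by (simp del: laurent_eval_single)

lemma laurent_eval_of_int [simp]: "laurent_eval x (of_int c) = of_int c"
  using laurent_eval_single[of x 0 c] single_of_int[of c, where 'a = int and 'b = int]
  by (simp del: laurent_eval_single)

lemma laurent_eval_diff: "laurent_eval x (p - q) = laurent_eval x p - laurent_eval x q"
  using laurent_eval_add[of x "p - q" q] by simp

lemma laurent_eval_mult:
  assumes "x \<noteq> 0"
  shows "laurent_eval x (p * q) = laurent_eval x p * laurent_eval x q"
proof (induction p rule: laurent_induct)
  case (single k c)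
  show ?case
  proof (induction q rule: laurent_induct)
    case (single l d)
    show ?case using assms by (simp add: mult_single power_int_add)
  next
    case (add p q)
    then show ?case by (simp only: distrib_left laurent_eval_add)
  qed simp
next
  case (add p q)
  then show ?case by (simp only: distrib_right laurent_eval_add)
qed simp

lemma laurent_eval_power:
  assumes "x \<noteq> 0"
  shows "laurent_eval x (p ^ k) = laurent_eval x p ^ k"
  by (induction k) (simp_all add: laurent_eval_mult assms)

lemma laurent_eval_conj: "laurent_eval x (laurent_conj p) = laurent_eval (inverse x) p"
proof (induction p rule: laurent_induct)
  case zero
  have "laurent_conj 0 = 0" by (rule poly_mapping_eqI) simp
  then show ?case by simp
qed (simp_all add: laurent_conj_add laurent_eval_add power_int_minus power_int_inverse)

lemma residue_class_eq_iff: "residue_class n p = residue_class n q \<longleftrightarrow> Delta n dvd p - q"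
proof
  assume "residue_class n p = residue_class n q"
  moreover have "p \<in> residue_class n p" unfolding residue_class_eq by (auto intro: exI[of _ 0])
  ultimately obtain r where "p = r * Delta n + q" by (auto simp: residue_class_eq)
  then show "Delta n dvd p - q" by simp
next
  assume "Delta n dvd p - q"
  then obtain r where "p - q = Delta n * r" by (auto simp: dvd_def)
  then have r: "p = q + Delta n * r" by (simp add: algebra_simps)
  show "residue_class n p = residue_class n q"
  proof (intro equalityI subsetI)
    fix x assume "x \<in> residue_class n p"
    then obtain s where "x = s * Delta n + p" by (auto simp: residue_class_eq)
    then have "x = (s + r) * Delta n + q" by (simp add: r algebra_simps)
    then show "x \<in> residue_class n q" by (auto simp: residue_class_eq)
  next
    fix x assume "x \<in> residue_class n q"
    then obtain s where "x = s * Delta n + q" by (auto simp: residue_class_eq)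
    then have "x = (s - r) * Delta n + p" by (simp add: r algebra_simps)
    then show "x \<in> residue_class n p" by (auto simp: residue_class_eq)
  qed
qed

lemma single_eq_of_int_mult: "Poly_Mapping.single k c = of_int c * (Poly_Mapping.single k 1 :: laurent)"
proof -
  have "(of_int c :: laurent) = Poly_Mapping.single 0 c"
    using single_of_int[of c, where 'a = int and 'b = int] by simp
  then show ?thesis by (simp add: mult_single)
qed

lemma T_inverse: "(Poly_Mapping.single 1 1 :: laurent) * Poly_Mapping.single (- 1) 1 = 1"
  by (simp add: mult_single)

text \<open>The root \<open>w\<close> stays a parameter, since the cases choose it differently: a
  complex root in general, a real one for positive \<open>n\<close>, and the integer
  \<open>m + 1\<close> if \<open>n = m * (m + 1)\<close>.\<close>

locale quadratic_order =
  fixes n :: int and w :: complex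
  assumes n_nonzero: "n \<noteq> 0" and w_square: "w * w = w + of_int n"
begin

text \<open>The two embeddings of \<open>a + b w \<in> \<int>[w]\<close> and its norm.\<close>
definition E1 :: "int \<Rightarrow> int \<Rightarrow> complex" where "E1 a b = of_int a + of_int b * w"
definition E2 :: "int \<Rightarrow> int \<Rightarrow> complex" where "E2 a b = of_int a + of_int b * (1 - w)"
definition nrm :: "int \<Rightarrow> int \<Rightarrow> int" where "nrm a b = a * a + a * b - n * b * b"

text \<open>Equality would make the discriminant \<open>4 n + 1\<close> vanish, which is impossible
  modulo 4.\<close>

lemma w_neq_conj: "w \<noteq> 1 - w"
proof
  assume w: "w = 1 - w"
  have "4 * of_int n + 1 = (0::complex)"
    using w w_square by Groebner_Basis.algebra
  then have "complex_of_int (4 * n) = of_int (- 1)" by (simp add: eq_neg_iff_add_eq_0)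
  then have "4 * n = - 1" by (simp only: of_int_eq_iff)
  then show False by presburger
qed

lemma E1_mult: "E1 a b * E1 c d = E1 (a * c + n * b * d) (a * d + b * c + b * d)"
proof -
  have "E1 a b * E1 c d = of_int a * of_int c + (of_int a * of_int d + of_int b * of_int c) * w
      + of_int b * of_int d * (w * w)"
    by (simp add: E1_def algebra_simps)
  then show ?thesis unfolding w_square by (simp add: E1_def algebra_simps)
qed

lemma E2_mult: "E2 a b * E2 c d = E2 (a * c + n * b * d) (a * d + b * c + b * d)"
proof -
  have "(1 - w) * (1 - w) = (1 - w) + of_int n" using w_square by (simp add: algebra_simps)
  moreover have "E2 a b * E2 c d = of_int a * of_int c
      + (of_int a * of_int d + of_int b * of_int c) * (1 - w)
      + of_int b * of_int d * ((1 - w) * (1 - w))"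
    by (simp add: E2_def algebra_simps)
  ultimately show ?thesis by (simp add: E2_def algebra_simps)
qed

lemma E2_eq_E1: "E2 a b = E1 (a + b) (- b)"
  by (simp add: E1_def E2_def algebra_simps)

lemma E1_eq_E2: "E1 a b = E2 (a + b) (- b)"
  by (simp add: E1_def E2_def algebra_simps)

lemma E1_E2: "E1 a b * E2 a b = of_int (nrm a b)"
  unfolding E2_eq_E1 E1_mult by (simp add: E1_def nrm_def algebra_simps)

lemma E_of_int: "E1 a 0 = of_int a" "E2 a 0 = of_int a"
  by (simp_all add: E1_def E2_def)

text \<open>The difference of the embeddings recovers \<open>b\<close>, because \<open>w\<close> and
  \<open>1 - w\<close> differ. This holds even if \<open>w\<close> is an integer, where
  \<open>E1\<close> alone has a kernel.\<close>

lemma E_inject: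
  assumes "E1 a b = E1 c d" "E2 a b = E2 c d"
  shows "a = c" "b = d"
proof -
  have "of_int (b - d) * (w - (1 - w)) = (E1 a b - E1 c d) - (E2 a b - E2 c d)"
    by (simp add: E1_def E2_def algebra_simps)
  then have "of_int (b - d) * (w - (1 - w)) = 0" using assms by simp
  then show "b = d" using w_neq_conj by simp
  then show "a = c" using assms by (simp add: E1_def)
qed

lemma nrm_mult: "nrm (a * c + n * b * d) (a * d + b * c + b * d) = nrm a b * nrm c d"
  by (simp add: nrm_def algebra_simps)

definition tau :: complex where "tau = 1 + w / of_int n"

declare n_nonzero [simp]

lemma tau_mult_conj: "tau * (1 + (1 - w) / of_int n) = 1"
proof -
  define u where "u = 1 / complex_of_int n"
  have "of_int n * u = 1" by (simp add: u_def)
  then have "(1 + w * u) * (1 + (1 - w) * u) = 1"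
    using w_square by Groebner_Basis.algebra
  then show ?thesis by (simp add: tau_def u_def)
qed

lemma tau_nonzero [simp]: "tau \<noteq> 0"
  using tau_mult_conj by auto

lemma inverse_tau: "inverse tau = 1 + (1 - w) / of_int n"
  using tau_mult_conj by (simp add: inverse_unique)

lemma tau_eq: "tau * (1 - w) = - w"
proof -
  define u where "u = 1 / complex_of_int n"
  have "of_int n * u = 1" by (simp add: u_def)
  then have "(1 + w * u) * (1 - w) = - w"
    using w_square by Groebner_Basis.algebra
  then show ?thesis by (simp add: tau_def u_def)
qed

text \<open>Laurent polynomials reducing to \<open>w\<close> and to \<open>1 / n\<close>.\<close>
definition W :: laurent where "W = of_int n * (Poly_Mapping.single 1 1 - 1)"
definition M :: laurent where "M = Poly_Mapping.single 1 1 - 2 + Poly_Mapping.single (- 1) 1"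

lemma Delta_eq: "Delta n = of_int n * M - 1"
proof -
  have "Poly_Mapping.single 0 (2 * n + 1) = (of_int (2 * n + 1) :: laurent)"
    using single_of_int[of "2 * n + 1", where 'a = int and 'b = int] by simp
  then show ?thesis
    unfolding Delta_def M_def single_eq_of_int_mult[of 1 n] single_eq_of_int_mult[of "-1" n]
    by (simp add: algebra_simps)
qed

lemma W_square: "W * W = W + of_int n + of_int n * Poly_Mapping.single 1 1 * Delta n"
proof -
  have "T * T = T * (T - 2 + T') + 2 * T - 1" if "T * T' = 1" for T T' :: laurent
    using that by Groebner_Basis.algebra
  note * = this[OF T_inverse, folded M_def]
  have "W * W = of_int n * of_int n * (Poly_Mapping.single 1 1 * Poly_Mapping.single 1 1 - 2 * Poly_Mapping.single 1 1 + 1)"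
    by (simp add: W_def algebra_simps)
  also have "\<dots> = of_int n * of_int n * (Poly_Mapping.single 1 1 * M)"
    unfolding * by simp
  also have "\<dots> = W + of_int n + of_int n * Poly_Mapping.single 1 1 * Delta n"
    by (simp add: W_def Delta_eq algebra_simps)
  finally show ?thesis .
qed

lemma Delta_dvd_inverse_power: "Delta n dvd (of_int n * M) ^ k - 1"
  unfolding Delta_eq by (metis dvd_triv_left power_diff_1_eq)

text \<open>Expresses \<open>p = (a + b w) / n^k\<close> inside the quotient ring: modulo
  \<open>Delta n\<close> the Laurent polynomial \<open>M\<close> is the inverse of \<open>n\<close>,
  so denominators can be written as powers of \<open>M\<close>.\<close>

definition fractional :: "laurent \<Rightarrow> bool" where
  "fractional p \<longleftrightarrow> (\<exists>k a b. Delta n dvd p - (of_int a + of_int b * W) * M ^ k)"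

lemma fractional_add:
  assumes "fractional p" "fractional q"
  shows "fractional (p + q)"
proof -
  obtain k a b where "Delta n dvd p - (of_int a + of_int b * W) * M ^ k"
    using assms by (auto simp: fractional_def)
  then obtain r where r: "p = (of_int a + of_int b * W) * M ^ k + Delta n * r"
    by (metis diff_eq_eq add.commute dvd_def)
  obtain l c d where "Delta n dvd q - (of_int c + of_int d * W) * M ^ l"
    using assms by (auto simp: fractional_def)
  then obtain s where s: "q = (of_int c + of_int d * W) * M ^ l + Delta n * s"
    by (metis diff_eq_eq add.commute dvd_def)
  obtain x where x: "of_int n ^ l * M ^ l = 1 + Delta n * x"
    using Delta_dvd_inverse_power[of l] by (metis diff_eq_eq add.commute dvd_def power_mult_distrib)
  obtain y where y: "of_int n ^ k * M ^ k = 1 + Delta n * y"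
    using Delta_dvd_inverse_power[of k] by (metis diff_eq_eq add.commute dvd_def power_mult_distrib)
  define \<alpha> where "\<alpha> = of_int a + of_int b * W"
  define \<beta> where "\<beta> = of_int c + of_int d * W"
  have "p + q - (of_int (n ^ l * a + n ^ k * c) + of_int (n ^ l * b + n ^ k * d) * W) * M ^ (k + l)
      = p + q - \<alpha> * M ^ k * (of_int n ^ l * M ^ l) - \<beta> * M ^ l * (of_int n ^ k * M ^ k)"
    by (simp add: \<alpha>_def \<beta>_def algebra_simps power_add)
  also have "\<dots> = Delta n * (r + s - \<alpha> * M ^ k * x - \<beta> * M ^ l * y)"
    unfolding x y r s by (simp add: \<alpha>_def \<beta>_def algebra_simps)
  finally show ?thesis unfolding fractional_def by (metis dvd_triv_left)
qed

lemma fractional_mult: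
  assumes "fractional p" "fractional q"
  shows "fractional (p * q)"
proof -
  obtain k a b where "Delta n dvd p - (of_int a + of_int b * W) * M ^ k"
    using assms by (auto simp: fractional_def)
  then obtain r where r: "p = (of_int a + of_int b * W) * M ^ k + Delta n * r"
    by (metis diff_eq_eq add.commute dvd_def)
  obtain l c d where "Delta n dvd q - (of_int c + of_int d * W) * M ^ l"
    using assms by (auto simp: fractional_def)
  then obtain s where s: "q = (of_int c + of_int d * W) * M ^ l + Delta n * s"
    by (metis diff_eq_eq add.commute dvd_def)
  define \<alpha> where "\<alpha> = of_int a + of_int b * W"
  define \<beta> where "\<beta> = of_int c + of_int d * W"
  define \<gamma> where "\<gamma> = of_int (a * c + n * b * d) + of_int (a * d + b * c + b * d) * W"
  have "\<alpha> * \<beta> = of_int (a * c) + of_int (a * d + b * c) * W + of_int (b * d) * (W * W)"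
    by (simp add: \<alpha>_def \<beta>_def algebra_simps)
  also have "\<dots> = \<gamma> + Delta n * (of_int (b * d) * of_int n * Poly_Mapping.single 1 1)"
    unfolding W_square by (simp add: \<gamma>_def algebra_simps)
  finally obtain z where z: "\<alpha> * \<beta> = \<gamma> + Delta n * z" by blast
  have "p * q - \<gamma> * M ^ (k + l) = (\<alpha> * \<beta> - \<gamma>) * M ^ k * M ^ l
      + Delta n * (r * \<beta> * M ^ l + s * \<alpha> * M ^ k + Delta n * r * s)"
    unfolding r s \<alpha>_def[symmetric] \<beta>_def[symmetric] by (simp add: algebra_simps power_add)
  also have "\<dots> = Delta n * (z * M ^ k * M ^ l + r * \<beta> * M ^ l + s * \<alpha> * M ^ k + Delta n * r * s)"
    unfolding z by (simp add: algebra_simps)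
  finally show ?thesis unfolding fractional_def \<gamma>_def by (metis dvd_triv_left)
qed

lemma fractional_of_int: "fractional (of_int c)"
  unfolding fractional_def by (intro exI[of _ 0] exI[of _ c]) simp

lemma fractional_T: "fractional (Poly_Mapping.single 1 1)"
proof -
  have "Poly_Mapping.single 1 1 - (of_int n + of_int 1 * W) * M ^ 1
      = Delta n * (- Poly_Mapping.single 1 1)"
    by (simp add: W_def Delta_eq algebra_simps)
  then show ?thesis unfolding fractional_def by (metis dvd_triv_left)
qed

lemma fractional_T_inverse: "fractional (Poly_Mapping.single (- 1) 1)"
proof -
  \<comment> \<open>The coordinates come from
    \<open>1 / t = 1 + (1 - w) / n = (n + 1 - w) / n\<close>.\<close>
  have "T' - (N + 1 - N * (T - 1)) * (T - 2 + T') = (N * (T - 2 + T') - 1) * (T - 2)"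
    for T T' N :: laurent
    by (simp add: algebra_simps)
  from this[of "Poly_Mapping.single (- 1) 1" "of_int n" "Poly_Mapping.single 1 1"]
  have "Poly_Mapping.single (- 1) 1 - (of_int (n + 1) + of_int (- 1) * W) * M ^ 1
      = Delta n * (Poly_Mapping.single 1 1 - 2)"
    by (simp add: W_def M_def Delta_eq)
  then show ?thesis unfolding fractional_def by (metis dvd_triv_left)
qed

lemma fractional_all: "fractional p"
proof (induction p rule: laurent_induct)
  case zero
  show ?case using fractional_of_int[of 0] by simp
next
  case (single k c)
  have pow: "fractional (q ^ j)" if "fractional q" for q j
    using that fractional_of_int[of 1] by (induction j) (auto intro: fractional_mult)
  have pos: "Poly_Mapping.single (int j) (1::int) = Poly_Mapping.single 1 1 ^ j" for j
  proof (induction j)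
    case (Suc j)
    then show ?case by (simp flip: Suc add: mult_single)
  qed simp
  have neg: "Poly_Mapping.single (- int j) (1::int) = Poly_Mapping.single (- 1) 1 ^ j" for j
  proof (induction j)
    case (Suc j)
    have "Poly_Mapping.single (- int (Suc j)) (1::int)
        = Poly_Mapping.single (- 1) 1 * Poly_Mapping.single (- int j) 1"
      by (simp add: mult_single)
    then show ?case using Suc by simp
  qed simp
  have "fractional (Poly_Mapping.single k 1)"
  proof (cases "k \<ge> 0")
    case True
    then show ?thesis using pos[of "nat k"] pow[OF fractional_T] by simp
  next
    case False
    then show ?thesis using neg[of "nat (- k)"] pow[OF fractional_T_inverse] by simp
  qed
  then show ?case
    unfolding single_eq_of_int_mult[of k c] by (intro fractional_mult fractional_of_int)
next
  case (add p q)
  then show ?case by (rule fractional_add)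
qed


lemma laurent_eval_W: "laurent_eval tau W = w" "laurent_eval (inverse tau) W = 1 - w"
proof -
  have "laurent_eval tau W = of_int n * (tau - 1)"
    "laurent_eval (inverse tau) W = of_int n * (inverse tau - 1)"
    by (simp_all add: W_def laurent_eval_mult laurent_eval_diff)
  then show "laurent_eval tau W = w" "laurent_eval (inverse tau) W = 1 - w"
    by (simp_all add: inverse_tau) (simp add: tau_def)
qed

lemma laurent_eval_M: "laurent_eval tau M = 1 / of_int n" "laurent_eval (inverse tau) M = 1 / of_int n"
proof -
  have M: "M = Poly_Mapping.single 1 1 - of_int 2 + Poly_Mapping.single (- 1) 1"
    by (simp add: M_def)
  have "tau - 2 + inverse tau = 1 / of_int n"
    unfolding inverse_tau by (simp add: tau_def add_divide_distrib[symmetric])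
  then show "laurent_eval tau M = 1 / of_int n" "laurent_eval (inverse tau) M = 1 / of_int n"
    unfolding M laurent_eval_add laurent_eval_diff laurent_eval_of_int laurent_eval_single
    by (simp_all add: power_int_minus algebra_simps)
qed

lemma laurent_eval_Delta: "laurent_eval tau (Delta n) = 0" "laurent_eval (inverse tau) (Delta n) = 0"
  by (simp_all add: Delta_eq laurent_eval_diff laurent_eval_mult laurent_eval_M)

lemma laurent_eval_Delta_dvd:
  assumes "Delta n dvd p - q"
  shows "laurent_eval tau p = laurent_eval tau q"
    "laurent_eval (inverse tau) p = laurent_eval (inverse tau) q"
proof -
  obtain r where r: "p - q = Delta n * r" using assms by blast
  have "laurent_eval tau (p - q) = 0" "laurent_eval (inverse tau) (p - q) = 0"
    unfolding r by (simp_all add: laurent_eval_mult laurent_eval_Delta)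
  then show "laurent_eval tau p = laurent_eval tau q"
    "laurent_eval (inverse tau) p = laurent_eval (inverse tau) q"
    by (simp_all add: laurent_eval_diff)
qed

lemma laurent_eval_fraction:
  "laurent_eval tau ((of_int a + of_int b * W) * M ^ k) = E1 a b / of_int n ^ k"
  "laurent_eval (inverse tau) ((of_int a + of_int b * W) * M ^ k) = E2 a b / of_int n ^ k"
  by (simp_all add: laurent_eval_mult laurent_eval_add laurent_eval_power laurent_eval_W
      laurent_eval_M E1_def E2_def power_divide)

lemma laurent_fraction_cases:
  obtains k a b where "Delta n dvd p - (of_int a + of_int b * W) * M ^ k"
    "laurent_eval tau p * of_int n ^ k = E1 a b" "laurent_eval (inverse tau) p * of_int n ^ k = E2 a b"
proof -
  obtain k a b where *: "Delta n dvd p - (of_int a + of_int b * W) * M ^ k"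
    using fractional_all[of p] by (auto simp: fractional_def)
  show ?thesis
    using laurent_eval_Delta_dvd[OF *] by (intro that[OF *]) (simp_all add: laurent_eval_fraction)
qed

text \<open>Writing \<open>p\<close> as a fraction turns the two vanishing conditions into the
  vanishing of the numerator under both embeddings, hence of its coordinates. So the quotient ring
  embeds into pairs of complex numbers, also when \<open>Delta n\<close> is reducible.\<close>

lemma Delta_dvd_iff:
  "Delta n dvd p \<longleftrightarrow> laurent_eval tau p = 0 \<and> laurent_eval (inverse tau) p = 0"
proof
  assume "Delta n dvd p"
  then show "laurent_eval tau p = 0 \<and> laurent_eval (inverse tau) p = 0"
    using laurent_eval_Delta_dvd[of p 0] by simp
next
  assume 0: "laurent_eval tau p = 0 \<and> laurent_eval (inverse tau) p = 0"
  obtain k a b where *: "Delta n dvd p - (of_int a + of_int b * W) * M ^ k"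
    "laurent_eval tau p * of_int n ^ k = E1 a b" "laurent_eval (inverse tau) p * of_int n ^ k = E2 a b"
    by (rule laurent_fraction_cases)
  then have "E1 a b = E1 0 0" "E2 a b = E2 0 0" using 0 by (simp_all add: E_of_int)
  then have "a = 0" "b = 0" by (rule E_inject)+
  then show "Delta n dvd p" using *(1) by simp
qed

section \<open>Norm-one elements and the unitary units\<close>

definition norm_one :: "complex set" where
  "norm_one = {x. \<exists>a b k. x * of_int n ^ k = E1 a b \<and> nrm a b = n ^ (2 * k)}"

definition norm_one_group :: "complex monoid" where
  "norm_one_group = \<lparr>carrier = norm_one, monoid.mult = (*), one = 1\<rparr>"

text \<open>The same coordinates represent \<open>x\<close> under the first embedding and
  \<open>1 / x\<close> under the second. In this form products and inverses follow from the
  multiplication rules for \<open>E1\<close> and \<open>E2\<close>, and \<open>E_inject\<close>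
  becomes applicable.\<close>

lemma norm_one_iff: "x \<in> norm_one \<longleftrightarrow> (\<exists>a b k. x * of_int n ^ k = E1 a b \<and> of_int n ^ k = x * E2 a b)"
proof -
  have "nrm a b = n ^ (2 * k) \<longleftrightarrow> of_int n ^ k = x * E2 a b" if "x * of_int n ^ k = E1 a b" for a b k
  proof -
    have "nrm a b = n ^ (2 * k) \<longleftrightarrow> complex_of_int (nrm a b) = of_int n ^ k * of_int n ^ k"
      by (metis mult_2 of_int_eq_iff of_int_power power_add)
    also have "\<dots> \<longleftrightarrow> of_int n ^ k * (x * E2 a b) = of_int n ^ k * of_int n ^ k"
      unfolding E1_E2[symmetric] that[symmetric] by (simp add: mult_ac)
    finally show ?thesis by auto
  qed
  then show ?thesis unfolding norm_one_def by blast
qed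

lemma norm_one_nonzero: "x \<in> norm_one \<Longrightarrow> x \<noteq> 0"
  by (auto simp: norm_one_iff)

lemma one_in_norm_one: "1 \<in> norm_one"
  unfolding norm_one_iff by (intro exI[of _ 1] exI[of _ 0]) (simp add: E_of_int)

lemma norm_one_mult:
  assumes "x \<in> norm_one" "y \<in> norm_one"
  shows "x * y \<in> norm_one"
proof -
  obtain a b k where 1: "x * of_int n ^ k = E1 a b" "of_int n ^ k = x * E2 a b"
    using assms(1) by (auto simp: norm_one_iff)
  obtain c d l where 2: "y * of_int n ^ l = E1 c d" "of_int n ^ l = y * E2 c d"
    using assms(2) by (auto simp: norm_one_iff)
  have "x * y * of_int n ^ (k + l) = E1 a b * E1 c d" "of_int n ^ (k + l) = x * y * (E2 a b * E2 c d)"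
    unfolding 1(1)[symmetric] 2(1)[symmetric] using 1(2) 2(2) by (simp_all add: power_add mult_ac)
  then show ?thesis unfolding norm_one_iff E1_mult E2_mult by blast
qed

lemma norm_one_inverse:
  assumes "x \<in> norm_one"
  shows "inverse x \<in> norm_one"
proof -
  obtain a b k where 1: "x * of_int n ^ k = E1 a b" "of_int n ^ k = x * E2 a b"
    using assms(1) by (auto simp: norm_one_iff)
  have "inverse x * of_int n ^ k = E1 (a + b) (- b)" "of_int n ^ k = inverse x * E2 (a + b) (- b)"
    using 1 norm_one_nonzero[OF assms] by (simp_all flip: E1_eq_E2 E2_eq_E1)  (metis field_class.field_inverse mult.assoc mult_1)
  then show ?thesis unfolding norm_one_iff by blast
qed

lemma carrier_norm_one_group [simp]: "carrier norm_one_group = norm_one"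
  and mult_norm_one_group [simp]: "x \<otimes>\<^bsub>norm_one_group\<^esub> y = x * y"
  and one_norm_one_group [simp]: "\<one>\<^bsub>norm_one_group\<^esub> = 1"
  by (simp_all add: norm_one_group_def)

lemma comm_group_norm_one: "comm_group norm_one_group"
proof (rule comm_groupI)
  fix x assume "x \<in> carrier norm_one_group"
  then show "\<exists>y\<in>carrier norm_one_group. y \<otimes>\<^bsub>norm_one_group\<^esub> x = \<one>\<^bsub>norm_one_group\<^esub>"
    using norm_one_inverse norm_one_nonzero by (intro bexI[of _ "inverse x"]) auto
qed (auto simp: norm_one_mult one_in_norm_one)

sublocale norm_one: comm_group norm_one_group
  by (rule comm_group_norm_one)

lemma pow_norm_one_group:
  assumes "x \<in> norm_one"
  shows "x [^]\<^bsub>norm_one_group\<^esub> (k::int) = x powi k"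
proof -
  have nat: "x [^]\<^bsub>norm_one_group\<^esub> (j::nat) = x ^ j" for j
    by (induction j) auto
  have inv: "inv\<^bsub>norm_one_group\<^esub> y = inverse y" if "y \<in> norm_one" for y
    using that norm_one_inverse norm_one_nonzero by (intro norm_one.inv_equality) auto
  have "x ^ j \<in> norm_one" for j
    using norm_one.nat_pow_closed[of x j] assms by (simp add: nat)
  then show ?thesis
    by (simp add: int_pow_def2 nat power_int_def inv power_inverse)
qed

lemma norm_one_powi: "x \<in> norm_one \<Longrightarrow> x powi k \<in> norm_one"
  using norm_one.int_pow_closed[of x k] by (simp add: pow_norm_one_group)

lemma tau_in_norm_one: "tau \<in> norm_one"
proof -
  have "tau * of_int n ^ 1 = E1 n 1" by (simp add: tau_def E1_def field_simps)
  moreover have "nrm n 1 = n ^ (2 * 1)" by (simp add: nrm_def power2_eq_square)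
  ultimately show ?thesis unfolding norm_one_def by blast
qed

lemma minus_norm_one: "x \<in> norm_one \<Longrightarrow> - x \<in> norm_one"
proof -
  have "- 1 \<in> norm_one" unfolding norm_one_iff
    by (intro exI[of _ "- 1"] exI[of _ 0]) (simp add: E_of_int)
  then show "x \<in> norm_one \<Longrightarrow> - x \<in> norm_one" using norm_one_mult[of "- 1" x] by simp
qed

lemma unitary_iff:
  "residue_class n p \<in> unitary_units n \<longleftrightarrow> laurent_eval tau p * laurent_eval (inverse tau) p = 1"
  unfolding residue_class_in_unitary_units_iff residue_class_eq_iff Delta_dvd_iff
  by (simp add: laurent_eval_diff laurent_eval_mult laurent_eval_conj mult.commute)

definition unit_eval :: "laurent set \<Rightarrow> complex" where
  "unit_eval u = laurent_eval tau (SOME p. p \<in> u)"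

lemma unit_eval_residue_class: "unit_eval (residue_class n p) = laurent_eval tau p"
proof -
  have "p \<in> residue_class n p" unfolding residue_class_eq by (auto intro: exI[of _ 0])
  then have "(SOME q. q \<in> residue_class n p) \<in> residue_class n p" by (rule someI)
  then have "Delta n dvd (SOME q. q \<in> residue_class n p) - p"
    unfolding residue_class_eq by auto
  then show ?thesis unfolding unit_eval_def by (rule laurent_eval_Delta_dvd)
qed

lemma unitary_units_cases:
  assumes "u \<in> unitary_units n"
  obtains p where "u = residue_class n p" "laurent_eval tau p * laurent_eval (inverse tau) p = 1"
  using assms unitary_iff by (auto simp: unitary_units_def carrier_alexander_ring)

text \<open>Injective because the evaluation at \<open>inverse tau\<close> is the reciprocal of that
  at \<open>tau\<close>, so that one value fixes both. Surjective because a fraction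
  \<open>(a + b w) / n^k\<close> is hit by \<open>(a + b W) * M^k\<close>.\<close>

lemma unit_eval_iso: "unit_eval \<in> iso (unitary_group n) norm_one_group"
  unfolding iso_def
proof (intro CollectI conjI)
  have carrier: "carrier (unitary_group n) = unitary_units n" by (simp add: unitary_group_def)
  have in_norm_one: "unit_eval u \<in> norm_one" if u: "u \<in> unitary_units n" for u
  proof -
    obtain p where p: "u = residue_class n p" "laurent_eval tau p * laurent_eval (inverse tau) p = 1"
      using u by (rule unitary_units_cases)
    obtain k a b where *: "laurent_eval tau p * of_int n ^ k = E1 a b"
      "laurent_eval (inverse tau) p * of_int n ^ k = E2 a b"
      by (rule laurent_fraction_cases)
    have "of_int n ^ k = laurent_eval tau p * laurent_eval (inverse tau) p * of_int n ^ k"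
      using p(2) by simp
    also have "\<dots> = laurent_eval tau p * E2 a b" unfolding *(2)[symmetric] by (simp add: mult_ac)
    finally show ?thesis
      unfolding norm_one_iff p(1) unit_eval_residue_class using *(1) by blast
  qed
  show "unit_eval \<in> hom (unitary_group n) norm_one_group"
  proof (rule homI)
    fix u v assume "u \<in> carrier (unitary_group n)" "v \<in> carrier (unitary_group n)"
    then obtain p q where "u = residue_class n p" "v = residue_class n q"
      unfolding carrier by (metis unitary_units_cases)
    then show "unit_eval (u \<otimes>\<^bsub>unitary_group n\<^esub> v) = unit_eval u \<otimes>\<^bsub>norm_one_group\<^esub> unit_eval v"
      by (simp add: unitary_group_def mult_residue_class unit_eval_residue_class laurent_eval_mult)
  qed (use in_norm_one carrier in auto)
  show "bij_betw unit_eval (carrier (unitary_group n)) (carrier norm_one_group)"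
    unfolding bij_betw_def carrier
  proof
    show "inj_on unit_eval (unitary_units n)"
    proof (rule inj_onI)
      fix u v assume u: "u \<in> unitary_units n" and v: "v \<in> unitary_units n" and uv: "unit_eval u = unit_eval v"
      obtain p where p: "u = residue_class n p" "laurent_eval tau p * laurent_eval (inverse tau) p = 1"
        using u by (rule unitary_units_cases)
      obtain q where q: "v = residue_class n q" "laurent_eval tau q * laurent_eval (inverse tau) q = 1"
        using v by (rule unitary_units_cases)
      have eq: "laurent_eval tau p = laurent_eval tau q"
        using uv by (simp add: p q unit_eval_residue_class)
      moreover from this have "laurent_eval (inverse tau) p = laurent_eval (inverse tau) q"
        using p(2) q(2) by (metis mult_cancel_left mult_zero_left zero_neq_one)
      ultimately show "u = v"
        by (simp add: p(1) q(1) residue_class_eq_iff Delta_dvd_iff laurent_eval_diff)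
    qed
    show "unit_eval ` unitary_units n = carrier norm_one_group"
    proof
      show "carrier norm_one_group \<subseteq> unit_eval ` unitary_units n"
      proof
        fix x assume "x \<in> carrier norm_one_group"
        then obtain a b k where x: "x * of_int n ^ k = E1 a b" "of_int n ^ k = x * E2 a b"
          by (auto simp: norm_one_iff)
        define p where "p = (of_int a + of_int b * W) * M ^ k"
        have eval: "laurent_eval tau p = x"
          unfolding p_def laurent_eval_fraction x(1)[symmetric] by simp
        have "x * laurent_eval (inverse tau) p = of_int n ^ k / of_int n ^ k"
          unfolding p_def laurent_eval_fraction times_divide_eq_right x(2)[symmetric] ..
        then have "x * laurent_eval (inverse tau) p = 1" by simp
        then show "x \<in> unit_eval ` unitary_units n"
          using eval unitary_iff[of p] unit_eval_residue_class[of p] by force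
      qed
    qed (use in_norm_one in auto)
  qed
qed

text \<open>For nonzero \<open>n\<close> this is the interface to the coset group: a surjection from
  a group of complex numbers with the powers of \<open>tau\<close> as kernel.\<close>

lemma quotient_map:
  obtains \<pi> where "\<pi> \<in> hom norm_one_group (unitary_quotient n)"
    "\<pi> ` norm_one = carrier (unitary_quotient n)"
    "\<And>x. x \<in> norm_one \<Longrightarrow> \<pi> x = \<one>\<^bsub>unitary_quotient n\<^esub> \<longleftrightarrow> (\<exists>k. x = tau powi k)"
proof -
  interpret U: comm_group "unitary_group n" by (rule comm_group_unitary_group)
  interpret N: normal "t_powers n" "unitary_group n"
    using subgroup_t_powers by (simp add: U.normal_iff_subgroup)
  define \<rho> where "\<rho> = inv_into (carrier (unitary_group n)) unit_eval"
  have \<rho>: "\<rho> \<in> iso norm_one_group (unitary_group n)"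
    unfolding \<rho>_def by (rule U.iso_set_sym[OF unit_eval_iso])
  then have bij: "bij_betw \<rho> norm_one (carrier (unitary_group n))" and hom: "\<rho> \<in> hom norm_one_group (unitary_group n)"
    by (auto simp: iso_def)
  have \<rho>_eq: "\<rho> x = u \<longleftrightarrow> x = unit_eval u" if "x \<in> norm_one" "u \<in> carrier (unitary_group n)" for x u
    using that unit_eval_iso unfolding \<rho>_def iso_def bij_betw_def
    by (metis (mono_tags, lifting) carrier_norm_one_group f_inv_into_f inv_into_f_f mem_Collect_eq)
  define T where "T = residue_class n (Poly_Mapping.single 1 1)"
  have T: "T \<in> carrier (unitary_group n)" unfolding T_def by (rule t_in_unitary_group)
  have unit_T: "unit_eval (T [^]\<^bsub>unitary_group n\<^esub> k) = tau powi k" for k :: int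
  proof -
    have "unit_eval (T [^]\<^bsub>unitary_group n\<^esub> k) = unit_eval T [^]\<^bsub>norm_one_group\<^esub> k"
      using unit_eval_iso T by (intro hom_int_pow) (auto simp: iso_def U.is_group norm_one.is_group)
    then show ?thesis
      by (simp add: T_def unit_eval_residue_class pow_norm_one_group tau_in_norm_one)
  qed
  have t_powers: "t_powers n = range (\<lambda>k::int. T [^]\<^bsub>unitary_group n\<^esub> k)"
    unfolding t_powers_def T_def[symmetric] by (auto simp: U.generate_pow[OF T])
  let ?\<pi> = "\<lambda>x. t_powers n #>\<^bsub>unitary_group n\<^esub> \<rho> x"
  show ?thesis
  proof (rule that[of ?\<pi>])
    show "?\<pi> \<in> hom norm_one_group (unitary_quotient n)"
      using hom_compose[OF hom N.r_coset_hom_Mod] by (simp add: comp_def unitary_quotient_def)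
    show "?\<pi> ` norm_one = carrier (unitary_quotient n)"
      using bij unfolding unitary_quotient_def carrier_FactGroup bij_betw_def by (metis image_image)
    fix x assume x: "x \<in> norm_one"
    then have \<rho>x: "\<rho> x \<in> carrier (unitary_group n)" using bij by (auto simp: bij_betw_def)
    have "?\<pi> x = \<one>\<^bsub>unitary_quotient n\<^esub> \<longleftrightarrow> \<rho> x \<in> t_powers n"
      using U.coset_join1[OF _ \<rho>x subgroup_t_powers] U.coset_join2[OF \<rho>x subgroup_t_powers]
      by (auto simp: unitary_quotient_def)
    also have "\<dots> \<longleftrightarrow> (\<exists>k::int. \<rho> x = T [^]\<^bsub>unitary_group n\<^esub> k)"
      by (auto simp: t_powers)
    also have "\<dots> \<longleftrightarrow> (\<exists>k. x = tau powi k)"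
      using \<rho>_eq[OF x U.int_pow_closed[OF T]] by (simp add: unit_T)
    finally show "?\<pi> x = \<one>\<^bsub>unitary_quotient n\<^esub> \<longleftrightarrow> (\<exists>k. x = tau powi k)" .
  qed
qed

end

section \<open>Valuations at the primes dividing \<open>n\<close>\<close>

lemma prime_power_mult_cancel:
  fixes p :: int
  assumes "Factorial_Ring.prime p" "p ^ s * A = p ^ t * B" "\<not> p dvd A" "\<not> p dvd B"
  shows "s = t"
proof -
  have *: "\<not> s < t" if "p ^ s * A = p ^ t * B" "\<not> p dvd A" for s t A B
  proof
    assume "s < t"
    then have "p ^ t = p ^ s * (p * p ^ (t - s - 1))"
      by (metis Suc_diff_Suc diff_diff_left less_imp_add_positive add_diff_cancel_left' plus_1_eq_Suc power_Suc power_add add.commute Suc_eq_plus1)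
    then have "p ^ s * A = p ^ s * (p * p ^ (t - s - 1) * B)" using that(1) by (simp add: mult_ac)
    then have "A = p * p ^ (t - s - 1) * B" using assms(1) by auto
    then show False using that(2) by simp
  qed
  show ?thesis using *[of s A t B] *[of t B s A] assms by simp
qed

lemma prime_content_decompose:
  assumes "Factorial_Ring.prime (p::int)" "a \<noteq> 0 \<or> b \<noteq> 0"
  obtains l a' b' where "a = p ^ l * a'" "b = p ^ l * b'" "\<not> (p dvd a' \<and> p dvd b')"
proof -
  have "gcd a b \<noteq> 0" using assms by simp
  then obtain g where g: "gcd a b = p ^ multiplicity p (gcd a b) * g" "\<not> p dvd g"
    using multiplicity_decompose'[of "gcd a b" p] assms(1) not_prime_unit by metis
  define l where "l = multiplicity p (gcd a b)"
  have "p ^ l dvd gcd a b" using g l_def by (metis dvd_triv_left)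
  then obtain a' b' where ab: "a = p ^ l * a'" "b = p ^ l * b'"
    by (meson dvd_def dvd_gcdD1 dvd_gcdD2)
  have "\<not> (p dvd a' \<and> p dvd b')"
  proof
    assume "p dvd a' \<and> p dvd b'"
    then have "p ^ l * p dvd gcd a b" by (simp add: ab)
    then have "p ^ l * p dvd p ^ l * g" using g(1) unfolding l_def[symmetric] by simp
    then show False using g(2) assms(1) by auto
  qed
  then show ?thesis using that ab by blast
qed

context quadratic_order
begin

lemma E_scale: "of_int m * E1 a b = E1 (m * a) (m * b)" "of_int m * E2 a b = E2 (m * a) (m * b)"
  by (simp_all add: E1_def E2_def algebra_simps)

text \<open>Since \<open>p\<close> divides \<open>n\<close>, sending \<open>a + b w\<close> to
  \<open>a\<close> modulo \<open>p\<close> is a ring homomorphism with kernel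
  \<open>P = (p, w)\<close>. The lemma says that the complement of this prime ideal is closed under
  products.\<close>

lemma not_dvd_first_coordinate:
  assumes "Factorial_Ring.prime p" "p dvd n" "\<not> p dvd a" "\<not> p dvd c"
  shows "\<not> p dvd a * c + n * b * d"
  using assms by (simp add: dvd_add_left_iff prime_dvd_mult_iff)

text \<open>
  \<open>has_val p x e\<close> states that \<open>x\<close> has valuation \<open>e\<close> at the prime \<open>P = (p, w)\<close> above \<open>p\<close>:
  up to \<open>p\<close>-powers, \<open>x\<close> is a quotient of two elements outside \<open>P\<close>. Since \<open>a + b w \<in> P\<close> iff \<open>p dvd a\<close>,
  no completion is needed. The last equation is the image of the preceding one under conjugation;
  it follows from it only when \<open>4 n + 1\<close> is not a square.
\<close>
definition has_val :: "int \<Rightarrow> complex \<Rightarrow> int \<Rightarrow> bool" where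
  "has_val p x e \<longleftrightarrow> (\<exists>b0 b1 c0 c1 i j. \<not> p dvd b0 \<and> \<not> p dvd c0 \<and> e = int i - int j \<and>
     x * of_int p ^ j * E1 b0 b1 = of_int p ^ i * E1 c0 c1 \<and>
     of_int p ^ j * E2 b0 b1 = x * of_int p ^ i * E2 c0 c1)"

text \<open>Cross-multiplying two representations of \<open>x\<close> leaves powers of
  \<open>p\<close> times elements outside \<open>P\<close>. Their first coordinates are prime to
  \<open>p\<close>, so comparing first coordinates compares the exponents.\<close>

lemma has_val_unique:
  assumes p: "Factorial_Ring.prime p" "p dvd n" and "x \<noteq> 0" "has_val p x e" "has_val p x e'"
  shows "e = e'"
proof -
  obtain b0 b1 c0 c1 i j where 1: "\<not> p dvd b0" "\<not> p dvd c0" "e = int i - int j"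
    "x * of_int p ^ j * E1 b0 b1 = of_int p ^ i * E1 c0 c1"
    "of_int p ^ j * E2 b0 b1 = x * of_int p ^ i * E2 c0 c1"
    using assms by (auto simp: has_val_def)
  obtain b0' b1' c0' c1' i' j' where 2: "\<not> p dvd b0'" "\<not> p dvd c0'" "e' = int i' - int j'"
    "x * of_int p ^ j' * E1 b0' b1' = of_int p ^ i' * E1 c0' c1'"
    "of_int p ^ j' * E2 b0' b1' = x * of_int p ^ i' * E2 c0' c1'"
    using assms by (auto simp: has_val_def)
  have "of_int (p ^ (i + j')) * (E1 c0 c1 * E1 b0' b1') = (of_int p ^ i * E1 c0 c1) * (of_int p ^ j' * E1 b0' b1')"
    by (simp add: power_add mult_ac)
  also have "\<dots> = of_int p ^ j * E1 b0 b1 * (x * of_int p ^ j' * E1 b0' b1')"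
    unfolding 1(4)[symmetric] by (simp add: mult_ac)
  also have "\<dots> = of_int (p ^ (i' + j)) * (E1 c0' c1' * E1 b0 b1)"
    unfolding 2(4) by (simp add: power_add mult_ac)
  finally have E1: "of_int (p ^ (i + j')) * (E1 c0 c1 * E1 b0' b1') = of_int (p ^ (i' + j)) * (E1 c0' c1' * E1 b0 b1)" .
  have "x * (of_int (p ^ (i + j')) * (E2 c0 c1 * E2 b0' b1')) = (x * of_int p ^ i * E2 c0 c1) * (of_int p ^ j' * E2 b0' b1')"
    by (simp add: power_add mult_ac)
  also have "\<dots> = of_int p ^ j * E2 b0 b1 * (x * of_int p ^ i' * E2 c0' c1')"
    unfolding 1(5) 2(5) by (simp add: mult_ac)
  also have "\<dots> = x * (of_int (p ^ (i' + j)) * (E2 c0' c1' * E2 b0 b1))"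
    by (simp add: power_add mult_ac)
  finally have E2: "of_int (p ^ (i + j')) * (E2 c0 c1 * E2 b0' b1') = of_int (p ^ (i' + j)) * (E2 c0' c1' * E2 b0 b1)"
    using \<open>x \<noteq> 0\<close> by simp
  have "p ^ (i + j') * (c0 * b0' + n * c1 * b1') = p ^ (i' + j) * (c0' * b0 + n * c1' * b1)"
    using E_inject(1)[OF E1[unfolded E1_mult E_scale] E2[unfolded E2_mult E_scale]] .
  then have "i + j' = i' + j"
    by (rule prime_power_mult_cancel[OF p(1)]) (rule not_dvd_first_coordinate[OF p]; fact)+
  then show ?thesis using 1(3) 2(3) by simp
qed

lemma has_val_mult:
  assumes p: "Factorial_Ring.prime p" "p dvd n" and "has_val p x e" "has_val p y e'"
  shows "has_val p (x * y) (e + e')"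
proof -
  obtain b0 b1 c0 c1 i j where 1: "\<not> p dvd b0" "\<not> p dvd c0" "e = int i - int j"
    "x * of_int p ^ j * E1 b0 b1 = of_int p ^ i * E1 c0 c1"
    "of_int p ^ j * E2 b0 b1 = x * of_int p ^ i * E2 c0 c1"
    using assms by (auto simp: has_val_def)
  obtain b0' b1' c0' c1' i' j' where 2: "\<not> p dvd b0'" "\<not> p dvd c0'" "e' = int i' - int j'"
    "y * of_int p ^ j' * E1 b0' b1' = of_int p ^ i' * E1 c0' c1'"
    "of_int p ^ j' * E2 b0' b1' = y * of_int p ^ i' * E2 c0' c1'"
    using assms by (auto simp: has_val_def)
  have "x * y * of_int p ^ (j + j') * (E1 b0 b1 * E1 b0' b1')
      = (x * of_int p ^ j * E1 b0 b1) * (y * of_int p ^ j' * E1 b0' b1')"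
    by (simp add: power_add mult_ac)
  also have "\<dots> = of_int p ^ (i + i') * (E1 c0 c1 * E1 c0' c1')"
    unfolding 1(4) 2(4) by (simp add: power_add mult_ac)
  finally have E1: "x * y * of_int p ^ (j + j') * (E1 b0 b1 * E1 b0' b1') = of_int p ^ (i + i') * (E1 c0 c1 * E1 c0' c1')" .
  have "of_int p ^ (j + j') * (E2 b0 b1 * E2 b0' b1')
      = (of_int p ^ j * E2 b0 b1) * (of_int p ^ j' * E2 b0' b1')"
    by (simp add: power_add mult_ac)
  also have "\<dots> = x * y * of_int p ^ (i + i') * (E2 c0 c1 * E2 c0' c1')"
    unfolding 1(5) 2(5) by (simp add: power_add mult_ac)
  finally have E2: "of_int p ^ (j + j') * (E2 b0 b1 * E2 b0' b1') = x * y * of_int p ^ (i + i') * (E2 c0 c1 * E2 c0' c1')" .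
  have "e + e' = int (i + i') - int (j + j')" using 1(3) 2(3) by simp
  moreover have "\<not> p dvd b0 * b0' + n * b1 * b1'" "\<not> p dvd c0 * c0' + n * c1 * c1'"
    using p 1(1,2) 2(1,2) by (intro not_dvd_first_coordinate; simp)+
  ultimately show ?thesis
    unfolding has_val_def using E1[unfolded E1_mult] E2[unfolded E2_mult] by metis
qed

text \<open>After removal of the common power of \<open>p\<close>, the numerator
  \<open>a' + b' w\<close> lies outside \<open>P\<close> unless \<open>p\<close> divides
  \<open>a'\<close>. In that case \<open>p\<close> does not divide \<open>b'\<close>, so its
  conjugate lies outside \<open>P\<close>; multiplying by the conjugate replaces the numerator by
  its norm, an integer whose \<open>p\<close>-part can be split off.\<close>

lemma has_val_exists:
  assumes p: "Factorial_Ring.prime p" and x: "x \<in> norm_one"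
  shows "\<exists>e. has_val p x e"
proof -
  obtain a b k where ab: "x * of_int n ^ k = E1 a b" "of_int n ^ k = x * E2 a b"
    using x by (auto simp: norm_one_iff)
  obtain m where n: "n = p ^ multiplicity p n * m" "\<not> p dvd m"
    using multiplicity_decompose'[of n p] n_nonzero p not_prime_unit by metis
  define s where "s = multiplicity p n"
  have nk: "complex_of_int n ^ k = of_int p ^ (s * k) * of_int (m ^ k)"
    by (subst n(1)) (simp add: s_def power_mult_distrib power_mult)
  have nz: "E1 a b \<noteq> 0" "E2 a b \<noteq> 0"
    using ab norm_one_nonzero[OF x] by (auto simp flip: ab(1))
  then have "a \<noteq> 0 \<or> b \<noteq> 0" by (auto simp: E_of_int)
  then obtain l a' b' where a': "a = p ^ l * a'" "b = p ^ l * b'" "\<not> (p dvd a' \<and> p dvd b')"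
    using prime_content_decompose p by metis
  have E1': "E1 a b = of_int p ^ l * E1 a' b'" and E2': "E2 a b = of_int p ^ l * E2 a' b'"
    using E_scale[of "p ^ l" a' b'] by (simp_all add: a')
  have mk: "\<not> p dvd m ^ k" using n(2) p prime_dvd_power by blast
  show ?thesis
  proof (cases "p dvd a'")
    case False
    have "x * of_int p ^ (s * k) * E1 (m ^ k) 0 = of_int p ^ l * E1 a' b'"
      using ab(1) unfolding nk E1' E_of_int by (simp add: mult_ac)
    moreover have "of_int p ^ (s * k) * E2 (m ^ k) 0 = x * of_int p ^ l * E2 a' b'"
      using ab(2) unfolding nk E2' E_of_int by (simp add: mult_ac)
    ultimately show ?thesis unfolding has_val_def using False mk by blast
  next
    case True
    then have b': "\<not> p dvd a' + b'" using a'(3) by (simp add: dvd_add_right_iff)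
    have "nrm a' b' \<noteq> 0"
      using nz E1_E2[of a' b'] unfolding E1' E2' by auto
    then obtain c where c: "nrm a' b' = p ^ multiplicity p (nrm a' b') * c" "\<not> p dvd c"
      using multiplicity_decompose'[of "nrm a' b'" p] p not_prime_unit by metis
    define t where "t = multiplicity p (nrm a' b')"
    have N: "E1 a' b' * E2 a' b' = of_int p ^ t * of_int c"
      unfolding E1_E2 by (subst c(1)) (simp add: t_def)
    have "x * of_int p ^ (s * k) * E1 (m ^ k * (a' + b')) (m ^ k * - b')
        = x * (of_int p ^ (s * k) * of_int (m ^ k)) * E2 a' b'"
      unfolding E2_eq_E1 E_scale(1)[symmetric] by (simp only: mult_ac)
    also have "\<dots> = of_int p ^ l * (E1 a' b' * E2 a' b')"
      unfolding nk[symmetric] ab(1) E1' by (simp add: mult_ac)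
    also have "\<dots> = of_int p ^ (l + t) * E1 c 0"
      unfolding N by (simp add: E_of_int power_add mult_ac)
    finally have 1: "x * of_int p ^ (s * k) * E1 (m ^ k * (a' + b')) (m ^ k * - b') = of_int p ^ (l + t) * E1 c 0" .
    have "of_int p ^ (s * k) * E2 (m ^ k * (a' + b')) (m ^ k * - b')
        = (of_int p ^ (s * k) * of_int (m ^ k)) * E1 a' b'"
      unfolding E1_eq_E2 E_scale(2)[symmetric] by (simp only: mult_ac)
    also have "\<dots> = x * of_int p ^ l * (E1 a' b' * E2 a' b')"
      unfolding nk[symmetric] ab(2) E2' by (simp add: mult_ac)
    also have "\<dots> = x * of_int p ^ (l + t) * E2 c 0"
      unfolding N by (simp add: E_of_int power_add mult_ac)
    finally have 2: "of_int p ^ (s * k) * E2 (m ^ k * (a' + b')) (m ^ k * - b') = x * of_int p ^ (l + t) * E2 c 0" .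
    have "\<not> p dvd m ^ k * (a' + b')" using mk b' p by (simp add: prime_dvd_mult_iff)
    then show ?thesis unfolding has_val_def using 1 2 c(2) by blast
  qed
qed

definition val :: "int \<Rightarrow> complex \<Rightarrow> int" where
  "val p x = (THE e. has_val p x e)"

lemma val_eqI:
  assumes "Factorial_Ring.prime p" "p dvd n" "x \<in> norm_one" "has_val p x e"
  shows "val p x = e"
  unfolding val_def using assms has_val_unique norm_one_nonzero by blast

lemma has_val_val:
  assumes "Factorial_Ring.prime p" "p dvd n" "x \<in> norm_one"
  shows "has_val p x (val p x)"
  using has_val_exists[OF assms(1,3)] val_eqI[OF assms] by metis

lemma val_mult:
  assumes "Factorial_Ring.prime p" "p dvd n" "x \<in> norm_one" "y \<in> norm_one"
  shows "val p (x * y) = val p x + val p y"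
  using assms by (intro val_eqI norm_one_mult has_val_mult has_val_val)

lemma val_hom:
  assumes "Factorial_Ring.prime p" "p dvd n"
  shows "val p \<in> hom norm_one_group integer_group"
  using val_mult[OF assms] by (intro homI) auto

lemma val_powi:
  assumes "Factorial_Ring.prime p" "p dvd n" "x \<in> norm_one"
  shows "val p (x powi k) = k * val p x"
  using hom_int_pow[OF val_hom[OF assms(1,2)], of x k] assms(3) norm_one.is_group
  by (simp add: pow_norm_one_group)

text \<open>From \<open>tau * (1 - w) = - w\<close> and \<open>w * (1 - w) = - n\<close> follows
  \<open>tau * (1 - w)^2 = n\<close>, and \<open>1 - w\<close> lies outside
  \<open>P\<close>.\<close>

lemma val_tau:
  assumes p: "Factorial_Ring.prime p" "p dvd n"
  shows "val p tau = int (multiplicity p n)" "val p tau > 0"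
proof -
  obtain m where n: "n = p ^ multiplicity p n * m" "\<not> p dvd m"
    using multiplicity_decompose'[of n p] n_nonzero p not_prime_unit by metis
  have n': "complex_of_int n = of_int p ^ multiplicity p n * of_int m"
    by (metis n(1) of_int_mult of_int_power)
  have tau_n: "tau * of_int n = of_int n + w" by (simp add: tau_def field_simps)
  have "E1 (1 + n) (- 1) = (1 - w) * (1 - w)" "E2 (1 + n) (- 1) = w * w"
    using w_square by (simp_all add: E1_def E2_def algebra_simps)
  moreover have "tau * ((1 - w) * (1 - w)) = of_int n"
    using w_square tau_eq by Groebner_Basis.algebra
  ultimately have "tau * of_int p ^ 0 * E1 (1 + n) (- 1) = of_int p ^ multiplicity p n * E1 m 0"
    "of_int p ^ 0 * E2 (1 + n) (- 1) = tau * of_int p ^ multiplicity p n * E2 m 0"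
    using tau_n w_square by (simp_all add: E_of_int mult.assoc flip: n')
  moreover have "\<not> p dvd 1 + n"
    using p by (metis dvd_add_left_iff not_prime_unit)
  moreover have "int (multiplicity p n) = int (multiplicity p n) - int 0" by simp
  ultimately have "has_val p tau (int (multiplicity p n))"
    unfolding has_val_def using n(2) by metis
  then show val: "val p tau = int (multiplicity p n)"
    by (rule val_eqI[OF p tau_in_norm_one])
  have "multiplicity p n > 0" using n p(2) by (metis gr0I mult_1 power_0)
  then show "val p tau > 0" using val by simp
qed

text \<open>If \<open>p\<close> occurs in the denominator of \<open>x\<close> beyond the valuation, then the numerator and its conjugate
  both lie in \<open>P\<close>, so \<open>p\<close> divides the numerator.\<close>
lemma denominator_cancel:
  assumes p: "Factorial_Ring.prime p" "p dvd n" and e: "has_val p x e"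
    and x: "x * of_int d = E1 a b" "of_int d = x * E2 a b" and d: "p ^ Suc (nat \<bar>e\<bar>) dvd d"
  shows "p dvd a" "p dvd b"
proof -
  obtain b0 b1 c0 c1 i j where v: "\<not> p dvd b0" "\<not> p dvd c0" "e = int i - int j"
    "x * of_int p ^ j * E1 b0 b1 = of_int p ^ i * E1 c0 c1"
    "of_int p ^ j * E2 b0 b1 = x * of_int p ^ i * E2 c0 c1"
    using e by (auto simp: has_val_def)
  have cancel: "p dvd A" if "p ^ s * A = d * p ^ t * B" "int s \<le> int t + \<bar>e\<bar>" for s t A B
  proof -
    have "p ^ Suc s dvd p ^ (Suc (nat \<bar>e\<bar>) + t)"
      using that(2) by (intro le_imp_power_dvd) linarith
    also have "\<dots> dvd d * p ^ t" unfolding power_add by (intro mult_dvd_mono d) simp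
    finally have "p ^ s * p dvd p ^ s * A" unfolding that(1) by (simp add: mult.commute)
    then show ?thesis using p by auto
  qed
  have "of_int (p ^ j) * (E1 a b * E1 b0 b1) = of_int d * (x * of_int p ^ j * E1 b0 b1)"
    unfolding x(1)[symmetric] by (simp add: mult_ac)
  also have "\<dots> = of_int (d * p ^ i) * E1 c0 c1" unfolding v(4) by (simp add: mult_ac)
  finally have 1: "of_int (p ^ j) * (E1 a b * E1 b0 b1) = of_int (d * p ^ i) * E1 c0 c1" .
  have "of_int (p ^ j) * (E2 a b * E2 b0 b1) = E2 a b * (of_int p ^ j * E2 b0 b1)"
    by (simp add: mult_ac)
  also have "\<dots> = of_int (d * p ^ i) * E2 c0 c1" unfolding v(5) of_int_mult x(2) by (simp add: mult_ac)
  finally have 2: "of_int (p ^ j) * (E2 a b * E2 b0 b1) = of_int (d * p ^ i) * E2 c0 c1" .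
  have "p ^ j * (a * b0 + n * b * b1) = d * p ^ i * c0"
    using E_inject(1)[OF 1[unfolded E1_mult E_scale] 2[unfolded E2_mult E_scale]] .
  then have "p dvd a * b0 + n * b * b1" by (rule cancel) (use v(3) in auto)
  then show "p dvd a" using p v(1) not_dvd_first_coordinate by blast
  have "of_int (p ^ i) * (E1 (a + b) (- b) * E1 c0 c1) = E2 a b * (of_int p ^ i * E1 c0 c1)"
    by (simp add: E2_eq_E1 mult_ac)
  also have "\<dots> = of_int (d * p ^ j) * E1 b0 b1" unfolding v(4)[symmetric] of_int_mult x(2) by (simp add: mult_ac)
  finally have 1: "of_int (p ^ i) * (E1 (a + b) (- b) * E1 c0 c1) = of_int (d * p ^ j) * E1 b0 b1" .
  have "of_int (p ^ i) * (E2 (a + b) (- b) * E2 c0 c1) = of_int d * (x * of_int p ^ i * E2 c0 c1)"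
    by (simp add: E1_eq_E2[symmetric] x(1)[symmetric] mult_ac)
  also have "\<dots> = of_int (d * p ^ j) * E2 b0 b1" unfolding v(5)[symmetric] by (simp add: mult_ac)
  finally have 2: "of_int (p ^ i) * (E2 (a + b) (- b) * E2 c0 c1) = of_int (d * p ^ j) * E2 b0 b1" .
  have "p ^ i * ((a + b) * c0 + n * (- b) * c1) = d * p ^ j * b0"
    using E_inject(1)[OF 1[unfolded E1_mult E_scale] 2[unfolded E2_mult E_scale]] .
  then have "p dvd (a + b) * c0 + n * (- b) * c1" by (rule cancel) (use v(3) in auto)
  then have "p dvd a + b" using p v(2) not_dvd_first_coordinate by blast
  then show "p dvd b" using \<open>p dvd a\<close> by (simp add: dvd_add_right_iff)
qed

text \<open>The denominator \<open>n^k\<close> is first enlarged to a multiple of \<open>D\<close>.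
  The surplus factor \<open>m\<close> is then stripped off one prime at a time: as long as a prime
  \<open>q\<close> divides it, \<open>q\<close> occurs beyond the valuation and cancels.\<close>

lemma denominator_bound:
  assumes x: "x \<in> norm_one" and D: "D \<noteq> 0"
    and val: "\<And>q. Factorial_Ring.prime q \<Longrightarrow> q dvd n \<Longrightarrow> q ^ nat \<bar>val q x\<bar> dvd D"
  shows "\<exists>a b. x * of_int D = E1 a b \<and> of_int D = x * E2 a b"
proof -
  have "\<exists>a b. x * of_int D = E1 a b \<and> of_int D = x * E2 a b"
    if "m > 0" "\<And>q. Factorial_Ring.prime q \<Longrightarrow> q dvd int m \<Longrightarrow> q dvd n"
      "x * of_int (D * int m) = E1 a b" "of_int (D * int m) = x * E2 a b" for m a b
    using that
  proof (induction m arbitrary: a b rule: less_induct)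
    case (less m)
    show ?case
    proof (cases "m = 1")
      case True
      then show ?thesis using less.prems(3,4) by auto
    next
      case False
      then obtain q :: nat where q: "Factorial_Ring.prime q" "q dvd m" using prime_factor_nat by blast
      then obtain m' where m': "m = q * m'" by blast
      have q': "Factorial_Ring.prime (int q)" "int q dvd n" using q less.prems(2) by auto
      have "int q ^ nat \<bar>val (int q) x\<bar> * int q dvd D * int m"
        using val[OF q'] q by (intro mult_dvd_mono) auto
      then have "int q ^ Suc (nat \<bar>val (int q) x\<bar>) dvd D * int m" by (simp add: mult.commute)
      then have "int q dvd a" "int q dvd b"
        using denominator_cancel[OF q' has_val_val[OF q' x] less.prems(3,4)] by auto
      then obtain a' b' where a': "a = int q * a'" "b = int q * b'" by blast
      have E: "E1 a b = of_int (int q) * E1 a' b'" "E2 a b = of_int (int q) * E2 a' b'"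
        unfolding E_scale a' by simp_all
      have "q > 1" using q prime_gt_1_nat by blast
      show ?thesis
      proof (rule less.IH[of m' a' b'])
        show "m' < m" "0 < m'" using m' \<open>q > 1\<close> less.prems(1) by auto
        show "x * of_int (D * int m') = E1 a' b'" "of_int (D * int m') = x * E2 a' b'"
          using less.prems(3,4) \<open>q > 1\<close> unfolding E m' by (auto simp: mult_ac)
        show "r dvd n" if "Factorial_Ring.prime r" "r dvd int m'" for r
          using less.prems(2) that m' by auto
      qed
    qed
  qed
  note * = this
  obtain a b k where ab: "x * of_int n ^ k = E1 a b" "of_int n ^ k = x * E2 a b"
    using x by (auto simp: norm_one_iff)
  \<comment> \<open>The square makes the surplus positive whatever the sign of
    \<open>n\<close>.\<close>
  define m where "m = nat (n ^ k * n ^ k)"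
  have m: "int m = n ^ k * n ^ k" by (simp add: m_def)
  show ?thesis
  proof (rule *[of m "D * n ^ k * a" "D * n ^ k * b"])
    have "int m \<noteq> 0" unfolding m by simp
    then show "m > 0" by simp
    show "q dvd n" if "Factorial_Ring.prime q" "q dvd int m" for q
      using that by (metis m prime_dvd_mult_iff prime_dvd_power)
    show "x * of_int (D * int m) = E1 (D * n ^ k * a) (D * n ^ k * b)"
      "of_int (D * int m) = x * E2 (D * n ^ k * a) (D * n ^ k * b)"
      using ab unfolding E_scale[symmetric] m by (auto simp: mult_ac)
  qed
qed

lemma integral_norm_one:
  assumes x: "x \<in> norm_one" and val: "\<And>q. Factorial_Ring.prime q \<Longrightarrow> q dvd n \<Longrightarrow> val q x = 0"
  obtains a b where "x = E1 a b" "nrm a b = 1"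
proof -
  obtain a b where ab: "x * of_int 1 = E1 a b" "of_int 1 = x * E2 a b"
    using denominator_bound[OF x, of 1] val by auto
  then have "complex_of_int (nrm a b) = of_int 1" by (simp flip: E1_E2)
  then have "nrm a b = 1" by (simp only: of_int_eq_iff)
  then show ?thesis using that ab by simp
qed

lemma E1_in_norm_one: "nrm a b = 1 \<Longrightarrow> E1 a b \<in> norm_one"
  unfolding norm_one_def by (intro CollectI exI[of _ a] exI[of _ b] exI[of _ 0]) simp

text \<open>If \<open>p\<close> divided \<open>a\<close>, it would divide the norm
  \<open>a (a + b) - n b^2\<close>, which equals \<open>d^2\<close>. So numerator and denominator
  are both outside \<open>P\<close>.\<close>

lemma val_E1:
  assumes p: "Factorial_Ring.prime p" "p dvd n" and d: "\<not> p dvd d"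
    and x: "x * of_int d = E1 a b" "of_int d = x * E2 a b"
    and N: "x \<in> norm_one"
  shows "val p x = 0"
proof -
  have "complex_of_int (nrm a b) = of_int (d * d)" using x by (simp flip: E1_E2 x(1) add: mult_ac)
  then have nrm: "nrm a b = d * d" by (simp only: of_int_eq_iff)
  have "\<not> p dvd a"
  proof
    assume "p dvd a"
    then have "p dvd nrm a b" using p(2) by (auto simp: nrm_def)
    then show False using nrm p d by (simp add: prime_dvd_mult_iff)
  qed
  then have "has_val p x 0"
    unfolding has_val_def using d x
    by (intro exI[of _ d] exI[of _ "0::int"] exI[of _ a] exI[of _ b] exI[of _ "0::nat"]) (auto simp: E_of_int)
  then show ?thesis by (rule val_eqI[OF p N])
qed


section \<open>Valuations on the quotient by the powers of t\<close>

lemma hom_factors_through_quotient: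
  assumes \<pi>: "\<pi> \<in> hom norm_one_group (unitary_quotient n)"
    "\<pi> ` norm_one = carrier (unitary_quotient n)"
    "\<And>x. x \<in> norm_one \<Longrightarrow> \<pi> x = \<one>\<^bsub>unitary_quotient n\<^esub> \<longleftrightarrow> (\<exists>k. x = tau powi k)"
    and v: "v \<in> hom norm_one_group integer_group" "v tau = 0"
  shows "\<exists>\<psi> \<in> hom (unitary_quotient n) integer_group. \<forall>x\<in>norm_one. \<psi> (\<pi> x) = v x"
proof -
  interpret Q: comm_group "unitary_quotient n" by (rule comm_group_unitary_quotient)
  have v_mult: "v (x * y) = v x + v y" if "x \<in> norm_one" "y \<in> norm_one" for x y
    using v(1) that by (auto simp: hom_def)
  have \<pi>_mult: "\<pi> (x * y) = \<pi> x \<otimes>\<^bsub>unitary_quotient n\<^esub> \<pi> y" if "x \<in> norm_one" "y \<in> norm_one" for x y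
    using \<pi>(1) that by (auto simp: hom_def)
  have \<pi>_closed: "\<pi> x \<in> carrier (unitary_quotient n)" if "x \<in> norm_one" for x
    using \<pi>(2) that by auto
  have v_eq: "v x = v y" if xy: "x \<in> norm_one" "y \<in> norm_one" "\<pi> x = \<pi> y" for x y
  proof -
    have iy: "inverse y \<in> norm_one" using xy by (simp add: norm_one_inverse)
    have "\<pi> (x * inverse y) = \<pi> (y * inverse y)" using xy iy by (simp only: \<pi>_mult)
    also have "y * inverse y = tau powi 0" using norm_one_nonzero[OF xy(2)] by simp
    also have "\<pi> (tau powi 0) = \<one>\<^bsub>unitary_quotient n\<^esub>"
      using \<pi>(3)[OF norm_one_powi[OF tau_in_norm_one]] by blast
    finally obtain k where k: "x * inverse y = tau powi k"
      using \<pi>(3)[OF norm_one_mult[OF xy(1) iy]] by blast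
    have "v (tau powi k) = 0"
      using hom_int_pow[OF v(1), of tau k] v(2) tau_in_norm_one norm_one.is_group
      by (simp add: pow_norm_one_group)
    moreover have "x = tau powi k * y" using k norm_one_nonzero[OF xy(2)] by (simp add: field_simps)
    ultimately show ?thesis
      using v_mult[OF norm_one_powi[OF tau_in_norm_one, of k] xy(2)] by simp
  qed
  define \<psi> where "\<psi> = (\<lambda>g. v (SOME x. x \<in> norm_one \<and> \<pi> x = g))"
  have \<psi>: "\<psi> (\<pi> x) = v x" if "x \<in> norm_one" for x
  proof -
    have "(SOME y. y \<in> norm_one \<and> \<pi> y = \<pi> x) \<in> norm_one \<and> \<pi> (SOME y. y \<in> norm_one \<and> \<pi> y = \<pi> x) = \<pi> x"
      by (rule someI[of _ x]) (simp add: that)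
    then show ?thesis unfolding \<psi>_def using v_eq that by blast
  qed
  have "\<psi> \<in> hom (unitary_quotient n) integer_group"
  proof (rule homI)
    fix g h assume "g \<in> carrier (unitary_quotient n)" "h \<in> carrier (unitary_quotient n)"
    then obtain x y where xy: "g = \<pi> x" "h = \<pi> y" "x \<in> norm_one" "y \<in> norm_one"
      unfolding \<pi>(2)[symmetric] by blast
    have "\<psi> (\<pi> (x * y)) = \<psi> (\<pi> x) + \<psi> (\<pi> y)"
      using xy by (simp only: \<psi> norm_one_mult v_mult)
    then show "\<psi> (g \<otimes>\<^bsub>unitary_quotient n\<^esub> h) = \<psi> g \<otimes>\<^bsub>integer_group\<^esub> \<psi> h"
      using xy by (simp add: \<pi>_mult)
  qed simp
  then show ?thesis using \<psi> by blast
qed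

definition primes :: "int set" where "primes = {p. Factorial_Ring.prime p \<and> p dvd n}"

lemma finite_primes: "finite primes"
proof (rule finite_subset)
  show "primes \<subseteq> {0..\<bar>n\<bar>}"
    using n_nonzero order.trans[OF abs_ge_self dvd_imp_le_int] by (auto simp: primes_def prime_ge_0_int)
qed simp

lemma card_primes: "card primes = num_primes n"
proof -
  have "primes = int ` {p :: nat. Factorial_Ring.prime p \<and> int p dvd n}"
  proof (intro equalityI subsetI)
    fix p assume p: "p \<in> primes"
    then have "p = int (nat p)" by (simp add: primes_def prime_ge_0_int)
    with p show "p \<in> int ` {p :: nat. Factorial_Ring.prime p \<and> int p dvd n}"
      by (intro image_eqI[of _ _ "nat p"]) (auto simp: primes_def simp flip: prime_int_nat_transfer)
  qed (auto simp: primes_def)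
  then show ?thesis by (simp add: num_primes_def card_image)
qed

text \<open>
  The combination of \<open>val p\<close> and \<open>val p0\<close> that kills \<open>tau\<close> descends to the quotient; these
  homomorphisms for \<open>p \<noteq> p0\<close> have, up to torsion, the kernel of all valuations as common kernel.
\<close>
lemma quotient_valuations:
  assumes p0: "p0 \<in> primes"
  obtains \<pi> \<psi> where "\<pi> \<in> hom norm_one_group (unitary_quotient n)"
    "\<pi> ` norm_one = carrier (unitary_quotient n)"
    "\<And>x. x \<in> norm_one \<Longrightarrow> \<pi> x = \<one>\<^bsub>unitary_quotient n\<^esub> \<longleftrightarrow> (\<exists>k. x = tau powi k)"
    "\<And>p. p \<in> primes \<Longrightarrow> \<psi> p \<in> hom (unitary_quotient n) integer_group"
    "\<And>p x. p \<in> primes \<Longrightarrow> x \<in> norm_one \<Longrightarrow> \<psi> p (\<pi> x) = val p0 tau * val p x - val p0 x * val p tau"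
    "\<And>x. x \<in> norm_one \<Longrightarrow> (\<And>p. p \<in> primes - {p0} \<Longrightarrow> \<psi> p (\<pi> x) = 0) \<Longrightarrow>
      \<exists>y\<in>norm_one. (\<forall>p\<in>primes. val p y = 0) \<and> \<pi> x [^]\<^bsub>unitary_quotient n\<^esub> val p0 tau = \<pi> y"
proof -
  interpret Q: comm_group "unitary_quotient n" by (rule comm_group_unitary_quotient)
  obtain \<pi> where \<pi>: "\<pi> \<in> hom norm_one_group (unitary_quotient n)"
    "\<pi> ` norm_one = carrier (unitary_quotient n)"
    "\<And>x. x \<in> norm_one \<Longrightarrow> \<pi> x = \<one>\<^bsub>unitary_quotient n\<^esub> \<longleftrightarrow> (\<exists>k. x = tau powi k)"
    by (rule quotient_map) blast
  define v where "v = (\<lambda>p x. val p0 tau * val p x - val p0 x * val p tau)"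
  have "\<exists>\<psi>. \<psi> \<in> hom (unitary_quotient n) integer_group \<and> (\<forall>x\<in>norm_one. \<psi> (\<pi> x) = v p x)"
    if p: "p \<in> primes" for p
  proof -
    have "v p \<in> hom norm_one_group integer_group"
    proof (rule homI)
      fix x y assume "x \<in> carrier norm_one_group" "y \<in> carrier norm_one_group"
      then show "v p (x \<otimes>\<^bsub>norm_one_group\<^esub> y) = v p x \<otimes>\<^bsub>integer_group\<^esub> v p y"
        using p p0 by (simp add: v_def val_mult primes_def algebra_simps)
    qed simp
    moreover have "v p tau = 0" by (simp add: v_def)
    ultimately show ?thesis using hom_factors_through_quotient[OF \<pi>, of "v p"] by blast
  qed
  then obtain \<psi> where \<psi>: "\<And>p. p \<in> primes \<Longrightarrow> \<psi> p \<in> hom (unitary_quotient n) integer_group"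
    "\<And>p x. p \<in> primes \<Longrightarrow> x \<in> norm_one \<Longrightarrow> \<psi> p (\<pi> x) = v p x"
    by metis
  show ?thesis
  proof (rule that[OF \<pi> \<psi>(1)])
    show "\<psi> p (\<pi> x) = val p0 tau * val p x - val p0 x * val p tau" if "p \<in> primes" "x \<in> norm_one" for p x
      using \<psi>(2)[OF that] by (simp add: v_def)
    fix x assume x: "x \<in> norm_one" and ker: "\<And>p. p \<in> primes - {p0} \<Longrightarrow> \<psi> p (\<pi> x) = 0"
    have v0: "v p x = 0" if "p \<in> primes" for p
      using ker[of p] \<psi>(2)[OF that x] that by (cases "p = p0") (auto simp: v_def)
    \<comment> \<open>A power of \<open>tau\<close> cancels the valuation at \<open>p0\<close>; at
      every \<open>p\<close> the valuation of \<open>y\<close> is then exactly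
      \<open>v p x\<close>.\<close>
    define y where "y = x powi val p0 tau * tau powi (- val p0 x)"
    have y: "y \<in> norm_one"
      unfolding y_def by (intro norm_one_mult norm_one_powi x tau_in_norm_one)
    have "val p y = 0" if "p \<in> primes" for p
      using v0[OF that] that x tau_in_norm_one unfolding y_def v_def primes_def
      by (simp add: val_mult norm_one_powi val_powi)
    moreover have "\<pi> y = \<pi> x [^]\<^bsub>unitary_quotient n\<^esub> val p0 tau"
    proof -
      have "\<pi> y = \<pi> (x powi val p0 tau) \<otimes>\<^bsub>unitary_quotient n\<^esub> \<pi> (tau powi (- val p0 x))"
        using \<pi>(1) norm_one_powi[OF x] norm_one_powi[OF tau_in_norm_one] by (auto simp: hom_def y_def)
      also have "\<pi> (tau powi (- val p0 x)) = \<one>\<^bsub>unitary_quotient n\<^esub>"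
        using \<pi>(3)[OF norm_one_powi[OF tau_in_norm_one]] by blast
      also have "\<pi> (x powi val p0 tau) = \<pi> x [^]\<^bsub>unitary_quotient n\<^esub> val p0 tau"
        using hom_int_pow[OF \<pi>(1), of x "val p0 tau"] x norm_one.is_group Q.is_group
        by (simp add: pow_norm_one_group)
      moreover have "\<pi> x \<in> carrier (unitary_quotient n)" using \<pi>(2) x by blast
      ultimately show ?thesis by simp
    qed
    ultimately show "\<exists>y\<in>norm_one. (\<forall>p\<in>primes. val p y = 0) \<and> \<pi> x [^]\<^bsub>unitary_quotient n\<^esub> val p0 tau = \<pi> y"
      using y by metis
  qed
qed

lemma group_rank_finite_kernel:
  assumes p0: "p0 \<in> primes" and units: "\<And>a b. nrm a b = 1 \<Longrightarrow> b = 0"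
    and f: "\<And>p. p \<in> primes \<Longrightarrow> f p \<in> norm_one" "\<And>p. p \<in> primes \<Longrightarrow> val p (f p) \<noteq> 0"
      "\<And>p q. p \<in> primes \<Longrightarrow> q \<in> primes \<Longrightarrow> q \<noteq> p \<Longrightarrow> val q (f p) = 0"
  shows "group_rank (unitary_quotient n) = enat (num_primes n - 1)"
proof (rule quotient_valuations[OF p0])
  interpret Q: comm_group "unitary_quotient n" by (rule comm_group_unitary_quotient)
  fix \<pi> \<psi>
  assume \<pi>: "\<pi> \<in> hom norm_one_group (unitary_quotient n)"
    "\<pi> ` norm_one = carrier (unitary_quotient n)"
    "\<And>x. x \<in> norm_one \<Longrightarrow> \<pi> x = \<one>\<^bsub>unitary_quotient n\<^esub> \<longleftrightarrow> (\<exists>k. x = tau powi k)"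
    and \<psi>: "\<And>p. p \<in> primes \<Longrightarrow> \<psi> p \<in> hom (unitary_quotient n) integer_group"
    "\<And>p x. p \<in> primes \<Longrightarrow> x \<in> norm_one \<Longrightarrow> \<psi> p (\<pi> x) = val p0 tau * val p x - val p0 x * val p tau"
    and ker: "\<And>x. x \<in> norm_one \<Longrightarrow> (\<And>p. p \<in> primes - {p0} \<Longrightarrow> \<psi> p (\<pi> x) = 0) \<Longrightarrow>
      \<exists>y\<in>norm_one. (\<forall>p\<in>primes. val p y = 0) \<and> \<pi> x [^]\<^bsub>unitary_quotient n\<^esub> val p0 tau = \<pi> y"
  have tau0: "val p0 tau > 0" using val_tau p0 by (simp add: primes_def)
  have "group_rank (unitary_quotient n) = enat (card (primes - {p0}))"
  proof (rule Q.group_rank_eq_card[where \<psi> = \<psi> and f = "\<lambda>p. \<pi> (f p)"])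
    fix g assume g: "g \<in> carrier (unitary_quotient n)" "\<And>p. p \<in> primes - {p0} \<Longrightarrow> \<psi> p g = 0"
    then obtain x where x: "x \<in> norm_one" "g = \<pi> x" using \<pi>(2) by blast
    then obtain y where y: "y \<in> norm_one" "\<forall>p\<in>primes. val p y = 0"
      "g [^]\<^bsub>unitary_quotient n\<^esub> val p0 tau = \<pi> y"
      using ker[OF x(1)] g(2) by auto
    obtain a b where ab: "y = E1 a b" "nrm a b = 1"
      using integral_norm_one[OF y(1)] y(2) by (auto simp: primes_def)
    have "b = 0" using units ab by blast
    then have "y * y = 1" using ab E1_E2[of a b] by (simp add: E_of_int)
    \<comment> \<open>The additional factor \<open>2\<close> in the exponent removes the sign, as
      \<open>y\<close> is \<open>1\<close> or \<open>- 1\<close>.\<close>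
    have "g [^]\<^bsub>unitary_quotient n\<^esub> (val p0 tau * 2) = \<pi> y [^]\<^bsub>unitary_quotient n\<^esub> (2::int)"
      using g(1) by (simp flip: y(3) add: Q.int_pow_pow)
    also have "\<dots> = \<pi> (y powi 2)"
      using hom_int_pow[OF \<pi>(1), of y 2] y(1) norm_one.is_group Q.is_group
      by (simp add: pow_norm_one_group)
    also have "y powi 2 = tau powi 0"
      using \<open>y * y = 1\<close> by (simp add: power_int_def power2_eq_square)
    also have "\<pi> (tau powi 0) = \<one>\<^bsub>unitary_quotient n\<^esub>"
      using \<pi>(3)[OF norm_one_powi[OF tau_in_norm_one]] by blast
    finally show "\<exists>m::int. m \<noteq> 0 \<and> g [^]\<^bsub>unitary_quotient n\<^esub> m = \<one>\<^bsub>unitary_quotient n\<^esub>"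
      using tau0 by (intro exI[of _ "val p0 tau * 2"]) simp
  next
    show "(\<lambda>p. \<pi> (f p)) \<in> primes - {p0} \<rightarrow> carrier (unitary_quotient n)"
      using f(1) \<pi>(2) by auto
    show "\<psi> p (\<pi> (f p)) \<noteq> 0" if "p \<in> primes - {p0}" for p
      using that f p0 tau0 by (simp add: \<psi>(2))
    show "\<psi> q (\<pi> (f p)) = 0" if "p \<in> primes - {p0}" "q \<in> primes - {p0}" "q \<noteq> p" for p q
      using that f p0 by (simp add: \<psi>(2))
  qed (use finite_primes \<psi>(1) in auto)
  then show ?thesis using p0 by (simp add: card_primes finite_primes)
qed

text \<open>The unit restores the rank lost by dividing by \<open>tau\<close>. It keeps infinite
  order in the quotient: a power of it that is a power of \<open>tau\<close> has valuation
  \<open>0\<close> at \<open>p0\<close>, where \<open>tau\<close> has positive valuation, so it is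
  the trivial power.\<close>

lemma group_rank_cyclic_kernel:
  assumes p0: "p0 \<in> primes" and \<epsilon>: "nrm e0 e1 = 1" "\<And>m. E1 e0 e1 powi m = 1 \<Longrightarrow> m = 0"
    and units: "\<And>a b. nrm a b = 1 \<Longrightarrow> \<exists>m k. m \<noteq> 0 \<and> E1 a b powi m = E1 e0 e1 powi k"
    and f: "\<And>p. p \<in> primes \<Longrightarrow> f p \<in> norm_one" "\<And>p. p \<in> primes \<Longrightarrow> val p (f p) \<noteq> 0"
      "\<And>p q. p \<in> primes \<Longrightarrow> q \<in> primes \<Longrightarrow> q \<noteq> p \<Longrightarrow> val q (f p) = 0"
  shows "group_rank (unitary_quotient n) = enat (num_primes n)"
proof (rule quotient_valuations[OF p0])
  interpret Q: comm_group "unitary_quotient n" by (rule comm_group_unitary_quotient)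
  fix \<pi> \<psi>
  assume \<pi>: "\<pi> \<in> hom norm_one_group (unitary_quotient n)"
    "\<pi> ` norm_one = carrier (unitary_quotient n)"
    "\<And>x. x \<in> norm_one \<Longrightarrow> \<pi> x = \<one>\<^bsub>unitary_quotient n\<^esub> \<longleftrightarrow> (\<exists>k. x = tau powi k)"
    and \<psi>: "\<And>p. p \<in> primes \<Longrightarrow> \<psi> p \<in> hom (unitary_quotient n) integer_group"
    "\<And>p x. p \<in> primes \<Longrightarrow> x \<in> norm_one \<Longrightarrow> \<psi> p (\<pi> x) = val p0 tau * val p x - val p0 x * val p tau"
    and ker: "\<And>x. x \<in> norm_one \<Longrightarrow> (\<And>p. p \<in> primes - {p0} \<Longrightarrow> \<psi> p (\<pi> x) = 0) \<Longrightarrow>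
      \<exists>y\<in>norm_one. (\<forall>p\<in>primes. val p y = 0) \<and> \<pi> x [^]\<^bsub>unitary_quotient n\<^esub> val p0 tau = \<pi> y"
  have tau0: "val p0 tau > 0" using val_tau p0 by (simp add: primes_def)
  have \<pi>_pow: "\<pi> (x powi k) = \<pi> x [^]\<^bsub>unitary_quotient n\<^esub> k" if "x \<in> norm_one" for x k
    using hom_int_pow[OF \<pi>(1), of x k] that norm_one.is_group Q.is_group
    by (simp add: pow_norm_one_group)
  define \<epsilon> where "\<epsilon> = E1 e0 e1"
  have \<epsilon>': "\<epsilon> \<in> norm_one" unfolding \<epsilon>_def by (rule E1_in_norm_one) fact
  have val_\<epsilon>: "val p \<epsilon> = 0" if "p \<in> primes" for p
  proof (rule val_E1)
    show "\<epsilon> * of_int 1 = E1 e0 e1" "of_int 1 = \<epsilon> * E2 e0 e1"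
      using \<epsilon>(1) E1_E2[of e0 e1] by (simp_all add: \<epsilon>_def)
    show "\<not> p dvd 1" using that by (auto simp: primes_def not_prime_unit)
  qed (use that \<epsilon>' in \<open>auto simp: primes_def\<close>)
  have "group_rank (unitary_quotient n) = enat (Suc (card (primes - {p0})))"
  proof (rule Q.group_rank_eq_Suc_card[where \<psi> = \<psi> and f = "\<lambda>p. \<pi> (f p)" and e = "\<pi> \<epsilon>"])
    show "\<pi> \<epsilon> \<in> carrier (unitary_quotient n)" using \<pi>(2) \<epsilon>' by blast
    show "\<psi> p (\<pi> \<epsilon>) = 0" if "p \<in> primes - {p0}" for p
      using that \<psi>(2)[OF _ \<epsilon>'] val_\<epsilon> p0 by simp
    show "m = 0" if "\<pi> \<epsilon> [^]\<^bsub>unitary_quotient n\<^esub> m = \<one>\<^bsub>unitary_quotient n\<^esub>" for m :: int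
    proof -
      have "\<pi> (\<epsilon> powi m) = \<one>\<^bsub>unitary_quotient n\<^esub>" using that \<epsilon>' by (simp add: \<pi>_pow)
      then obtain k where k: "\<epsilon> powi m = tau powi k" using \<pi>(3)[OF norm_one_powi[OF \<epsilon>']] by blast
      then have "val p0 (\<epsilon> powi m) = val p0 (tau powi k)" by simp
      then have "k = 0"
        using val_\<epsilon>[OF p0] p0 tau0 \<epsilon>' tau_in_norm_one by (simp add: val_powi primes_def)
      then show "m = 0" using k \<epsilon>(2) by (simp add: \<epsilon>_def)
    qed
  next
    fix g assume g: "g \<in> carrier (unitary_quotient n)" "\<And>p. p \<in> primes - {p0} \<Longrightarrow> \<psi> p g = 0"
    then obtain x where x: "x \<in> norm_one" "g = \<pi> x" using \<pi>(2) by blast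
    then obtain y where y: "y \<in> norm_one" "\<forall>p\<in>primes. val p y = 0"
      "g [^]\<^bsub>unitary_quotient n\<^esub> val p0 tau = \<pi> y"
      using ker[OF x(1)] g(2) by auto
    obtain a b where ab: "y = E1 a b" "nrm a b = 1"
      using integral_norm_one[OF y(1)] y(2) by (auto simp: primes_def)
    then obtain m k where m: "m \<noteq> 0" "y powi m = \<epsilon> powi k" using units \<epsilon>_def by metis
    have "g [^]\<^bsub>unitary_quotient n\<^esub> (val p0 tau * m) = \<pi> y [^]\<^bsub>unitary_quotient n\<^esub> m"
      using g(1) by (simp flip: y(3) add: Q.int_pow_pow)
    also have "\<dots> = \<pi> \<epsilon> [^]\<^bsub>unitary_quotient n\<^esub> k"
      using y(1) \<epsilon>' m(2) by (simp flip: \<pi>_pow)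
    finally show "\<exists>(m::int) k::int. m \<noteq> 0 \<and> g [^]\<^bsub>unitary_quotient n\<^esub> m = \<pi> \<epsilon> [^]\<^bsub>unitary_quotient n\<^esub> k"
      using tau0 m(1) by (intro exI[of _ "val p0 tau * m"] exI[of _ k]) simp
  next
    show "(\<lambda>p. \<pi> (f p)) \<in> primes - {p0} \<rightarrow> carrier (unitary_quotient n)"
      using f(1) \<pi>(2) by auto
    show "\<psi> p (\<pi> (f p)) \<noteq> 0" if "p \<in> primes - {p0}" for p
      using that f p0 tau0 by (simp add: \<psi>(2))
    show "\<psi> q (\<pi> (f p)) = 0" if "p \<in> primes - {p0}" "q \<in> primes - {p0}" "q \<noteq> p" for p q
      using that f p0 by (simp add: \<psi>(2))
  qed (use finite_primes \<psi>(1) in auto)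
  then show ?thesis
    using p0 finite_primes card_Suc_Diff1[OF finite_primes p0] by (simp add: card_primes)
qed

end

section \<open>Existence of units\<close>

text \<open>Pigeonhole on the triple of \<open>c\<close> and the residues of \<open>a\<close> and
  \<open>b\<close> modulo \<open>c\<close>, which takes finitely many values. It serves both the
  units away from one prime and the Pell units.\<close>

lemma infinite_congruent_subsequence:
  fixes a b c :: "nat \<Rightarrow> int"
  assumes c: "\<And>j. c j \<noteq> 0" "\<And>j. \<bar>c j\<bar> \<le> C"
  shows "\<exists>S c0. infinite S \<and> (\<forall>j\<in>S. c j = c0) \<and> (\<forall>i\<in>S. \<forall>j\<in>S. c0 dvd a i - a j \<and> c0 dvd b i - b j)"
proof -
  define F where "F = (\<lambda>j. (c j, a j mod c j, b j mod c j))"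
  have "range F \<subseteq> {-C..C} \<times> {-C..C} \<times> {-C..C}"
  proof -
    have "k mod c j \<in> {-C..C}" for k j
      using abs_mod_less[OF c(1)[of j], of k] c(2)[of j] unfolding atLeastAtMost_iff by linarith
    moreover have "c j \<in> {-C..C}" for j using c(2)[of j] unfolding atLeastAtMost_iff by linarith
    ultimately show ?thesis unfolding F_def by blast
  qed
  then have "finite (range F)" by (rule finite_subset) simp
  then obtain j0 where j0: "infinite {j \<in> UNIV. F j = F j0}"
    using pigeonhole_infinite[of UNIV F] by auto
  moreover have "c j0 dvd a i - a j \<and> c j0 dvd b i - b j" if "F i = F j0" "F j = F j0" for i j
    using that unfolding F_def by (metis mod_eq_dvd_iff prod.inject)
  moreover have "c j = c j0" if "F j = F j0" for j using that by (simp add: F_def)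
  ultimately show ?thesis
    by (intro exI[of _ "{j \<in> UNIV. F j = F j0}"] exI[of _ "c j0"]) blast
qed

section \<open>Norm-one elements supported at a single prime, for nonsquare discriminant\<close>

context quadratic_order
begin

lemma four_nrm: "4 * nrm a b = (2 * a + b)\<^sup>2 - (4 * n + 1) * b\<^sup>2"
  by (simp add: nrm_def power2_eq_square algebra_simps)

lemma nrm_eq_0D:
  assumes "\<nexists>s. s\<^sup>2 = 4 * n + 1" "nrm a b = 0"
  shows "a = 0" "b = 0"
proof -
  have sq: "(2 * a + b)\<^sup>2 = (4 * n + 1) * b\<^sup>2" using four_nrm[of a b] assms(2) by simp
  show "b = 0"
  proof (rule ccontr)
    assume "b \<noteq> 0"
    have "b\<^sup>2 dvd (2 * a + b)\<^sup>2" unfolding sq by simp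
    then have "b dvd 2 * a + b" by (simp only: pow_divides_pow_iff zero_less_numeral)
    then obtain s where "2 * a + b = b * s" by blast
    then have "s\<^sup>2 = 4 * n + 1" using sq \<open>b \<noteq> 0\<close> by (simp add: power_mult_distrib)
    then show False using assms(1) by blast
  qed
  then show "a = 0" using assms(2) by (simp add: nrm_def)
qed

text \<open>Modulo \<open>c\<close> the product of \<open>a' + b' w\<close> with the conjugate of
  \<open>a + b w\<close> equals the norm of \<open>a + b w\<close>, which is
  \<open>0\<close>.\<close>

lemma congruent_quotient:
  assumes "c dvd nrm a b" "c dvd a' - a" "c dvd b' - b"
  obtains d0 d1 where "E1 a' b' * E2 a b = of_int c * E1 d0 d1" "E2 a' b' * E1 a b = of_int c * E2 d0 d1"
proof -
  have "a' * (a + b) + n * b' * (- b) = nrm a b + (a' - a) * (a + b) - n * b * (b' - b)"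
    "a' * (- b) + b' * (a + b) + b' * (- b) = (b' - b) * a - (a' - a) * b"
    by (simp_all add: nrm_def algebra_simps)
  then have "c dvd a' * (a + b) + n * b' * (- b)" "c dvd a' * (- b) + b' * (a + b) + b' * (- b)"
    using assms by (simp_all add: dvd_add dvd_diff dvd_mult dvd_mult2)
  then obtain d0 d1 where d: "a' * (a + b) + n * b' * (- b) = c * d0"
    "a' * (- b) + b' * (a + b) + b' * (- b) = c * d1" by (metis dvdE)
  have "E1 a' b' * E1 (a + b) (- b) = of_int c * E1 d0 d1" "E2 a' b' * E2 (a + b) (- b) = of_int c * E2 d0 d1"
    unfolding E1_mult E2_mult E_scale d by simp_all
  then show ?thesis by (intro that[of d0 d1]) (simp_all only: E1_eq_E2[of a b] E2_eq_E1[of a b])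
qed

lemma norm_oneI:
  assumes "x * of_int d = E1 a b" "of_int d = x * E2 a b" "d dvd n ^ k"
  shows "x \<in> norm_one"
proof -
  obtain m where m: "n ^ k = d * m" using assms(3) by blast
  have "x * of_int n ^ k = E1 (m * a) (m * b)" "of_int n ^ k = x * E2 (m * a) (m * b)"
    unfolding of_int_power[symmetric] m E_scale[symmetric] assms(1)[symmetric] of_int_mult
    by (simp_all add: mult_ac) (simp add: assms(2) mult_ac)
  then show ?thesis unfolding norm_one_iff by blast
qed

text \<open>The iteration \<open>r \<mapsto> r\<^sup>2 - n\<close> is a \<open>p\<close>-adic contraction near \<open>0\<close>, so no Hensel lifting is needed.\<close>
lemma root_mod_prime_power:
  assumes "p dvd n"
  obtains r where "p dvd r" "p ^ k dvd r * r - r - n"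
proof -
  have "\<exists>r s. p dvd r \<and> p dvd s \<and> s = r * r - n \<and> p ^ k dvd s - r"
  proof (induction k)
    case 0
    show ?case using assms by (intro exI[of _ 0] exI[of _ "- n"]) simp
  next
    case (Suc k)
    then obtain r s where rs: "p dvd r" "p dvd s" "s = r * r - n" "p ^ k dvd s - r" by blast
    have "(s * s - n) - s = (s + r) * (s - r)" using rs(3) by (simp add: algebra_simps)
    moreover have "p * p ^ k dvd (s + r) * (s - r)" using rs by (intro mult_dvd_mono) auto
    ultimately have "p ^ Suc k dvd (s * s - n) - s" by simp
    moreover have "p dvd s * s - n" using rs(2) assms by (simp add: dvd_diff)
    ultimately show ?case using rs(2) by blast
  qed
  then obtain r where "p dvd r" "p ^ k dvd (r * r - n) - r" by blast
  then show ?thesis using that[of r] by (simp add: algebra_simps)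
qed

text \<open>With \<open>R\<close> a root of \<open>X^2 - X - n\<close> modulo \<open>p^(2 j)\<close>
  that is divisible by \<open>p\<close>, the elements whose image under \<open>w \<mapsto> R\<close>
  vanishes modulo \<open>p^(2 j)\<close> form the power \<open>P^(2 j)\<close>. The last equation
  puts \<open>a + b w\<close> there. Approximating \<open>R / p^(2 j)\<close> with denominators up
  to \<open>p^j\<close> bounds both coordinates by \<open>p^j\<close>, so the norm is
  \<open>p^(2 j)\<close> times a factor bounded independently of \<open>j\<close>.\<close>

lemma small_element_above_prime:
  assumes p: "Factorial_Ring.prime p" "p dvd n" and nonsq: "\<nexists>s. s\<^sup>2 = 4 * n + 1"
  obtains a b c R h where "nrm a b = c * p ^ (2 * j)" "c \<noteq> 0" "\<bar>c\<bar> \<le> 2 + \<bar>n\<bar>"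
    "p dvd R" "p ^ (2 * j) dvd R * R - R - n" "a = h * p ^ (2 * j) - b * R"
proof -
  obtain R where R: "p dvd R" "p ^ (2 * j) dvd R * R - R - n"
    by (rule root_mod_prime_power[OF p(2)])
  have p0: "p > 0" using p(1) by (simp add: prime_gt_0_int)
  \<comment> \<open>The exponent \<open>2 * j\<close> is even so that this square root, which
    balances the bounds for \<open>a\<close> and \<open>b\<close>, is an integer.\<close>
  define N where "N = nat (p ^ j)"
  have N: "N > 0" "int N = p ^ j" "real N = of_int p ^ j"
    using p0 by (simp_all add: N_def of_nat_nat)
  obtain h b where b: "0 < b" "b \<le> int N" "\<bar>of_int b * (of_int R / of_int p ^ (2 * j)) - of_int h\<bar> < 1 / real N"
    by (rule Dirichlet_approx[OF N(1), of "of_int R / of_int p ^ (2 * j)"])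
  define a where "a = h * p ^ (2 * j) - b * R"
  have "real_of_int \<bar>a\<bar> = \<bar>of_int b * (of_int R / of_int p ^ (2 * j)) - of_int h\<bar> * of_int p ^ (2 * j)"
  proof -
    have "(of_int b * (of_int R / of_int p ^ (2 * j)) - of_int h) * of_int p ^ (2 * j) = - real_of_int a"
      using p0 by (simp add: a_def field_simps)
    then have "\<bar>- real_of_int a\<bar> = \<bar>of_int b * (of_int R / of_int p ^ (2 * j)) - of_int h\<bar> * \<bar>of_int p ^ (2 * j)\<bar>"
      by (simp only: abs_mult[symmetric])
    then show ?thesis using p0 by simp
  qed
  also have "\<dots> \<le> 1 / real N * of_int p ^ (2 * j)"
    using b(3) p0 by (intro mult_right_mono) auto
  also have "\<dots> = of_int (p ^ j)"
    using p0 by (simp add: N(3) mult_2 power_add)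
  finally have a: "\<bar>a\<bar> \<le> p ^ j" by (simp only: of_int_le_iff)
  have b': "\<bar>b\<bar> \<le> p ^ j" using b N by simp
  have "\<bar>nrm a b\<bar> \<le> \<bar>a\<bar> * \<bar>a\<bar> + \<bar>a\<bar> * \<bar>b\<bar> + \<bar>n\<bar> * (\<bar>b\<bar> * \<bar>b\<bar>)"
    unfolding nrm_def abs_mult[symmetric] mult.assoc by linarith
  also have "\<dots> \<le> p ^ j * p ^ j + p ^ j * p ^ j + \<bar>n\<bar> * (p ^ j * p ^ j)"
    using a b' p0 by (intro add_mono mult_mono) auto
  also have "\<dots> = (2 + \<bar>n\<bar>) * p ^ (2 * j)"
    unfolding mult_2[of j] power_add by (simp add: distrib_right)
  finally have bound: "\<bar>nrm a b\<bar> \<le> (2 + \<bar>n\<bar>) * p ^ (2 * j)" .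
  have "nrm a b = p ^ (2 * j) * (h * (h * p ^ (2 * j) - 2 * b * R + b)) + b * b * (R * R - R - n)"
    by (simp add: nrm_def a_def algebra_simps)
  then have "p ^ (2 * j) dvd nrm a b" using R(2) by simp
  then obtain c where c: "nrm a b = c * p ^ (2 * j)" by (metis dvd_def mult.commute)
  have "c \<noteq> 0" using nrm_eq_0D[OF nonsq, of a b] b c by auto
  moreover have "\<bar>c\<bar> \<le> 2 + \<bar>n\<bar>" using bound p0 by (simp add: c abs_mult)
  ultimately show ?thesis by (intro that[OF c _ _ R a_def])
qed

text \<open>Take two small elements with the same cofactor \<open>c0\<close>, congruent modulo
  \<open>c0\<close>, in \<open>P^(2 j)\<close> and \<open>P^(2 j')\<close>. The product of the
  second with the conjugate of the first, divided by \<open>c0 p^(j + j')\<close>, has norm one and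
  only powers of \<open>p\<close> in its denominator. Its valuation at \<open>P\<close> is at least
  \<open>j' - j\<close> minus that of \<open>c0\<close>, hence positive for \<open>j'\<close>
  large.\<close>

lemma prime_unit_exists:
  assumes p: "Factorial_Ring.prime p" "p dvd n" and nonsq: "\<nexists>s. s\<^sup>2 = 4 * n + 1"
  shows "\<exists>u\<in>norm_one. val p u \<noteq> 0 \<and> (\<forall>q\<in>primes. q \<noteq> p \<longrightarrow> val q u = 0)"
proof -
  have p0: "p > 1" using p(1) by (simp add: prime_gt_1_int)
  have "\<exists>a b c R h. nrm a b = c * p ^ (2 * j) \<and> c \<noteq> 0 \<and> \<bar>c\<bar> \<le> 2 + \<bar>n\<bar> \<and>
    p dvd R \<and> p ^ (2 * j) dvd R * R - R - n \<and> a = h * p ^ (2 * j) - b * R" for j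
    by (rule small_element_above_prime[OF p nonsq, of j]) blast
  then obtain a b c R h where *: "\<And>j. nrm (a j) (b j) = c j * p ^ (2 * j)" "\<And>j. c j \<noteq> 0"
    "\<And>j. \<bar>c j\<bar> \<le> 2 + \<bar>n\<bar>" "\<And>j. p dvd R j" "\<And>j. p ^ (2 * j) dvd R j * R j - R j - n"
    "\<And>j. a j = h j * p ^ (2 * j) - b j * R j"
    by metis
  obtain S c0 where S: "infinite S" "\<forall>j\<in>S. c j = c0"
    "\<forall>i\<in>S. \<forall>j\<in>S. c0 dvd a i - a j \<and> c0 dvd b i - b j"
    using infinite_congruent_subsequence[where c = c and C = "2 + \<bar>n\<bar>" and a = a and b = b, OF *(2) *(3)] by blast
  obtain j where j: "j \<in> S" using S(1) by (metis finite.emptyI ex_in_conv)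
  \<comment> \<open>The gap exceeds the bound on \<open>c0\<close>, so \<open>p^(j' - j)\<close> is
    too large to divide \<open>c0\<close>.\<close>
  obtain j' where j': "j' \<in> S" "j' > j + nat (2 + \<bar>n\<bar>)"
    using S(1) by (meson infinite_nat_iff_unbounded)
  have c_j: "c j = c0" and c_j': "c j' = c0" using S(2) j j' by auto
  have c0: "c0 \<noteq> 0" "\<bar>c0\<bar> \<le> 2 + \<bar>n\<bar>" using c_j *(2,3)[of j] by auto
  define J where "J = j + j'"
  have "c0 dvd nrm (a j) (b j)" using *(1)[of j] c_j by simp
  then obtain d0 d1 where d: "E1 (a j') (b j') * E2 (a j) (b j) = of_int c0 * E1 d0 d1"
    "E2 (a j') (b j') * E1 (a j) (b j) = of_int c0 * E2 d0 d1"
    by (rule congruent_quotient[of c0 "a j" "b j" "a j'" "b j'"]) (use S(3) j j' in auto)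
  have nrm_d: "E1 d0 d1 * E2 d0 d1 = of_int (p ^ J) * of_int (p ^ J)"
  proof -
    have "of_int c0 * of_int c0 * (E1 d0 d1 * E2 d0 d1) = (of_int c0 * E1 d0 d1) * (of_int c0 * E2 d0 d1)"
      by (simp only: mult_ac)
    also have "\<dots> = (E1 (a j') (b j') * E2 (a j') (b j')) * (E1 (a j) (b j) * E2 (a j) (b j))"
      unfolding d[symmetric] by (simp only: mult_ac)
    also have "\<dots> = of_int c0 * of_int c0 * (of_int (p ^ J) * of_int (p ^ J))"
      unfolding E1_E2 *(1) c_j c_j' J_def mult_2 power_add of_int_mult by (simp only: mult_ac)
    finally show ?thesis using c0 by simp
  qed
  define u where "u = E1 d0 d1 / of_int (p ^ J)"
  have u: "u * of_int (p ^ J) = E1 d0 d1" "of_int (p ^ J) = u * E2 d0 d1"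
    using p0 nrm_d by (simp_all add: u_def field_simps)
  have u_in: "u \<in> norm_one"
    by (rule norm_oneI[OF u dvd_power_same[OF p(2)]])
  have "val q u = 0" if "q \<in> primes" "q \<noteq> p" for q
  proof (rule val_E1[OF _ _ _ u u_in])
    show "\<not> q dvd p ^ J"
      using that p by (metis mem_Collect_eq prime_dvd_power primes_def primes_dvd_imp_eq)
  qed (use that in \<open>auto simp: primes_def\<close>)
  moreover have "val p u \<noteq> 0"
  proof
    assume "val p u = 0"
    then have "has_val p u 0" using has_val_val[OF p u_in] by simp
    then obtain b0 b1 c1 g1 i i' where v: "\<not> p dvd b0" "\<not> p dvd c1" "0 = int i - int i'"
      "u * of_int p ^ i' * E1 b0 b1 = of_int p ^ i * E1 c1 g1"
      "of_int p ^ i' * E2 b0 b1 = u * of_int p ^ i * E2 c1 g1"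
      unfolding has_val_def by blast
    have v1: "u * E1 b0 b1 = E1 c1 g1" and v2: "E2 b0 b1 = u * E2 c1 g1"
      using v(3-5) p0 by auto
    \<comment> \<open>The multiplier \<open>1 - R - w\<close> is the conjugate of
      \<open>w - R\<close>. It lies outside \<open>P\<close>, and it carries
      \<open>P^(2 j') = (p^(2 j'), w - R)\<close> into the multiples of \<open>p^(2 j')\<close>,
      because the norm of \<open>w - R\<close> is \<open>R^2 - R - n\<close>.\<close>
    have "p ^ (2 * j') dvd a j' * (1 - R j') + n * b j' * (- 1)"
    proof -
      have "a j' * (1 - R j') + n * b j' * (- 1)
          = p ^ (2 * j') * (h j' * (1 - R j')) + b j' * (R j' * R j' - R j' - n)"
        unfolding *(6)[of j'] by (simp add: algebra_simps)
      then show ?thesis using *(5)[of j'] by simp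
    qed
    moreover have "p ^ (2 * j') dvd a j' * (- 1) + b j' * (1 - R j') + b j' * (- 1)"
    proof -
      have "a j' * (- 1) + b j' * (1 - R j') + b j' * (- 1) = p ^ (2 * j') * (- h j')"
        unfolding *(6)[of j'] by (simp add: algebra_simps)
      then show ?thesis by simp
    qed
    ultimately obtain g h' where gh: "a j' * (1 - R j') + n * b j' * (- 1) = p ^ (2 * j') * g"
      "a j' * (- 1) + b j' * (1 - R j') + b j' * (- 1) = p ^ (2 * j') * h'"
      by (metis dvdE)
    have \<rho>: "E1 (a j') (b j') * E1 (1 - R j') (- 1) = of_int (p ^ (2 * j')) * E1 g h'"
      "E2 (a j') (b j') * E2 (1 - R j') (- 1) = of_int (p ^ (2 * j')) * E2 g h'"
      unfolding E1_mult E2_mult gh E_scale by simp_all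
    have "of_int (c0 * p ^ J) * (E1 c1 g1 * E1 (1 - R j') (- 1))
        = (of_int c0 * (u * of_int (p ^ J))) * (E1 b0 b1 * E1 (1 - R j') (- 1))"
      unfolding v1[symmetric] by (simp add: mult_ac)
    also have "\<dots> = (E1 (a j') (b j') * E1 (1 - R j') (- 1)) * (E1 (a j + b j) (- b j) * E1 b0 b1)"
      unfolding u(1) d(1)[symmetric] E2_eq_E1[symmetric] by (simp add: mult_ac)
    also have "\<dots> = of_int (p ^ (2 * j')) * (E1 g h' * (E1 (a j + b j) (- b j) * E1 b0 b1))"
      unfolding \<rho> by (simp add: mult_ac)
    finally have e1: "of_int (c0 * p ^ J) * (E1 c1 g1 * E1 (1 - R j') (- 1))
        = of_int (p ^ (2 * j')) * (E1 g h' * (E1 (a j + b j) (- b j) * E1 b0 b1))" .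
    have "of_int (c0 * p ^ J) * (E2 c1 g1 * E2 (1 - R j') (- 1))
        = (of_int c0 * E2 d0 d1) * ((u * E2 c1 g1) * E2 (1 - R j') (- 1))"
      unfolding of_int_mult u(2) by (simp add: mult_ac)
    also have "\<dots> = (E2 (a j') (b j') * E2 (1 - R j') (- 1)) * (E2 (a j + b j) (- b j) * E2 b0 b1)"
      unfolding v2[symmetric] d(2)[symmetric] E1_eq_E2[symmetric] by (simp add: mult_ac)
    also have "\<dots> = of_int (p ^ (2 * j')) * (E2 g h' * (E2 (a j + b j) (- b j) * E2 b0 b1))"
      unfolding \<rho> by (simp add: mult_ac)
    finally have e2: "of_int (c0 * p ^ J) * (E2 c1 g1 * E2 (1 - R j') (- 1))
        = of_int (p ^ (2 * j')) * (E2 g h' * (E2 (a j + b j) (- b j) * E2 b0 b1))" .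
    obtain Y where Y: "c0 * p ^ J * (c1 * (1 - R j') + n * g1 * (- 1)) = p ^ (2 * j') * Y"
      using E_inject(1)[OF e1[unfolded E1_mult E_scale] e2[unfolded E2_mult E_scale]] by blast
    define z where "z = c1 * (1 - R j') + n * g1 * (- 1)"
    have "\<not> p dvd 1 - R j'" using *(4)[of j'] p(1)
      by (metis diff_add_cancel dvd_add not_prime_unit)
    then have z: "\<not> p dvd z" unfolding z_def by (intro not_dvd_first_coordinate p v(2))
    \<comment> \<open>After cancelling \<open>p^J\<close> a surplus \<open>p^(j' - j)\<close>
      remains; as \<open>z\<close> is prime to \<open>p\<close>, it would have to divide
      \<open>c0\<close>.\<close>
    have "p ^ (2 * j') = p ^ J * p ^ (j' - j)"
      using j'(2) by (simp add: J_def mult_2 flip: power_add)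
    then have "p ^ J * (c0 * z) = p ^ J * (p ^ (j' - j) * Y)"
      using Y unfolding z_def[symmetric] by (simp add: mult_ac)
    then have "c0 * z = p ^ (j' - j) * Y" using p0 by simp
    moreover have "coprime (p ^ (j' - j)) z"
      using z p(1) by (simp add: prime_imp_coprime)
    ultimately have "p ^ (j' - j) dvd c0" by (metis coprime_dvd_mult_left_iff dvd_triv_left)
    then have "p ^ (j' - j) \<le> \<bar>c0\<bar>" using c0(1) by (metis abs_of_pos dvd_imp_le_int p0 zero_less_power less_trans zero_less_one)
    moreover have "int (j' - j) < p ^ (j' - j)"
    proof -
      have "int k < p ^ k" for k
      proof -
        have "k < 2 ^ k" by (rule less_exp)
        then have "int k < 2 ^ k" by (metis of_nat_less_iff of_nat_numeral of_nat_power)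
        also have "(2::int) ^ k \<le> p ^ k" using p0 by (intro power_mono) auto
        finally show ?thesis .
      qed
      then show ?thesis .
    qed
    ultimately show False using c0(2) j'(2) by linarith
  qed
  ultimately show ?thesis using u_in by blast
qed

end

section \<open>The fundamental unit of a real order\<close>

lemma scale_into_fundamental_interval:
  fixes x e :: complex
  assumes "x \<noteq> 0" "cmod e > 1"
  obtains k :: int where "1 \<le> cmod (x * e powi k)" "cmod (x * e powi k) < cmod e"
proof -
  define L where "L = ln (cmod e)"
  have L: "L > 0" using assms(2) unfolding L_def by (rule ln_gt_zero)
  define k where "k = \<lfloor>ln (cmod x) / L\<rfloor>"
  have "of_int k \<le> ln (cmod x) / L" "ln (cmod x) / L < of_int k + 1"
    unfolding k_def by linarith+
  then have k: "of_int k * L \<le> ln (cmod x)" "ln (cmod x) < (of_int k + 1) * L"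
    using L by (simp_all add: field_simps)
  have e: "e \<noteq> 0" using assms(2) by auto
  have pos: "cmod (x * e powi (- k)) > 0" using assms e by simp
  have "ln (cmod (x * e powi (- k))) = ln (cmod x) - of_int k * L"
  proof -
    have "cmod (e powi (- k)) = exp (- of_int k * L)"
      using e by (simp add: norm_power_int L_def powr_real_of_int' [symmetric] powr_def)
    then show ?thesis using assms(1) e by (simp add: norm_mult ln_mult)
  qed
  then have "0 \<le> ln (cmod (x * e powi (- k)))" "ln (cmod (x * e powi (- k))) < ln (cmod e)"
    using k by (simp_all add: L_def algebra_simps)
  then have "1 \<le> cmod (x * e powi (- k))" "cmod (x * e powi (- k)) < cmod e"
    using pos e by (simp_all add: ln_ge_zero_iff)
  then show ?thesis using that by blast
qed

context quadratic_order
begin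

definition integral_units :: "complex set" where
  "integral_units = {E1 a b | a b. nrm a b = 1}"

lemma integral_units_E1: "nrm a b = 1 \<Longrightarrow> E1 a b \<in> integral_units"
  by (auto simp: integral_units_def)

lemma integral_units_mult: "x \<in> integral_units \<Longrightarrow> y \<in> integral_units \<Longrightarrow> x * y \<in> integral_units"
  unfolding integral_units_def using E1_mult nrm_mult by force

lemma integral_units_inverse: "x \<in> integral_units \<Longrightarrow> inverse x \<in> integral_units"
proof -
  assume "x \<in> integral_units"
  then obtain a b where x: "x = E1 a b" "nrm a b = 1" by (auto simp: integral_units_def)
  then have "inverse x = E1 (a + b) (- b)"
    using E1_E2[of a b] by (simp add: E2_eq_E1 inverse_unique)
  moreover have "nrm (a + b) (- b) = 1" using x(2) by (simp add: nrm_def algebra_simps)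
  ultimately show ?thesis by (simp add: integral_units_E1)
qed

lemma integral_units_powi: "x \<in> integral_units \<Longrightarrow> x powi k \<in> integral_units"
proof -
  assume x: "x \<in> integral_units"
  have "y ^ j \<in> integral_units" if "y \<in> integral_units" for y j
  proof (induction j)
    case 0
    have "E1 1 0 \<in> integral_units" by (rule integral_units_E1) (simp add: nrm_def)
    then show ?case by (simp add: E_of_int)
  qed (simp add: integral_units_mult that)
  then show ?thesis using x integral_units_inverse by (simp add: power_int_def)
qed

lemma integral_units_nonzero:
  assumes "x \<in> integral_units"
  shows "x \<noteq> 0"
proof -
  obtain a b where "x = E1 a b" "nrm a b = 1" using assms by (auto simp: integral_units_def)
  then show ?thesis using E1_E2[of a b] by auto
qed

lemma E_of_real:
  assumes "w = of_real r"
  shows "E1 a b = of_real (of_int a + of_int b * r)" "E2 a b = of_real (of_int a + of_int b * (1 - r))"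
  unfolding E1_def E2_def by (simp_all add: assms)

lemma real_integral_unit_cmod_1:
  assumes w: "w = of_real r" and x: "x \<in> integral_units" "cmod x = 1"
  shows "x * x = 1"
proof -
  obtain a b where "x = E1 a b" using x by (auto simp: integral_units_def)
  then have y: "x = of_real (of_int a + of_int b * r)" by (simp only: E_of_real[OF w])
  then have "\<bar>of_int a + of_int b * r\<bar> = 1" using x(2) by (simp only: norm_of_real)
  then have "(of_int a + of_int b * r) * (of_int a + of_int b * r) = 1"
    by (metis abs_mult_self_eq mult_1)
  then show ?thesis unfolding y of_real_mult[symmetric] by simp
qed

text \<open>The conjugate of such a unit has absolute value at most \<open>1\<close>. The two
  embeddings differ by \<open>b (2 r - 1)\<close>, which bounds \<open>b\<close> and then
  \<open>a\<close>.\<close>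

lemma finite_bounded_integral_units:
  assumes w: "w = of_real r" "\<bar>2 * r - 1\<bar> \<ge> 1"
  shows "finite {x \<in> integral_units. 1 \<le> cmod x \<and> cmod x \<le> B}"
proof -
  define C where "C = \<lceil>B + (B + 1) * \<bar>r\<bar> + B + 1\<rceil>"
  have "{x \<in> integral_units. 1 \<le> cmod x \<and> cmod x \<le> B} \<subseteq> (\<lambda>(a, b). E1 a b) ` ({-C..C} \<times> {-C..C})"
  proof
    fix x assume x: "x \<in> {x \<in> integral_units. 1 \<le> cmod x \<and> cmod x \<le> B}"
    then obtain a b where ab: "x = E1 a b" "nrm a b = 1" by (auto simp: integral_units_def)
    have B: "1 \<le> B" using x by auto
    have "cmod (E1 a b) * cmod (E2 a b) = 1" using E1_E2[of a b] ab(2) by (simp flip: norm_mult)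
    then have "cmod (E2 a b) \<le> 1"
      using x ab mult_right_mono[of 1 "cmod (E1 a b)" "cmod (E2 a b)"] by simp
    moreover have E1: "E1 a b = of_real (of_int a + of_int b * r)" and E2: "E2 a b = of_real (of_int a + of_int b * (1 - r))"
      by (rule E_of_real[OF w(1)])+
    ultimately have 2: "\<bar>of_int a + of_int b * (1 - r)\<bar> \<le> 1" by (simp only: norm_of_real)
    have 1: "\<bar>of_int a + of_int b * r\<bar> \<le> B" using x unfolding ab E1 by (simp only: mem_Collect_eq norm_of_real)
    have "\<bar>of_int b\<bar> * 1 \<le> \<bar>of_int b\<bar> * \<bar>2 * r - 1\<bar>" using w(2) by (intro mult_left_mono) auto
    also have "\<dots> = \<bar>(of_int a + of_int b * r) - (of_int a + of_int b * (1 - r))\<bar>"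
      unfolding abs_mult[symmetric] by (simp add: algebra_simps)
    also have "\<dots> \<le> B + 1" using 1 2 by linarith
    finally have b: "\<bar>real_of_int b\<bar> \<le> B + 1" by simp
    have "\<bar>real_of_int a\<bar> \<le> B + \<bar>of_int b * r\<bar>" using 1 by linarith
    also have "\<bar>of_int b * r\<bar> \<le> (B + 1) * \<bar>r\<bar>" unfolding abs_mult using b by (intro mult_right_mono) auto
    finally have a: "\<bar>real_of_int a\<bar> \<le> B + (B + 1) * \<bar>r\<bar>" by simp
    have "0 \<le> (B + 1) * \<bar>r\<bar>" using B by simp
    then have "\<bar>real_of_int a\<bar> \<le> B + (B + 1) * \<bar>r\<bar> + B + 1" "\<bar>real_of_int b\<bar> \<le> B + (B + 1) * \<bar>r\<bar> + B + 1"
      using a b B by linarith+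
    then have "\<bar>real_of_int a\<bar> \<le> of_int C" "\<bar>real_of_int b\<bar> \<le> of_int C"
      unfolding C_def using le_of_int_ceiling order.trans by blast+
    then have "\<bar>a\<bar> \<le> C" "\<bar>b\<bar> \<le> C" by linarith+
    then have "a \<in> {-C..C}" "b \<in> {-C..C}" by auto
    then show "x \<in> (\<lambda>(a, b). E1 a b) ` ({-C..C} \<times> {-C..C})" unfolding ab(1) by force
  qed
  then show ?thesis by (rule finite_subset) simp
qed

text \<open>A good approximation \<open>h / k\<close> of \<open>r\<close> makes
  \<open>k r - h\<close> smaller than \<open>1 / Suc j\<close>, while its conjugate grows at most
  linearly in \<open>Suc j\<close>. The product, which is the norm, stays bounded.\<close>

lemma small_element_real:
  assumes w: "w = of_real r" and nonsq: "\<nexists>s. s\<^sup>2 = 4 * n + 1"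
  obtains a b where "nrm a b \<noteq> 0" "\<bar>nrm a b\<bar> \<le> \<lceil>1 + \<bar>2 * r - 1\<bar>\<rceil>" "cmod (E1 a b) < 1 / real (Suc j)"
proof -
  obtain h k where k: "0 < k" "k \<le> int (Suc j)" "\<bar>of_int k * r - of_int h\<bar> < 1 / real (Suc j)"
    by (rule Dirichlet_approx[of "Suc j" r]) auto
  define z where "z = of_int k * r - of_int h"
  have E1: "E1 (- h) k = of_real z" and E2: "E2 (- h) k = of_real (z - of_int k * (2 * r - 1))"
    unfolding E_of_real[OF w] z_def by (simp_all add: algebra_simps)
  have z: "\<bar>z\<bar> < 1 / real (Suc j)" using k(3) by (simp add: z_def)
  have "real_of_int \<bar>nrm (- h) k\<bar> = cmod (of_int (nrm (- h) k))" by simp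
  also have "\<dots> = \<bar>z\<bar> * \<bar>z - of_int k * (2 * r - 1)\<bar>"
    unfolding E1_E2[symmetric] E1 E2 norm_mult norm_of_real ..
  also have "\<dots> \<le> 1 / real (Suc j) * (real (Suc j) * (1 + \<bar>2 * r - 1\<bar>))"
  proof (intro mult_mono)
    have "1 / real (Suc j) \<le> 1" by simp
    then have "\<bar>z\<bar> \<le> 1" using z by linarith
    moreover have "\<bar>of_int k * (2 * r - 1)\<bar> \<le> real (Suc j) * \<bar>2 * r - 1\<bar>"
      unfolding abs_mult using k by (intro mult_right_mono) auto
    ultimately have "\<bar>z - of_int k * (2 * r - 1)\<bar> \<le> 1 + real (Suc j) * \<bar>2 * r - 1\<bar>" by linarith
    also have "\<dots> \<le> real (Suc j) * (1 + \<bar>2 * r - 1\<bar>)" by (simp add: algebra_simps)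
    finally show "\<bar>z - of_int k * (2 * r - 1)\<bar> \<le> real (Suc j) * (1 + \<bar>2 * r - 1\<bar>)" .
  qed (use z in auto)
  also have "\<dots> = 1 + \<bar>2 * r - 1\<bar>" by simp
  also have "\<dots> \<le> of_int \<lceil>1 + \<bar>2 * r - 1\<bar>\<rceil>" by (rule le_of_int_ceiling)
  finally have "\<bar>nrm (- h) k\<bar> \<le> \<lceil>1 + \<bar>2 * r - 1\<bar>\<rceil>" by (simp only: of_int_le_iff)
  moreover have "nrm (- h) k \<noteq> 0" using nrm_eq_0D(2)[OF nonsq, of "- h" k] k(1) by auto
  moreover have "cmod (E1 (- h) k) < 1 / real (Suc j)" unfolding E1 norm_of_real by (rule z)
  ultimately show ?thesis using that by blast
qed

text \<open>The classical argument for Pell's equation: two elements of equal norm \<open>c\<close>,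
  congruent modulo \<open>c\<close>, have a unit as quotient. Choosing the second one of smaller
  absolute value keeps this unit off the unit circle, and its inverse is larger than
  \<open>1\<close>.\<close>

lemma pell_unit_exists:
  assumes w: "w = of_real r" and nonsq: "\<nexists>s. s\<^sup>2 = 4 * n + 1"
  shows "\<exists>x\<in>integral_units. cmod x > 1"
proof -
  define C where "C = \<lceil>1 + \<bar>2 * r - 1\<bar>\<rceil>"
  have "\<exists>a b. nrm a b \<noteq> 0 \<and> \<bar>nrm a b\<bar> \<le> C \<and> cmod (E1 a b) < 1 / real (Suc j)" for j
    unfolding C_def by (rule small_element_real[OF w nonsq, of j]) blast
  then obtain a b where ab: "\<And>j. nrm (a j) (b j) \<noteq> 0" "\<And>j. \<bar>nrm (a j) (b j)\<bar> \<le> C"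
    "\<And>j. cmod (E1 (a j) (b j)) < 1 / real (Suc j)"
    by metis
  obtain S c where S: "infinite S" "\<forall>j\<in>S. nrm (a j) (b j) = c"
    "\<forall>i\<in>S. \<forall>j\<in>S. c dvd a i - a j \<and> c dvd b i - b j"
    using infinite_congruent_subsequence[where c = "\<lambda>j. nrm (a j) (b j)" and C = C and a = a and b = b, OF ab(1) ab(2)]
    by blast
  obtain i where i: "i \<in> S" using S(1) by (metis finite.emptyI ex_in_conv)
  have nz: "E1 (a i) (b i) \<noteq> 0" using ab(1)[of i] E1_E2[of "a i" "b i"] by auto
  obtain m where m: "1 / real (Suc m) < cmod (E1 (a i) (b i))"
    using reals_Archimedean[of "cmod (E1 (a i) (b i))"] nz by (auto simp: inverse_eq_divide)
  obtain j where j: "j \<in> S" "j > m" using S(1) by (meson infinite_nat_iff_unbounded)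
  have "cmod (E1 (a j) (b j)) < 1 / real (Suc m)"
    using ab(3)[of j] j(2) frac_le[of 1 1 "real (Suc m)" "real (Suc j)"] by simp
  then have less: "cmod (E1 (a j) (b j)) < cmod (E1 (a i) (b i))" using m by simp
  have c: "nrm (a i) (b i) = c" "nrm (a j) (b j) = c" "c \<noteq> 0" using S(2) i j ab(1)[of i] by auto
  obtain d0 d1 where d: "E1 (a j) (b j) * E2 (a i) (b i) = of_int c * E1 d0 d1"
    "E2 (a j) (b j) * E1 (a i) (b i) = of_int c * E2 d0 d1"
    by (rule congruent_quotient[of c "a i" "b i" "a j" "b j"]) (use S(3) i j c in auto)
  have "of_int c * of_int c * (E1 d0 d1 * E2 d0 d1) = (of_int c * E1 d0 d1) * (of_int c * E2 d0 d1)"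
    by (simp only: mult_ac)
  also have "\<dots> = (E1 (a i) (b i) * E2 (a i) (b i)) * (E1 (a j) (b j) * E2 (a j) (b j))"
    unfolding d[symmetric] by (simp only: mult_ac)
  also have "\<dots> = of_int c * of_int c * 1" unfolding E1_E2 c by simp
  finally have unit: "E1 d0 d1 * E2 d0 d1 = 1" using c(3) by simp
  then have "nrm d0 d1 = 1" by (simp add: E1_E2)
  then have "E1 d0 d1 \<in> integral_units" by (rule integral_units_E1)
  moreover have "cmod (E1 d0 d1) < 1"
  proof -
    have "of_int c * E1 (a j) (b j) = (E1 (a j) (b j) * E2 (a i) (b i)) * E1 (a i) (b i)"
      using E1_E2[of "a i" "b i"] unfolding c by (simp add: mult_ac)
    also have "\<dots> = of_int c * (E1 d0 d1 * E1 (a i) (b i))" unfolding d by (simp add: mult_ac)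
    finally have "E1 (a j) (b j) = E1 d0 d1 * E1 (a i) (b i)" using c(3) by simp
    then have "cmod (E1 d0 d1) * cmod (E1 (a i) (b i)) < 1 * cmod (E1 (a i) (b i))"
      using less by (simp add: norm_mult)
    then show ?thesis by (rule mult_right_less_imp_less) simp
  qed
  moreover have "E1 d0 d1 \<noteq> 0" using unit by auto
  ultimately have "inverse (E1 d0 d1) \<in> integral_units" "cmod (inverse (E1 d0 d1)) > 1"
    by (simp_all add: integral_units_inverse norm_inverse one_less_inverse)
  then show ?thesis by blast
qed

text \<open>A unit of least absolute value above \<open>1\<close> exists by finiteness. Multiplying
  any unit by a suitable power of it lands in an interval where minimality forces absolute value
  \<open>1\<close>; in a real order this leaves a sign, which squaring removes.\<close>

lemma fundamental_unit_exists:
  assumes w: "w = of_real r" "\<bar>2 * r - 1\<bar> \<ge> 1" and nonsq: "\<nexists>s. s\<^sup>2 = 4 * n + 1"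
  obtains e0 e1 where "nrm e0 e1 = 1" "\<And>m. E1 e0 e1 powi m = 1 \<Longrightarrow> m = 0"
    "\<And>a b. nrm a b = 1 \<Longrightarrow> \<exists>m k. m \<noteq> 0 \<and> E1 a b powi m = E1 e0 e1 powi k"
proof -
  obtain x0 where x0: "x0 \<in> integral_units" "cmod x0 > 1" using pell_unit_exists[OF w(1) nonsq] by blast
  define U where "U = {x \<in> integral_units. 1 < cmod x \<and> cmod x \<le> cmod x0}"
  have "finite U"
    by (rule finite_subset[OF _ finite_bounded_integral_units[OF w, of "cmod x0"]]) (auto simp: U_def)
  moreover have "U \<noteq> {}" using x0 by (auto simp: U_def)
  ultimately obtain e where e: "e \<in> U" "\<And>y. y \<in> U \<Longrightarrow> cmod e \<le> cmod y"
    using arg_min_if_finite[of U cmod] by (metis not_le)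
  then have e': "e \<in> integral_units" "cmod e > 1" by (auto simp: U_def)
  then obtain e0 e1 where e01: "e = E1 e0 e1" "nrm e0 e1 = 1" by (auto simp: integral_units_def)
  have e_min: "cmod e \<le> cmod y" if "y \<in> integral_units" "cmod y > 1" for y
    using e that by (cases "cmod y \<le> cmod x0") (force simp: U_def)+
  show ?thesis
  proof (rule that[OF e01(2)])
    show "m = 0" if "E1 e0 e1 powi m = 1" for m
    proof -
      have "cmod e powi m = 1" using that by (simp flip: e01 norm_power_int)
      then show ?thesis using e'(2)
        by (metis less_irrefl linorder_neqE_linordered_idom order_less_trans power_int_strict_increasing power_int_0_right)
    qed
    fix a b assume "nrm a b = 1"
    then have x: "E1 a b \<in> integral_units" by (rule integral_units_E1)
    obtain k where k: "1 \<le> cmod (E1 a b * e powi k)" "cmod (E1 a b * e powi k) < cmod e"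
      by (rule scale_into_fundamental_interval[OF integral_units_nonzero[OF x] e'(2)])
    define z where "z = E1 a b * e powi k"
    have z: "z \<in> integral_units" unfolding z_def by (intro integral_units_mult integral_units_powi x e')
    then have "cmod z = 1" using k e_min[OF z] unfolding z_def[symmetric] by linarith
    then have "z * z = 1" using real_integral_unit_cmod_1[OF w(1) z] by simp
    moreover have "E1 a b = z * e powi (- k)"
      using integral_units_nonzero[OF e'(1)] by (simp add: z_def power_int_minus)
    ultimately have "E1 a b powi 2 = e powi (- k) * e powi (- k)"
      by (simp add: power_int_def power2_eq_square mult_ac)
    also have "\<dots> = e powi (- k + - k)"
      using integral_units_nonzero[OF e'(1)] by (subst power_int_add) simp_all
    finally show "\<exists>m k. m \<noteq> 0 \<and> E1 a b powi m = E1 e0 e1 powi k"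
      unfolding e01(1) by (intro exI[of _ "2::int"] exI[of _ "- k + - k"] conjI) simp_all
  qed
qed

end

section \<open>The quotient group case by case\<close>

lemma powi_minus_one: "(- 1 :: complex) powi i = (if even i then 1 else - 1)"
  by (auto simp: power_int_minus_left)

context quadratic_order
begin

text \<open>The equation reads \<open>4 = (2 a + b)^2 + (- 4 n - 1) b^2\<close>, and the coefficient
  of \<open>b^2\<close> is at least \<open>7\<close>.\<close>

lemma nrm_one_negative:
  assumes "n < - 1" "nrm a b = 1"
  shows "b = 0"
proof (rule ccontr)
  assume "b \<noteq> 0"
  define u v where "u = (2 * a + b)\<^sup>2" and "v = (- 4 * n - 1) * b\<^sup>2"
  have uv: "4 = u + v"
    using four_nrm[of a b] assms(2) by (simp add: u_def v_def algebra_simps)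
  have "(- 4 * n - 1) * 1 \<le> v"
    unfolding v_def using assms(1) \<open>b \<noteq> 0\<close>
    by (intro mult_left_mono) (simp_all add: int_one_le_iff_zero_less)
  then have "7 \<le> v" using assms(1) by simp
  moreover have "u \<ge> 0" by (simp add: u_def)
  ultimately show False using uv by linarith
qed

lemma nrm_factor:
  assumes "n = m * (m + 1)"
  shows "nrm a b = (a + b * (m + 1)) * (a - b * m)"
  unfolding nrm_def by (simp add: assms algebra_simps)

text \<open>The norm splits into two integer factors with product \<open>1\<close>; these are equal,
  and their difference is \<open>b (2 m + 1)\<close>.\<close>

lemma nrm_one_square:
  assumes "n = m * (m + 1)" "m > 0" "nrm a b = 1"
  shows "b = 0"
proof -
  have "(a + b * (m + 1)) * (a - b * m) = 1" using assms nrm_factor by simp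
  then have "a + b * (m + 1) = a - b * m" by (auto simp: zmult_eq_1_iff)
  then have "b * (2 * m + 1) = 0" by (simp add: algebra_simps)
  then show "b = 0" using assms(2) by simp
qed

text \<open>Both embeddings are rational, and the element sought is a power \<open>P\<close> of
  \<open>p\<close> with conjugate \<open>1 / P\<close>. Its numerator over the denominator
  \<open>P\<close> must be \<open>P^2\<close> under one embedding and \<open>1\<close> under the
  other. Such integer coordinates exist iff \<open>D = 2 m + 1\<close> divides
  \<open>P^2 - 1\<close>. Since \<open>D^2 = 4 n + 1\<close>, \<open>p\<close> is prime to
  \<open>D\<close>, and Euler's theorem provides the exponent.\<close>

lemma prime_unit_square:
  assumes p: "Factorial_Ring.prime p" "p dvd n" and m: "n = m * (m + 1)" "m > 0" and w: "w = of_int (m + 1)"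
  shows "\<exists>u\<in>norm_one. val p u \<noteq> 0 \<and> (\<forall>q\<in>primes. q \<noteq> p \<longrightarrow> val q u = 0)"
proof -
  have p1: "p > 1" using p(1) by (simp add: prime_gt_1_int)
  define D where "D = 2 * m + 1"
  have "D * D = 4 * n + 1" by (simp add: D_def m algebra_simps)
  have "\<not> p dvd D"
  proof
    assume "p dvd D"
    then have "p dvd 4 * n + 1" using \<open>D * D = 4 * n + 1\<close> by (metis dvd_mult2)
    then have "p dvd 1" using p(2) by (metis dvd_add_right_iff dvd_mult)
    then show False using p(1) not_prime_unit by blast
  qed
  then have "coprime p D" using p(1) by (simp add: prime_imp_coprime)
  moreover have "int (nat p) = p" "int (nat D) = D" using p1 m(2) by (simp_all add: D_def)
  ultimately have "coprime (nat p) (nat D)" by (metis coprime_int_iff)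
  then have "[nat p ^ totient (nat D) = 1] (mod nat D)" by (rule euler_theorem)
  then have "[int (nat p ^ totient (nat D)) = int 1] (mod int (nat D))" by (simp only: cong_int_iff)
  then have "[p ^ totient (nat D) = 1] (mod D)"
    using \<open>int (nat p) = p\<close> \<open>int (nat D) = D\<close> by simp
  then have D_dvd: "D dvd p ^ totient (nat D) - 1" by (simp add: cong_iff_dvd_diff)
  define h where "h = totient (nat D)"
  have h: "h > 0" using m(2) by (simp add: h_def D_def)
  define P where "P = p ^ h"
  have P: "P > 1" unfolding P_def using p1 h by (simp add: one_less_power)
  have "D dvd (P - 1) * (P + 1)" using D_dvd by (simp add: P_def h_def)
  then obtain b where b: "(P - 1) * (P + 1) = D * b" by blast
  define u where "u = complex_of_int P"
  have u1: "u * of_int P = E1 (1 + b * m) b"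
  proof -
    have "P * P = 1 + b * m + b * (m + 1)" using b by (simp add: D_def algebra_simps)
    then have "complex_of_int (P * P) = of_int (1 + b * m + b * (m + 1))" by simp
    then show ?thesis unfolding u_def E1_def unfolding w by simp
  qed
  have u2: "of_int P = u * E2 (1 + b * m) b"
    unfolding u_def E2_def unfolding w by simp
  have u_in: "u \<in> norm_one"
    using u1 u2 unfolding P_def by (rule norm_oneI) (rule dvd_power_same[OF p(2)])
  have other: "val q u = 0" if "q \<in> primes" "q \<noteq> p" for q
  proof (rule val_E1[OF _ _ _ u1 u2 u_in])
    show "\<not> q dvd P"
      unfolding P_def using that p by (metis mem_Collect_eq prime_dvd_power primes_def primes_dvd_imp_eq)
  qed (use that in \<open>auto simp: primes_def\<close>)
  moreover have "val p u \<noteq> 0"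
  proof
    assume "val p u = 0"
    then have "val q u = 0" if "Factorial_Ring.prime q" "q dvd n" for q
      using other that by (cases "q = p") (auto simp: primes_def)
    then obtain a' b' where ab: "u = E1 a' b'" "nrm a' b' = 1" using integral_norm_one[OF u_in] by blast
    have "complex_of_int P = of_int (a' + b' * (m + 1))"
      using ab(1) unfolding u_def E1_def unfolding w by simp
    then have "P = a' + b' * (m + 1)" by (simp only: of_int_eq_iff)
    then have "P * (a' - b' * m) = 1" using ab(2) nrm_factor[OF m(1)] by simp
    then show False using P by (simp add: zmult_eq_1_iff)
  qed
  ultimately show ?thesis using u_in by blast
qed

lemma group_rank_nonsquare_negative:
  assumes "n < - 1"
  shows "group_rank (unitary_quotient n) = enat (num_primes n - 1)"
proof -
  have nonsq: "\<nexists>s. s\<^sup>2 = 4 * n + 1"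
  proof
    assume "\<exists>s. s\<^sup>2 = 4 * n + 1"
    then obtain s where "s\<^sup>2 = 4 * n + 1" by blast
    moreover have "s\<^sup>2 \<ge> 0" by simp
    ultimately show False using assms by linarith
  qed
  have "\<not> is_unit n" using assms by auto
  then obtain p0 where p0: "p0 \<in> primes" using prime_divisorE[of n] by (auto simp: primes_def)
  have "\<exists>f. \<forall>p\<in>primes. f p \<in> norm_one \<and> val p (f p) \<noteq> 0 \<and> (\<forall>q\<in>primes. q \<noteq> p \<longrightarrow> val q (f p) = 0)"
    by (rule bchoice) (use prime_unit_exists[OF _ _ nonsq] in \<open>auto simp: primes_def\<close>)
  then obtain f where "\<forall>p\<in>primes. f p \<in> norm_one \<and> val p (f p) \<noteq> 0 \<and> (\<forall>q\<in>primes. q \<noteq> p \<longrightarrow> val q (f p) = 0)"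
    by blast
  then show ?thesis
    using nrm_one_negative[OF assms] by (intro group_rank_finite_kernel[OF p0, of f]) auto
qed

lemma group_rank_square:
  assumes m: "n = m * (m + 1)" "m > 0" and w: "w = of_int (m + 1)"
  shows "group_rank (unitary_quotient n) = enat (num_primes n - 1)"
proof -
  have "n > 1"
  proof -
    have "1 * 2 \<le> m * (m + 1)" using m(2) by (intro mult_mono) auto
    then show ?thesis using m(1) by simp
  qed
  then have "\<not> is_unit n" by auto
  then obtain p0 where p0: "p0 \<in> primes" using prime_divisorE[of n] by (auto simp: primes_def)
  have "\<exists>f. \<forall>p\<in>primes. f p \<in> norm_one \<and> val p (f p) \<noteq> 0 \<and> (\<forall>q\<in>primes. q \<noteq> p \<longrightarrow> val q (f p) = 0)"
    by (rule bchoice) (use prime_unit_square[OF _ _ assms] in \<open>auto simp: primes_def\<close>)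
  then obtain f where "\<forall>p\<in>primes. f p \<in> norm_one \<and> val p (f p) \<noteq> 0 \<and> (\<forall>q\<in>primes. q \<noteq> p \<longrightarrow> val q (f p) = 0)"
    by blast
  then show ?thesis
    using nrm_one_square[OF m] by (intro group_rank_finite_kernel[OF p0, of f]) auto
qed

lemma group_rank_nonsquare_positive:
  assumes "n > 1" and nonsq: "\<nexists>s. s\<^sup>2 = 4 * n + 1" and w: "w = of_real r" "\<bar>2 * r - 1\<bar> \<ge> 1"
  shows "group_rank (unitary_quotient n) = enat (num_primes n)"
proof (rule fundamental_unit_exists[OF w nonsq])
  have "\<not> is_unit n" using assms by auto
  then obtain p0 where p0: "p0 \<in> primes" using prime_divisorE[of n] by (auto simp: primes_def)
  have "\<exists>f. \<forall>p\<in>primes. f p \<in> norm_one \<and> val p (f p) \<noteq> 0 \<and> (\<forall>q\<in>primes. q \<noteq> p \<longrightarrow> val q (f p) = 0)"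
    by (rule bchoice) (use prime_unit_exists[OF _ _ nonsq] in \<open>auto simp: primes_def\<close>)
  then obtain f where f: "\<forall>p\<in>primes. f p \<in> norm_one \<and> val p (f p) \<noteq> 0 \<and> (\<forall>q\<in>primes. q \<noteq> p \<longrightarrow> val q (f p) = 0)"
    by blast
  fix e0 e1
  assume e: "nrm e0 e1 = 1" "\<And>m. E1 e0 e1 powi m = 1 \<Longrightarrow> m = 0"
    "\<And>a b. nrm a b = 1 \<Longrightarrow> \<exists>m k. m \<noteq> 0 \<and> E1 a b powi m = E1 e0 e1 powi k"
  show ?thesis
    by (rule group_rank_cyclic_kernel[OF p0 e, of f]) (use f in auto)
qed

section \<open>The quotient for n = 2, -1 and 1\<close>

lemma quotient_cyclic:
  assumes s: "s \<in> norm_one" and gen: "\<And>x. x \<in> norm_one \<Longrightarrow> \<exists>i j. x = s powi i * tau powi j"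
    and N: "N > 0" and ord: "\<And>i. (\<exists>j. s powi i = tau powi j) \<longleftrightarrow> int N dvd i"
  shows "unitary_quotient n \<cong> integer_mod_group N"
proof (rule quotient_map)
  interpret Q: comm_group "unitary_quotient n" by (rule comm_group_unitary_quotient)
  fix \<pi>
  assume \<pi>: "\<pi> \<in> hom norm_one_group (unitary_quotient n)"
    "\<pi> ` norm_one = carrier (unitary_quotient n)"
    "\<And>x. x \<in> norm_one \<Longrightarrow> \<pi> x = \<one>\<^bsub>unitary_quotient n\<^esub> \<longleftrightarrow> (\<exists>k. x = tau powi k)"
  have \<pi>_pow: "\<pi> (x powi k) = \<pi> x [^]\<^bsub>unitary_quotient n\<^esub> k" if "x \<in> norm_one" for x k
    using hom_int_pow[OF \<pi>(1), of x k] that norm_one.is_group Q.is_group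
    by (simp add: pow_norm_one_group)
  have \<pi>s: "\<pi> s \<in> carrier (unitary_quotient n)" using \<pi>(2) s by blast
  show ?thesis
  proof (rule Q.iso_integer_mod_group[OF \<pi>s _ N])
    show "carrier (unitary_quotient n) = range (\<lambda>k::int. \<pi> s [^]\<^bsub>unitary_quotient n\<^esub> k)"
    proof
      show "carrier (unitary_quotient n) \<subseteq> range (\<lambda>k::int. \<pi> s [^]\<^bsub>unitary_quotient n\<^esub> k)"
      proof
        fix g assume "g \<in> carrier (unitary_quotient n)"
        then obtain x where x: "x \<in> norm_one" "g = \<pi> x" using \<pi>(2) by blast
        obtain i j where ij: "x = s powi i * tau powi j" using gen x(1) by blast
        have "g = \<pi> (s powi i) \<otimes>\<^bsub>unitary_quotient n\<^esub> \<pi> (tau powi j)"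
          using \<pi>(1) norm_one_powi[OF s] norm_one_powi[OF tau_in_norm_one] unfolding x(2) ij
          by (auto simp: hom_def)
        also have "\<pi> (tau powi j) = \<one>\<^bsub>unitary_quotient n\<^esub>"
          using \<pi>(3)[OF norm_one_powi[OF tau_in_norm_one]] by blast
        finally have "g = \<pi> s [^]\<^bsub>unitary_quotient n\<^esub> i" using \<pi>s by (simp add: \<pi>_pow[OF s])
        then show "g \<in> range (\<lambda>k::int. \<pi> s [^]\<^bsub>unitary_quotient n\<^esub> k)" by blast
      qed
    qed (use \<pi>s in auto)
    show "\<pi> s [^]\<^bsub>unitary_quotient n\<^esub> k = \<one>\<^bsub>unitary_quotient n\<^esub> \<longleftrightarrow> int N dvd k" for k :: int
      using \<pi>(3)[OF norm_one_powi[OF s, of k]] ord[of k] by (simp add: \<pi>_pow[OF s])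
  qed
qed

lemma quotient_trivial:
  assumes "\<And>x. x \<in> norm_one \<Longrightarrow> \<exists>j. x = tau powi j"
  shows "trivial_group (unitary_quotient n)"
proof (rule quotient_map)
  fix \<pi>
  assume \<pi>: "\<pi> ` norm_one = carrier (unitary_quotient n)"
    "\<And>x. x \<in> norm_one \<Longrightarrow> \<pi> x = \<one>\<^bsub>unitary_quotient n\<^esub> \<longleftrightarrow> (\<exists>k. x = tau powi k)"
  have "\<pi> ` norm_one = {\<one>\<^bsub>unitary_quotient n\<^esub>}"
    using assms \<pi>(2) one_in_norm_one by blast
  then show ?thesis
    using \<pi>(1) comm_group_unitary_quotient by (simp add: trivial_group_def comm_group_def)
qed

lemma minus_one_in_norm_one: "- 1 \<in> norm_one"
  using minus_norm_one[OF one_in_norm_one] .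

lemma val_minus_one:
  assumes "Factorial_Ring.prime p" "p dvd n"
  shows "val p (- 1) = 0"
proof -
  have "val p (- 1 * - 1) = val p (- 1) + val p (- 1)"
    by (intro val_mult assms minus_one_in_norm_one)
  moreover have "val p 1 = 0" using val_powi[OF assms one_in_norm_one, of 0] by simp
  ultimately show ?thesis by simp
qed

lemma quotient_sign:
  assumes gen: "\<And>x. x \<in> norm_one \<Longrightarrow> \<exists>j. x = tau powi j \<or> x = - (tau powi j)"
    and ord: "\<And>j. tau powi j \<noteq> - 1"
  shows "unitary_quotient n \<cong> integer_mod_group 2"
proof (rule quotient_cyclic[OF minus_one_in_norm_one])
  show "\<exists>i j. x = (- 1) powi i * tau powi j" if x: "x \<in> norm_one" for x
  proof -
    obtain j where "x = tau powi j \<or> x = - (tau powi j)" using gen x by blast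
    then have "x = (- 1) powi 0 * tau powi j \<or> x = (- 1) powi 1 * tau powi j" by auto
    then show ?thesis by blast
  qed
  show "(\<exists>j. (- 1) powi i = tau powi j) \<longleftrightarrow> int 2 dvd i" for i
    using ord exI[of "\<lambda>j. (- 1) powi i = tau powi j" 0] by (auto simp: powi_minus_one) (metis)
qed simp

lemma tau_powi_neq_minus_one:
  assumes "Factorial_Ring.prime p" "p dvd n"
  shows "tau powi j \<noteq> - 1"
proof
  assume eq: "tau powi j = - 1"
  then have "j * val p tau = 0"
    using val_powi[OF assms tau_in_norm_one, of j] val_minus_one[OF assms] by simp
  then have "j = 0" using val_tau(2)[OF assms] by simp
  then show False using eq by simp
qed

text \<open>The valuation of \<open>tau\<close> at the only prime is \<open>1\<close>, so a power of
  \<open>tau\<close> makes any element integral. As \<open>2 = 1 * 2\<close> is a square case, only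
  \<open>1\<close> and \<open>- 1\<close> are left.\<close>

lemma quotient_2:
  assumes "n = 2"
  shows "unitary_quotient n \<cong> integer_mod_group 2"
proof (rule quotient_sign)
  have p: "Factorial_Ring.prime (2::int)" "2 dvd n" using assms by simp_all
  show "tau powi j \<noteq> - 1" for j by (rule tau_powi_neq_minus_one[OF p])
  have val1: "val 2 tau = 1" using val_tau(1)[OF p] assms by simp
  fix x assume x: "x \<in> norm_one"
  define y where "y = x * tau powi (- val 2 x)"
  have y: "y \<in> norm_one" unfolding y_def by (intro norm_one_mult norm_one_powi x tau_in_norm_one)
  have "val 2 y = 0"
    unfolding y_def using val1 by (simp add: val_mult val_powi p x tau_in_norm_one norm_one_powi)
  moreover have "q = 2" if "Factorial_Ring.prime q" "q dvd n" for q
    using that p(1) assms by (simp add: primes_dvd_imp_eq)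
  ultimately obtain a b where ab: "y = E1 a b" "nrm a b = 1"
    using integral_norm_one[OF y] by metis
  have "b = 0" using nrm_one_square[of 1 a b] ab(2) assms by simp
  then have "a * a = 1" "y = of_int a" using ab by (simp_all add: nrm_def E_of_int)
  then have "y = 1 \<or> y = - 1" by (auto simp: zmult_eq_1_iff)
  moreover have "x = y * tau powi (val 2 x)" by (simp add: y_def power_int_minus)
  ultimately show "\<exists>j. x = tau powi j \<or> x = - (tau powi j)" by auto
qed

text \<open>Here \<open>\<int>[w]\<close> is the ring of Eisenstein integers, whose six units are
  the powers of \<open>tau = 1 - w\<close>, a primitive sixth root of unity.\<close>

lemma quotient_minus_1:
  assumes "n = - 1"
  shows "trivial_group (unitary_quotient n)"
proof (rule quotient_trivial)
  fix x assume x: "x \<in> norm_one"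
  have "False" if "Factorial_Ring.prime q" "q dvd n" for q :: int
    using that assms not_prime_unit by auto
  then obtain a b where ab: "x = E1 a b" "nrm a b = 1" using integral_norm_one[OF x] by metis
  have tau: "tau = 1 - w" unfolding tau_def by (simp add: assms)
  have ww: "w * w = w - 1" using w_square assms by simp
  have N: "a * a + a * b + b * b = 1" using ab(2) unfolding nrm_def by (simp add: assms)
  have "4 = (2 * a + b)\<^sup>2 + 3 * b\<^sup>2" "4 = (2 * b + a)\<^sup>2 + 3 * a\<^sup>2"
    unfolding power2_eq_square using N by Groebner_Basis.algebra+
  moreover have "(2 * a + b)\<^sup>2 \<ge> 0" "(2 * b + a)\<^sup>2 \<ge> 0" by simp_all
  ultimately have "b\<^sup>2 \<le> 1" "a\<^sup>2 \<le> 1" by linarith+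
  then have "\<bar>b\<bar> \<le> 1" "\<bar>a\<bar> \<le> 1" by (simp_all add: abs_square_le_1)
  then have "a = - 1 \<or> a = 0 \<or> a = 1" "b = - 1 \<or> b = 0 \<or> b = 1" by linarith+
  then have "(a, b) \<in> {(1, 0), (- 1, 0), (0, 1), (0, - 1), (1, - 1), (- 1, 1)}"
    using N by auto
  then have cases: "x \<in> {1, - 1, w, - w, 1 - w, w - 1}"
    unfolding ab(1) by (auto simp: E1_def)
  have p2: "tau ^ 2 = - w" using ww by (simp add: tau power2_eq_square algebra_simps)
  have p3: "tau ^ 3 = - 1"
  proof -
    have "tau ^ 3 = tau ^ 2 * tau" by (simp add: power3_eq_cube power2_eq_square)
    also have "\<dots> = - 1" unfolding p2 using ww by (simp add: tau algebra_simps)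
    finally show ?thesis .
  qed
  have p4: "tau ^ 4 = w - 1"
  proof -
    have "tau ^ 4 = tau ^ 3 * tau" by (simp add: power_numeral_reduce)
    then show ?thesis unfolding p3 by (simp add: tau)
  qed
  have p5: "tau ^ 5 = w"
  proof -
    have "tau ^ 5 = tau ^ 3 * tau ^ 2" by (simp add: power_numeral_reduce)
    then show ?thesis unfolding p3 p2 by simp
  qed
  have "x = tau ^ 0 \<or> x = tau ^ 1 \<or> x = tau ^ 2 \<or> x = tau ^ 3 \<or> x = tau ^ 4 \<or> x = tau ^ 5"
    unfolding p2 p3 p4 p5 using cases by (auto simp: tau)
  then show "\<exists>j. x = tau powi j" by (metis power_int_of_nat)
qed

text \<open>Here \<open>w\<close> is the golden ratio, of norm \<open>- 1\<close>, and
  \<open>tau = 1 + w\<close> is its square, of trace \<open>3\<close>. A norm-one unit scaled to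
  absolute value \<open>y\<close> in the interval from \<open>1\<close> to \<open>tau\<close> has
  trace of absolute value \<open>y + 1 / y\<close>, an integer at least \<open>2\<close> and below
  \<open>3\<close>. Trace \<open>2\<close> or \<open>- 2\<close> means that the unit is
  \<open>1\<close> or \<open>- 1\<close>.\<close>

lemma quotient_1:
  assumes n: "n = 1" and w: "w = of_real r" "r > 0"
  shows "unitary_quotient n \<cong> integer_mod_group 2"
proof (rule quotient_sign)
  define t where "t = 1 + r"
  have tau: "tau = of_real t" unfolding tau_def by (simp add: n w t_def)
  have t: "t > 1" using w by (simp add: t_def)
  have "complex_of_real (r * r) = of_real (r + 1)" using w_square by (simp add: w n)
  then have rr: "r * r = r + 1" by (simp only: of_real_eq_iff)
  have t_inv: "t + inverse t = 3"
  proof -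
    have "t * (2 - r) = 1" using rr by (simp add: t_def algebra_simps)
    then have "inverse t = 2 - r" by (rule inverse_unique)
    then show ?thesis by (simp add: t_def)
  qed
  show "tau powi j \<noteq> - 1" for j
  proof
    assume "tau powi j = - 1"
    then have "complex_of_real (t powi j) = of_real (- 1)" by (simp add: tau)
    then have "t powi j = - 1" by (simp only: of_real_eq_iff)
    then show False using zero_less_power_int[of t j] t by simp
  qed
  fix x assume x: "x \<in> norm_one"
  have cm: "cmod tau = t" using t by (simp add: tau)
  then have "cmod tau > 1" using t by simp
  then obtain k where k: "1 \<le> cmod (x * tau powi k)" "cmod (x * tau powi k) < t"
    using scale_into_fundamental_interval[OF norm_one_nonzero[OF x], of tau] cm by metis
  define z where "z = x * tau powi k"
  have z: "z \<in> norm_one" unfolding z_def by (intro norm_one_mult norm_one_powi x tau_in_norm_one)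
  have "False" if "Factorial_Ring.prime q" "q dvd n" for q :: int
    using that n not_prime_unit by auto
  then obtain a b where ab: "z = E1 a b" "nrm a b = 1" using integral_norm_one[OF z] by metis
  define \<zeta> where "\<zeta> = of_int a + of_int b * r"
  have z\<zeta>: "z = of_real \<zeta>" unfolding ab(1) E_of_real[OF w(1)] \<zeta>_def ..
  have \<zeta>: "1 \<le> \<bar>\<zeta>\<bar>" "\<bar>\<zeta>\<bar> < t" using k unfolding z_def[symmetric] z\<zeta> by simp_all
  have prod: "\<zeta> * (of_int (2 * a + b) - \<zeta>) = 1"
  proof -
    have "complex_of_real (\<zeta> * (of_int (2 * a + b) - \<zeta>)) = E1 a b * E2 a b"
      unfolding E_of_real[OF w(1)] \<zeta>_def by (simp add: algebra_simps)
    also have "\<dots> = of_real 1" using E1_E2 ab(2) by simp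
    finally show ?thesis by (simp only: of_real_eq_iff)
  qed
  define y where "y = \<bar>\<zeta>\<bar>"
  have y: "1 \<le> y" "y < t" using \<zeta> by (simp_all add: y_def)
  have "inverse \<zeta> = of_int (2 * a + b) - \<zeta>" using prod by (rule inverse_unique)
  then have tr: "of_int (2 * a + b) = \<zeta> + inverse \<zeta>" by simp
  have "\<bar>\<zeta> + inverse \<zeta>\<bar> = y + inverse y"
  proof (cases "\<zeta> > 0")
    case True
    then have "\<zeta> + inverse \<zeta> > 0" by (simp add: add_pos_pos)
    then show ?thesis using True by (simp add: y_def)
  next
    case False
    then have neg: "\<zeta> < 0" using \<zeta>(1) by auto
    then have "\<zeta> + inverse \<zeta> < 0" by (simp add: add_neg_neg)
    then show ?thesis using neg by (simp add: y_def)
  qed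
  then have tr': "real_of_int \<bar>2 * a + b\<bar> = y + inverse y" using tr by simp
  have "y + inverse y < t + inverse t"
  proof -
    have "(t - y) * (t * y - 1) > 0"
    proof -
      have "1 * 1 < t * y" using t y by (intro mult_less_le_imp_less) auto
      then show ?thesis using y by simp
    qed
    moreover have "inverse y * y = 1" "inverse t * t = 1" using t y by simp_all
    then have "(t + inverse t) * (t * y) - (y + inverse y) * (t * y) = (t - y) * (t * y - 1)"
      by Groebner_Basis.algebra
    ultimately have "(y + inverse y) * (t * y) < (t + inverse t) * (t * y)" by linarith
    moreover have "t * y > 0" using t y by simp
    ultimately show ?thesis by (simp only: mult_less_cancel_right_pos)
  qed
  then have "real_of_int \<bar>2 * a + b\<bar> < 3" using tr' t_inv by simp
  moreover have "y + inverse y \<ge> 2"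
  proof -
    have "0 \<le> (y - 1) * (y - 1)" by simp
    moreover have "(y + inverse y) * y = y * y + 1" using y by (simp add: distrib_right)
    ultimately have "2 * y \<le> (y + inverse y) * y" by (simp add: algebra_simps)
    moreover have "y > 0" using y by simp
    ultimately show ?thesis by (simp only: mult_le_cancel_right_pos)
  qed
  ultimately have "2 \<le> real_of_int \<bar>2 * a + b\<bar>" "real_of_int \<bar>2 * a + b\<bar> < 3" using tr' by auto
  then have "\<bar>2 * a + b\<bar> = 2" by linarith
  then have "2 * a + b = 2 \<or> 2 * a + b = - 2" by linarith
  then have "(\<zeta> - 1) * (\<zeta> - 1) = 0 \<or> (\<zeta> + 1) * (\<zeta> + 1) = 0"
  proof
    assume "2 * a + b = 2"
    then have "\<zeta> * (2 - \<zeta>) = 1" using prod by simp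
    then have "(\<zeta> - 1) * (\<zeta> - 1) = 0" by Groebner_Basis.algebra
    then show ?thesis ..
  next
    assume "2 * a + b = - 2"
    then have "\<zeta> * (- 2 - \<zeta>) = 1" using prod by simp
    then have "(\<zeta> + 1) * (\<zeta> + 1) = 0" by Groebner_Basis.algebra
    then show ?thesis ..
  qed
  then have "\<zeta> = 1 \<or> \<zeta> = - 1" by (auto simp: add_eq_0_iff)
  then have "z = 1 \<or> z = - 1" using z\<zeta> by auto
  moreover have "x = z * tau powi (- k)" by (simp add: z_def power_int_minus)
  ultimately show "\<exists>j. x = tau powi j \<or> x = - (tau powi j)" by auto
qed

end

section \<open>The quotient for negatives of prime powers\<close>

lemma int_odd_square_bound:
  fixes a b q D :: int
  assumes eq: "4 * D\<^sup>2 = (2 * a + b)\<^sup>2 + (4 * q - 1) * b\<^sup>2" and "b \<noteq> 0" "q \<ge> 2"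
    and le: "D\<^sup>2 = q \<or> 2 * D\<^sup>2 \<le> q"
  shows "D\<^sup>2 = q" "(a, b) \<in> {(0, 1), (- 1, 1), (0, - 1), (1, - 1)}"
proof -
  \<comment> \<open>The equation is \<open>nrm a b = D^2\<close> for \<open>n = - q\<close>, with
    the square completed. A nonzero \<open>b\<close> makes the right-hand side at least
    \<open>4 q - 1\<close>, which excludes \<open>2 D^2 \<le> q\<close> and, for
    \<open>D^2 = q\<close>, leaves only \<open>b^2 = 1\<close>.\<close>
  define u v where "u = (2 * a + b)\<^sup>2" and "v = (4 * q - 1) * b\<^sup>2"
  have nonneg: "0 \<le> u" by (simp add: u_def)
  have uv: "4 * D\<^sup>2 = u + v" using eq by (simp add: u_def v_def)
  have b1: "1 \<le> b\<^sup>2" using \<open>b \<noteq> 0\<close> by (simp add: int_one_le_iff_zero_less)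
  have "(4 * q - 1) * 1 \<le> v"
    unfolding v_def using b1 \<open>q \<ge> 2\<close> by (intro mult_left_mono) auto
  then have "4 * q - 1 \<le> v" by simp
  then have ge: "4 * q - 1 \<le> 4 * D\<^sup>2" using uv nonneg by linarith
  then show D: "D\<^sup>2 = q" using le \<open>q \<ge> 2\<close> by linarith
  have "b\<^sup>2 < 2"
  proof (rule ccontr)
    assume "\<not> b\<^sup>2 < 2"
    then have "(4 * q - 1) * 2 \<le> v" unfolding v_def using \<open>q \<ge> 2\<close> by (intro mult_left_mono) auto
    then have "8 * q - 2 \<le> v" by simp
    then show False using uv nonneg D \<open>q \<ge> 2\<close> by linarith
  qed
  then have b2: "b\<^sup>2 = 1" using b1 by simp
  then have "(2 * a + b)\<^sup>2 = 1" using eq D by simp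
  then have "2 * a + b = 1 \<or> 2 * a + b = - 1" by (simp add: power2_eq_1_iff)
  moreover have "b = 1 \<or> b = - 1" using b2 by (simp add: power2_eq_1_iff)
  ultimately show "(a, b) \<in> {(0, 1), (- 1, 1), (0, - 1), (1, - 1)}" by auto
qed

context quadratic_order
begin

lemma tau_square: "tau * of_int n = w * w"
  using w_square by (simp add: tau_def field_simps)

lemma norm_one_prime_power:
  assumes p: "Factorial_Ring.prime p" "k \<ge> 1" and n: "n = - (p ^ k)" and x: "x \<in> norm_one"
  obtains j y where "x = y * tau powi j"
    "y \<in> {1, - 1} \<or> even k \<and> y * of_int (p ^ (k div 2)) \<in> {w, w - 1, - w, 1 - w}"
proof -
  have p1: "p > 1" using p(1) by (simp add: prime_gt_1_int)
  have pn: "p dvd n" using n p(2) by (simp add: dvd_power)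
  define K where "K = int k"
  have "multiplicity p n = k"
    unfolding n using p1 p(1) by (simp add: multiplicity_same_power multiplicity_uminus_right)
  then have K: "val p tau = K" "K > 0" using val_tau[OF p(1) pn] by (simp_all add: K_def)
  \<comment> \<open>The integer nearest to \<open>val p x / K\<close>, so that at most half of
    \<open>K\<close> remains as valuation.\<close>
  define j where "j = (2 * val p x + K) div (2 * K)"
  define y where "y = x * tau powi (- j)"
  have y: "y \<in> norm_one" unfolding y_def by (intro norm_one_mult norm_one_powi x tau_in_norm_one)
  have val_y: "val p y = val p x - j * K"
    unfolding y_def by (simp add: val_mult val_powi p pn x tau_in_norm_one norm_one_powi K)
  have "2 * \<bar>val p y\<bar> \<le> K"
  proof -
    have "2 * K * j + (2 * val p x + K) mod (2 * K) = 2 * val p x + K" by (simp add: j_def)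
    moreover have "0 \<le> (2 * val p x + K) mod (2 * K)" "(2 * val p x + K) mod (2 * K) < 2 * K"
      using K(2) by simp_all
    ultimately have "2 * (val p x - j * K) + K \<ge> 0" "2 * (val p x - j * K) + K < 2 * K"
      by (simp_all add: algebra_simps)
    then show ?thesis unfolding val_y by linarith
  qed
  define e where "e = nat \<bar>val p y\<bar>"
  have e: "2 * e \<le> k" using \<open>2 * \<bar>val p y\<bar> \<le> K\<close> by (simp add: e_def K_def)
  define D where "D = p ^ e"
  have D: "D > 0" using p1 by (simp add: D_def)
  have "\<exists>a b. y * of_int D = E1 a b \<and> of_int D = y * E2 a b"
  proof (rule denominator_bound[OF y])
    fix q assume "Factorial_Ring.prime q" "q dvd n"
    then have "q = p" using p n by (metis dvd_minus_iff prime_dvd_power primes_dvd_imp_eq)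
    then show "q ^ nat \<bar>val q y\<bar> dvd D" by (simp add: D_def e_def)
  qed (use D in simp)
  then obtain a b where ab: "y * of_int D = E1 a b" "of_int D = y * E2 a b" by blast
  have "complex_of_int (nrm a b) = of_int (D\<^sup>2)"
    unfolding E1_E2[symmetric] ab(1)[symmetric] power2_eq_square of_int_mult by (simp add: ab(2) mult_ac)
  then have nrm: "nrm a b = D\<^sup>2" by (simp only: of_int_eq_iff)
  define q where "q = p ^ k"
  have D2: "D\<^sup>2 = p ^ (2 * e)" by (simp add: D_def power_mult mult.commute[of 2])
  have eq: "4 * D\<^sup>2 = (2 * a + b)\<^sup>2 + (4 * q - 1) * b\<^sup>2"
    using four_nrm[of a b] unfolding nrm unfolding n q_def[symmetric] by (simp add: algebra_simps)
  \<comment> \<open>Both sides are powers of \<open>p\<close>, and a smaller power is smaller by a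
    factor of at least \<open>2\<close>.\<close>
  have le: "D\<^sup>2 = q \<or> 2 * D\<^sup>2 \<le> q"
  proof (cases "2 * e = k")
    case True
    then show ?thesis unfolding D2 q_def by simp
  next
    case False
    then have "2 * p ^ (2 * e) \<le> p * p ^ (2 * e)" using p1 by (intro mult_right_mono) auto
    also have "\<dots> = p ^ (Suc (2 * e))" by simp
    also have "\<dots> \<le> p ^ k" using False e p1 by (intro power_increasing) auto
    finally show ?thesis unfolding D2 q_def by simp
  qed
  have q2: "q \<ge> 2"
  proof -
    have "p ^ 1 \<le> p ^ k" using p(2) p1 by (intro power_increasing) auto
    then show ?thesis using p1 by (simp add: q_def)
  qed
  have "x = y * tau powi j" by (simp add: y_def power_int_minus)
  moreover have "y \<in> {1, - 1} \<or> even k \<and> y * of_int (p ^ (k div 2)) \<in> {w, w - 1, - w, 1 - w}"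
  proof (cases "b = 0")
    case True
    then have "a\<^sup>2 = D\<^sup>2" using nrm by (simp add: nrm_def power2_eq_square)
    then have "a = D \<or> a = - D" by (simp add: power2_eq_iff)
    moreover have "y * of_int D = of_int a" using ab(1) True by (simp add: E_of_int)
    ultimately have "y * of_int D = of_int D \<or> y * of_int D = (- 1) * of_int D" by auto
    then have "y = 1 \<or> y = - 1" using D by (metis mult_right_cancel mult_1 less_irrefl of_int_eq_0_iff)
    then show ?thesis by simp
  next
    case False
    have "D\<^sup>2 = q" and cases: "(a, b) \<in> {(0, 1), (- 1, 1), (0, - 1), (1, - 1)}"
      using int_odd_square_bound[OF eq False q2 le] by auto
    then have "2 * e = k" using p1 unfolding D2 q_def by simp
    then have "even k" "e = k div 2" by auto
    moreover have "y * of_int D \<in> {w, w - 1, - w, 1 - w}"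
      using cases unfolding ab(1) by (auto simp: E1_def)
    ultimately show ?thesis by (simp add: D_def)
  qed
  ultimately show ?thesis using that by blast
qed

lemma quotient_prime_power_odd:
  assumes p: "Factorial_Ring.prime p" "k \<ge> 1" "odd k" and n: "n = - (p ^ k)"
  shows "unitary_quotient n \<cong> integer_mod_group 2"
proof (rule quotient_sign)
  have "p dvd n" using n p(2) by (simp add: dvd_power)
  then show "tau powi j \<noteq> - 1" for j by (rule tau_powi_neq_minus_one[OF p(1)])
  fix x assume x: "x \<in> norm_one"
  obtain j y where "x = y * tau powi j" "y \<in> {1, - 1}"
    by (rule norm_one_prime_power[OF p(1,2) n x]) (use p(3) in blast)
  then show "\<exists>j. x = tau powi j \<or> x = - (tau powi j)" by auto
qed

text \<open>In the quotient \<open>s^2 = - tau\<close> becomes the class of \<open>- 1\<close>,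
  which is nontrivial; hence \<open>s\<close> has order \<open>4\<close> there, and it accounts for
  the signs as well.\<close>

lemma quotient_prime_power_even:
  assumes p: "Factorial_Ring.prime p" "k \<ge> 1" "even k" and n: "n = - (p ^ k)"
  shows "unitary_quotient n \<cong> integer_mod_group 4"
proof -
  have p1: "p > 1" using p(1) by (simp add: prime_gt_1_int)
  have pn: "p dvd n" using n p(2) by (simp add: dvd_power)
  define D where "D = p ^ (k div 2)"
  have D: "D > 0" "D * D = - n" using p1 p(3) by (auto simp: D_def n simp flip: power_add)
  then have DD: "complex_of_int D * of_int D = - of_int n" by (metis of_int_minus of_int_mult)
  define s where "s = w / of_int D"
  have sD: "s * of_int D = w" using D by (simp add: s_def)
  have s_inv: "s * (1 - w) = of_int D"
  proof -
    have "w * (1 - w) = of_int D * of_int D" using w_square DD by (simp add: algebra_simps)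
    then show ?thesis using D by (simp add: s_def)
  qed
  have s: "s \<in> norm_one"
  proof (rule norm_oneI[of s D 0 1 k])
    show "s * of_int D = E1 0 1" "of_int D = s * E2 0 1"
      using sD s_inv by (simp_all add: E1_def E2_def)
    have "D dvd p ^ k" unfolding D_def by (intro le_imp_power_dvd) simp
    also have "p ^ k dvd n ^ k" by (rule dvd_power_same[OF pn])
    finally show "D dvd n ^ k" .
  qed
  have s0: "s \<noteq> 0" by (rule norm_one_nonzero[OF s])
  have ss: "s * s = - tau"
  proof -
    have "(s * s) * of_int n = - tau * of_int n"
      using sD DD tau_square by (simp add: s_def)
    then show ?thesis by (metis mult_right_cancel n_nonzero of_int_eq_0_iff)
  qed
  have "val p s + val p s = val p tau"
  proof -
    have "val p (s * s) = val p (- 1 * tau)" unfolding ss by simp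
    then show ?thesis
      using val_mult[OF p(1) pn s s] val_mult[OF p(1) pn minus_one_in_norm_one tau_in_norm_one]
        val_minus_one[OF p(1) pn] by simp
  qed
  then have val_s: "val p tau = 2 * val p s" "val p s > 0" using val_tau(2)[OF p(1) pn] by simp_all
  have s_even: "s powi (2 * j) = (- 1) powi j * tau powi j" for j
  proof -
    have "s powi (2 * j) = (s * s) powi j"
      using s0 by (metis power_int_mult_distrib power_int_add mult_2)
    also have "\<dots> = (- 1 * tau) powi j" unfolding ss by simp
    also have "\<dots> = (- 1) powi j * tau powi j" by (rule power_int_mult_distrib)
    finally show ?thesis .
  qed
  show ?thesis
  proof (rule quotient_cyclic[OF s])
    show "(\<exists>j. s powi i = tau powi j) \<longleftrightarrow> int 4 dvd i" for i
    proof
      assume "\<exists>j. s powi i = tau powi j"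
      then obtain j where j: "s powi i = tau powi j" by blast
      then have "i * val p s = j * val p tau"
        using val_powi[OF p(1) pn s, of i] val_powi[OF p(1) pn tau_in_norm_one, of j] by simp
      \<comment> \<open>Valuations give \<open>i = 2 j\<close>; comparing signs then forces
        \<open>j\<close> to be even.\<close>
      then have i: "i = 2 * j" using val_s by simp
      then have "(- 1 :: complex) powi j = 1" using j s_even[of j] by simp
      then have "even j" by (simp add: powi_minus_one split: if_splits)
      then show "int 4 dvd i" unfolding i by auto
    next
      assume "int 4 dvd i"
      then obtain l where "i = 2 * (2 * l)" by auto
      then have "s powi i = tau powi (2 * l)" using s_even[of "2 * l"] by (simp add: powi_minus_one)
      then show "\<exists>j. s powi i = tau powi j" by blast
    qed
    fix x assume x: "x \<in> norm_one"
    obtain j y where xy: "x = y * tau powi j"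
      and y: "y \<in> {1, - 1} \<or> y * of_int D \<in> {w, w - 1, - w, 1 - w}"
      by (rule norm_one_prime_power[OF p(1,2) n x]) (unfold D_def, blast)
    have si: "inverse s * of_int D = 1 - w" using s_inv s0 by (simp add: field_simps)
    have "y \<in> {1, - 1, s, inverse s, - s, - inverse s}"
    proof -
      have D0: "complex_of_int D \<noteq> 0" using D by simp
      have "y = z" if "y * of_int D = z * of_int D" for z using that D0 by simp
      moreover have "w = s * of_int D" "- w = (- s) * of_int D" "1 - w = inverse s * of_int D"
        "w - 1 = (- inverse s) * of_int D"
        using sD si by (simp_all add: algebra_simps)
      ultimately show ?thesis using y by (metis insert_iff empty_iff)
    qed
    then have "\<exists>i l. y = s powi i * tau powi l"
    proof -
      \<comment> \<open>The sign is absorbed through \<open>- 1 = s^2 / tau\<close>.\<close>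
      have m1: "- z = s powi (2 + i) * tau powi (- 1)" if "z = s powi i" for z i
      proof -
        have "s powi (2 + i) = s powi 2 * s powi i" using s0 by (metis power_int_add)
        also have "s powi 2 = - tau" using ss by (simp add: power_int_def power2_eq_square)
        finally show ?thesis unfolding that by (simp add: power_int_minus)
      qed
      assume "y \<in> {1, - 1, s, inverse s, - s, - inverse s}"
      then consider "y = s powi 0 * tau powi 0" | "y = - (s powi 0)" | "y = s powi 1 * tau powi 0"
        | "y = s powi (- 1) * tau powi 0" | "y = - (s powi 1)" | "y = - (s powi (- 1))"
        by (auto simp: power_int_minus)
      then show ?thesis using m1[OF refl] by cases blast+
    qed
    then obtain i l where "y = s powi i * tau powi l" by blast
    then have "x = s powi i * tau powi (l + j)" unfolding xy by (simp add: power_int_add)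
    then show "\<exists>i j. x = s powi i * tau powi j" by blast
  qed simp
qed


section \<open>Irreducibility of the polynomial\<close>

lemma irreducible_Delta:
  assumes nonsq: "\<nexists>s. s\<^sup>2 = 4 * n + 1"
  shows "Factorial_Ring.irreducible (Delta n)"
proof (rule Factorial_Ring.irreducibleI)
  have eval: "laurent_eval tau (Delta n) = 0" by (rule laurent_eval_Delta)
  show nz: "Delta n \<noteq> 0"
  proof
    assume "Delta n = 0"
    moreover have "laurent_eval 1 (Delta n) = - 1"
      by (simp add: Delta_def laurent_eval_add laurent_eval_diff)
    ultimately show False by simp
  qed
  show "\<not> Delta n dvd 1"
  proof
    assume "Delta n dvd 1"
    then obtain q where "1 = Delta n * q" by blast
    then have "laurent_eval tau 1 = laurent_eval tau (Delta n) * laurent_eval tau q"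
      using laurent_eval_mult[OF tau_nonzero] by metis
    then show False using eval by simp
  qed
  \<comment> \<open>For nonsquare \<open>4 n + 1\<close> vanishing at \<open>tau\<close> alone
    suffices, because only \<open>0\<close> has norm \<open>0\<close>. So \<open>Delta n\<close>
    generates the kernel of an evaluation into a field, and it divides a factor of every product
    that vanishes there.\<close>
  have dvd: "Delta n dvd p" if p: "laurent_eval tau p = 0" for p
  proof -
    obtain k a b where *: "Delta n dvd p - (of_int a + of_int b * W) * M ^ k"
      "laurent_eval tau p * of_int n ^ k = E1 a b" "laurent_eval (inverse tau) p * of_int n ^ k = E2 a b"
      by (rule laurent_fraction_cases)
    have "complex_of_int (nrm a b) = 0" using *(2) p by (simp flip: E1_E2)
    then have "nrm a b = 0" by simp
    then have "a = 0" "b = 0" using nrm_eq_0D[OF nonsq] by blast+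
    then show ?thesis using *(1) by simp
  qed
  have unit: "q dvd 1" if pq: "Delta n = p * q" and "Delta n dvd p" for p q
  proof -
    obtain r where "p = Delta n * r" using \<open>Delta n dvd p\<close> by blast
    then have "Delta n * 1 = Delta n * (r * q)" using pq by (metis mult.assoc mult.right_neutral)
    then have "1 = r * q" using nz by (metis mult_left_cancel)
    then show ?thesis by (metis dvd_triv_right)
  qed
  fix p q assume pq: "Delta n = p * q"
  then have "laurent_eval tau p * laurent_eval tau q = 0"
    using eval by (simp add: laurent_eval_mult)
  then have "Delta n dvd p \<or> Delta n dvd q" using dvd by (metis mult_eq_0_iff)
  moreover have "Delta n = q * p" using pq by (simp only: mult.commute)
  ultimately show "p dvd 1 \<or> q dvd 1" using unit pq by blast
qed

end

text \<open>The factors are \<open>m t - (m + 1)\<close> and \<open>(m + 1) - m / t\<close>. Neither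
  is a unit, since each has a nonzero complex root.\<close>

lemma not_irreducible_Delta:
  assumes "n = m * (m + 1)" "m > 0"
  shows "\<not> Factorial_Ring.irreducible (Delta n)"
proof
  assume irr: "Factorial_Ring.irreducible (Delta n)"
  define f g :: laurent where "f = Poly_Mapping.single 1 m - Poly_Mapping.single 0 (m + 1)"
    and "g = Poly_Mapping.single 0 (m + 1) - Poly_Mapping.single (- 1) m"
  have "f * g = Poly_Mapping.single 1 (m * (m + 1)) - Poly_Mapping.single 0 (m * m)
      - (Poly_Mapping.single 0 ((m + 1) * (m + 1)) - Poly_Mapping.single (- 1) ((m + 1) * m))"
    by (simp only: f_def g_def left_diff_distrib right_diff_distrib mult_single) simp
  also have "\<dots> = Delta n"
    unfolding Delta_def assms(1)
    by (rule poly_mapping_eqI) (auto simp: lookup_add lookup_minus lookup_single when_def algebra_simps)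
  finally have "f dvd 1 \<or> g dvd 1"
    using irr by (metis Factorial_Ring.irreducible_def)
  moreover have "\<not> p dvd 1" if "laurent_eval x p = 0" "x \<noteq> 0" for x p
  proof
    assume "p dvd 1"
    then obtain q where "1 = p * q" by blast
    then have "laurent_eval x 1 = laurent_eval x p * laurent_eval x q"
      using laurent_eval_mult[OF that(2)] by metis
    then show False using that by simp
  qed
  moreover have "laurent_eval (of_int (m + 1) / of_int m) f = 0"
    using assms(2) by (simp add: f_def laurent_eval_diff)
  moreover have "laurent_eval (of_int m / of_int (m + 1)) g = 0"
    using assms(2) by (simp add: g_def laurent_eval_diff power_int_minus)
  moreover have "complex_of_int (m + 1) / of_int m \<noteq> 0" "complex_of_int m / of_int (m + 1) \<noteq> 0"
    using assms(2) by (simp_all flip: of_int_add add: of_int_eq_0_iff del: of_int_add)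
  ultimately show False by blast
qed

section \<open>Choice of the root, and counting prime divisors\<close>

lemma quadratic_order_exists:
  assumes "n \<noteq> 0"
  obtains w where "quadratic_order n w"
proof
  define s where "s = csqrt (of_int (4 * n + 1))"
  have "s * s = 4 * of_int n + 1"
    unfolding s_def by (metis of_int_1 of_int_add of_int_mult of_int_numeral power2_csqrt power2_eq_square)
  then have "(1 + s) / 2 * ((1 + s) / 2) = (1 + s) / 2 + of_int n"
    by (simp add: field_simps)
  then show "quadratic_order n ((1 + s) / 2)" using assms by unfold_locales
qed

lemma real_quadratic_order_exists:
  assumes "n > 0"
  obtains r where "quadratic_order n (of_real r)" "r > 0" "\<bar>2 * r - 1\<bar> \<ge> 1"
proof
  define s where "s = sqrt (of_int (4 * n + 1))"
  have ss: "s * s = 4 * of_int n + 1" using assms by (simp add: s_def)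
  have s1: "s \<ge> 1" using assms by (simp add: s_def)
  have "(1 + s) / 2 * ((1 + s) / 2) = (1 + s) / 2 + of_int n"
    using ss by (simp add: field_simps)
  then have "complex_of_real ((1 + s) / 2 * ((1 + s) / 2)) = of_real ((1 + s) / 2 + of_int n)"
    by simp
  then show "quadratic_order n (of_real ((1 + s) / 2))"
    using assms by unfold_locales (simp_all only: of_real_mult of_real_add of_real_of_int_eq)
  show "(1 + s) / 2 > 0" "\<bar>2 * ((1 + s) / 2) - 1\<bar> \<ge> 1" using s1 by simp_all
qed

lemma square_discriminant:
  fixes n :: int
  assumes "s\<^sup>2 = 4 * n + 1" "n > 0"
  obtains m where "n = m * (m + 1)" "m > 0"
proof -
  define t where "t = \<bar>s\<bar>"
  have t: "t * t = 4 * n + 1" "t \<ge> 0" using assms(1) by (simp_all add: t_def power2_eq_square flip: abs_mult)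
  have "odd (t * t)" unfolding t(1) by simp
  then have "odd t" by simp
  then obtain m where m: "t = 2 * m + 1" by (elim oddE)
  then have "4 * n = 4 * (m * (m + 1))" using t(1) by (simp add: algebra_simps)
  then have n: "n = m * (m + 1)" by simp
  moreover have "m \<ge> 0" using m t(2) by simp
  moreover have "m \<noteq> 0" using n assms(2) by auto
  ultimately show ?thesis using that by simp
qed

text \<open>For \<open>n = 0\<close> the polynomial is \<open>- 1\<close>, so the quotient ring is
  the zero ring.\<close>

lemma unitary_quotient_0: "trivial_group (unitary_quotient 0)"
proof -
  have "Delta 0 = - 1"
    by (simp add: Delta_def)
  then have eq: "residue_class 0 p = residue_class 0 q" for p q
    by (simp add: residue_class_eq_iff)
  have U: "carrier (unitary_group 0) \<subseteq> {\<one>\<^bsub>unitary_group 0\<^esub>}"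
    using eq by (auto simp: unitary_group_def unitary_units_def carrier_alexander_ring one_alexander_ring)
  interpret U: comm_group "unitary_group 0" by (rule comm_group_unitary_group)
  interpret Q: comm_group "unitary_quotient 0" by (rule comm_group_unitary_quotient)
  have "t_powers 0 #>\<^bsub>unitary_group 0\<^esub> \<one>\<^bsub>unitary_group 0\<^esub> = \<one>\<^bsub>unitary_quotient 0\<^esub>"
    using U.coset_join2[OF U.one_closed subgroup_t_powers subgroup.one_closed[OF subgroup_t_powers]]
    by (simp add: unitary_quotient_def)
  then have "carrier (unitary_quotient 0) \<subseteq> {\<one>\<^bsub>unitary_quotient 0\<^esub>}"
    using U unfolding unitary_quotient_def carrier_FactGroup by auto
  then show ?thesis unfolding trivial_group_def using Q.is_group Q.one_closed by blast
qed

lemma finite_prime_divisors: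
  assumes "n \<noteq> 0"
  shows "finite {p :: nat. Factorial_Ring.prime p \<and> int p dvd n}"
proof (rule finite_subset)
  show "{p :: nat. Factorial_Ring.prime p \<and> int p dvd n} \<subseteq> {..nat \<bar>n\<bar>}"
  proof
    fix p assume "p \<in> {p :: nat. Factorial_Ring.prime p \<and> int p dvd n}"
    then have "\<bar>int p\<bar> \<le> \<bar>n\<bar>" using assms by (intro dvd_imp_le_int) auto
    then show "p \<in> {..nat \<bar>n\<bar>}" by simp
  qed
qed simp

lemma num_primes_ge_2:
  assumes "n \<noteq> 0" "Factorial_Ring.prime p" "Factorial_Ring.prime q" "p \<noteq> q" "int p dvd n" "int q dvd n"
  shows "num_primes n \<ge> 2"
proof -
  have "finite {p :: nat. Factorial_Ring.prime p \<and> int p dvd n}"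
    using assms(1) by (rule finite_prime_divisors)
  then have "card {p, q} \<le> num_primes n"
    unfolding num_primes_def using assms by (intro card_mono) auto
  then show ?thesis using assms(4) by simp
qed

text \<open>Once the full power of one prime is removed, the cofactor is not \<open>1\<close>, as
  otherwise \<open>- n\<close> would be a prime power; it supplies the second prime.\<close>

lemma num_primes_ge_2_negative:
  assumes "n < - 1" "\<not> (\<exists>(p :: nat) k. Factorial_Ring.prime p \<and> k \<ge> 1 \<and> n = - (int p ^ k))"
  shows "num_primes n \<ge> 2"
proof -
  define m where "m = nat (- n)"
  have m: "n = - int m" "m > 1" using assms(1) by (simp_all add: m_def)
  obtain p where p: "Factorial_Ring.prime p" "p dvd m" using m(2) prime_factor_nat[of m] by auto
  obtain c where c: "m = p ^ multiplicity p m * c" "\<not> p dvd c"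
    using multiplicity_decompose'[of m p] m(2) p(1) not_prime_unit by (metis not_one_less_zero)
  have "multiplicity p m \<ge> 1" using c p(2) by (metis One_nat_def Suc_leI gr0I mult_1 power_0)
  moreover have "n = - (int p ^ multiplicity p m)" if "c = 1"
    using c(1) m(1) that by (metis mult.right_neutral of_nat_power)
  ultimately have "c \<noteq> 1" using assms(2) p(1) by blast
  then obtain q where q: "Factorial_Ring.prime q" "q dvd c" using prime_factor_nat by blast
  have "p \<noteq> q" using q c(2) by auto
  moreover have "q dvd m" using q(2) c(1) by (metis dvd_mult)
  ultimately show ?thesis
    using p q m by (intro num_primes_ge_2[of n p q]) auto
qed

text \<open>The consecutive numbers \<open>m\<close> and \<open>m + 1\<close> have no common prime,
  and both exceed \<open>1\<close>.\<close>

lemma num_primes_ge_2_square: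
  assumes "n = m * (m + 1)" "m > 1"
  shows "num_primes n \<ge> 2"
proof -
  obtain p where p: "Factorial_Ring.prime p" "p dvd nat m" 
    using assms(2) prime_factor_nat[of "nat m"] by (force simp: nat_eq_iff)
  obtain q where q: "Factorial_Ring.prime q" "q dvd nat (m + 1)" 
    using assms(2) prime_factor_nat[of "nat (m + 1)"] by (force simp: nat_eq_iff)
  have "int p dvd int (nat m)" "int q dvd int (nat (m + 1))" using p q by (simp_all only: int_dvd_int_iff)
  then have pm: "int p dvd m" "int q dvd m + 1" using assms(2) by simp_all
  have "p \<noteq> q"
  proof
    assume "p = q"
    then have "int p dvd 1" using pm by (metis dvd_add_right_iff)
    then show False using p(1) by auto
  qed
  then show ?thesis
    using p q pm assms by (intro num_primes_ge_2[of n p q]) auto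
qed

lemma num_primes_ge_1:
  assumes "n > 1"
  shows "num_primes n \<ge> 1"
proof -
  obtain p where p: "Factorial_Ring.prime p" "p dvd nat n" 
    using assms prime_factor_nat[of "nat n"] by (force simp: nat_eq_iff)
  have "int p dvd int (nat n)" using p by (simp only: int_dvd_int_iff)
  then have "int p dvd n" using assms by simp
  moreover have "finite {p :: nat. Factorial_Ring.prime p \<and> int p dvd n}"
    using assms by (intro finite_prime_divisors) simp
  ultimately have "card {p} \<le> num_primes n"
    unfolding num_primes_def using p(1) by (intro card_mono) auto
  then show ?thesis by simp
qed

lemma finite_group_of_iso:
  assumes "G \<cong> integer_mod_group N" "N > 0"
  shows "finite (carrier G)"
proof -
  obtain h where "bij_betw h (carrier G) (carrier (integer_mod_group N))"
    using assms(1) by (auto simp: is_iso_def iso_def)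
  moreover have "finite (carrier (integer_mod_group N))"
    using assms(2) by (simp add: carrier_integer_mod_group)
  ultimately show ?thesis using bij_betw_finite by blast
qed

lemma infinite_unitary_quotient:
  assumes "group_rank (unitary_quotient n) = enat r" "r \<ge> 1"
  shows "infinite (carrier (unitary_quotient n))"
proof
  interpret Q: comm_group "unitary_quotient n" by (rule comm_group_unitary_quotient)
  assume "finite (carrier (unitary_quotient n))"
  then have "group_rank (unitary_quotient n) = 0" by (rule Q.finite_imp_group_rank_0)
  then show False using assms by (simp add: zero_enat_def)
qed

lemma rank_negative:
  assumes "n < - 1"
  shows "group_rank (unitary_quotient n) = enat (num_primes n - 1)"
proof -
  obtain w where "quadratic_order n w" using quadratic_order_exists[of n] assms by force
  then show ?thesis using assms by (rule quadratic_order.group_rank_nonsquare_negative)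
qed

lemma rank_square:
  assumes "n = m * (m + 1)" "m > 0"
  shows "group_rank (unitary_quotient n) = enat (num_primes n - 1)"
proof -
  have "quadratic_order n (of_int (m + 1))"
  proof
    show "n \<noteq> 0" using assms by simp
  qed (simp add: assms algebra_simps)
  then show ?thesis using assms refl by (rule quadratic_order.group_rank_square)
qed

lemma rank_nonsquare_positive:
  assumes "n > 1" "\<nexists>s. s\<^sup>2 = 4 * n + 1"
  shows "group_rank (unitary_quotient n) = enat (num_primes n)"
proof -
  obtain r where "quadratic_order n (of_real r)" "\<bar>2 * r - 1\<bar> \<ge> 1"
    using real_quadratic_order_exists[of n] assms by force
  then show ?thesis
    using quadratic_order.group_rank_nonsquare_positive[OF _ assms refl] by blast
qed

lemma irreducible_Delta_iff:
  assumes "n > 0"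
  shows "Factorial_Ring.irreducible (Delta n) \<longleftrightarrow> (\<nexists>s. s\<^sup>2 = 4 * n + 1)"
proof
  assume irr: "Factorial_Ring.irreducible (Delta n)"
  show "\<nexists>s. s\<^sup>2 = 4 * n + 1"
  proof
    assume "\<exists>s. s\<^sup>2 = 4 * n + 1"
    then obtain s where "s\<^sup>2 = 4 * n + 1" by blast
    then obtain m where "n = m * (m + 1)" "m > 0" using square_discriminant assms by blast
    then show False using not_irreducible_Delta irr by blast
  qed
next
  assume "\<nexists>s. s\<^sup>2 = 4 * n + 1"
  moreover obtain w where "quadratic_order n w" using quadratic_order_exists[of n] assms by force
  ultimately show "Factorial_Ring.irreducible (Delta n)"
    by (simp add: quadratic_order.irreducible_Delta)
qed

lemma unitary_quotient_cyclic_2: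
  assumes "n = 1 \<or> n = 2 \<or>
    (\<exists>(p :: nat) k. Factorial_Ring.prime p \<and> k \<ge> 1 \<and> odd k \<and> n = - (int p ^ k))"
  shows "unitary_quotient n \<cong> integer_mod_group 2"
  using assms
proof (elim disjE exE conjE)
  assume n: "n = 1"
  then obtain r where "quadratic_order n (of_real r)" "r > 0"
    using real_quadratic_order_exists[of n] by force
  then show ?thesis using quadratic_order.quotient_1[OF _ n refl] by blast
next
  assume n: "n = 2"
  then obtain w where "quadratic_order n w" using quadratic_order_exists[of n] by force
  then show ?thesis using n by (rule quadratic_order.quotient_2)
next
  fix p :: nat and k assume p: "Factorial_Ring.prime p" "k \<ge> 1" "odd k" and n: "n = - (int p ^ k)"
  then have "n \<noteq> 0" by auto
  then obtain w where "quadratic_order n w" by (rule quadratic_order_exists)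
  then show ?thesis
    using p n by (intro quadratic_order.quotient_prime_power_odd[of n w "int p" k]) auto
qed

lemma unitary_quotient_cyclic_4:
  assumes p: "Factorial_Ring.prime (p :: nat)" "k \<ge> 1" "even k" and n: "n = - (int p ^ k)"
  shows "unitary_quotient n \<cong> integer_mod_group 4"
proof -
  have "n \<noteq> 0" using p n by auto
  then obtain w where "quadratic_order n w" by (rule quadratic_order_exists)
  then show ?thesis
    using p n by (intro quadratic_order.quotient_prime_power_even[of n w "int p" k]) auto
qed

lemma unitary_quotient_trivial:
  assumes "n = - 1 \<or> n = 0"
  shows "trivial_group (unitary_quotient n)"
proof (cases "n = 0")
  case True
  then show ?thesis using unitary_quotient_0 by simp
next
  case False
  then obtain w where "quadratic_order n w" by (rule quadratic_order_exists)
  then show ?thesis using False assms by (intro quadratic_order.quotient_minus_1) auto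
qed

theorem theorem1p7:
  fixes n :: int
  shows
    "(finite (carrier (unitary_quotient n)) \<longleftrightarrow>
        n \<in> {2, 1, 0, - 1} \<or>
        (\<exists>(p :: nat) k. Factorial_Ring.prime p \<and> k \<ge> 1 \<and> n = - (int p ^ k))) \<and>
     (n = - 1 \<or> n = 0 \<longrightarrow> trivial_group (unitary_quotient n)) \<and>
     (n = 1 \<or> n = 2 \<or>
        (\<exists>(p :: nat) k. Factorial_Ring.prime p \<and> k \<ge> 1 \<and> odd k \<and> n = - (int p ^ k)) \<longrightarrow>
        unitary_quotient n \<cong> integer_mod_group 2) \<and>
     ((\<exists>(p :: nat) k. Factorial_Ring.prime p \<and> k \<ge> 2 \<and> even k \<and> n = - (int p ^ k)) \<longrightarrow>
        unitary_quotient n \<cong> integer_mod_group 4) \<and>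
     (\<not> (n \<in> {2, 1, 0, - 1} \<or>
         (\<exists>(p :: nat) k. Factorial_Ring.prime p \<and> k \<ge> 1 \<and> n = - (int p ^ k))) \<longrightarrow>
        infinite (carrier (unitary_quotient n)) \<and>
        (Factorial_Ring.irreducible (Delta n) \<and> n > 0 \<longrightarrow>
           group_rank (unitary_quotient n) = enat (num_primes n)) \<and>
        ((Factorial_Ring.irreducible (Delta n) \<and> n < 0) \<or> \<not> Factorial_Ring.irreducible (Delta n) \<longrightarrow>
           group_rank (unitary_quotient n) = enat (num_primes n - 1)))"
proof (intro conjI impI)
  let ?power = "\<exists>(p :: nat) k. Factorial_Ring.prime p \<and> k \<ge> 1 \<and> n = - (int p ^ k)"
  show trivial: "trivial_group (unitary_quotient n)" if "n = - 1 \<or> n = 0"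
    using that by (rule unitary_quotient_trivial)
  show cyclic2: "unitary_quotient n \<cong> integer_mod_group 2"
    if "n = 1 \<or> n = 2 \<or>
      (\<exists>(p :: nat) k. Factorial_Ring.prime p \<and> k \<ge> 1 \<and> odd k \<and> n = - (int p ^ k))"
    using that by (rule unitary_quotient_cyclic_2)
  show "unitary_quotient n \<cong> integer_mod_group 4"
    if "\<exists>(p :: nat) k. Factorial_Ring.prime p \<and> k \<ge> 2 \<and> even k \<and> n = - (int p ^ k)"
    using that unitary_quotient_cyclic_4 by auto
  \<comment> \<open>The lower bounds on \<open>num_primes n\<close> are recorded along with the
    ranks because they make each rank at least \<open>1\<close>, from which infinitude
    follows.\<close>
  have rank: "group_rank (unitary_quotient n) = enat (num_primes n) \<and> num_primes n \<ge> 1 \<and>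
        Factorial_Ring.irreducible (Delta n) \<and> n > 0 \<or>
      group_rank (unitary_quotient n) = enat (num_primes n - 1) \<and> num_primes n \<ge> 2 \<and>
        (\<not> Factorial_Ring.irreducible (Delta n) \<or> n < 0)"
    if neg: "\<not> (n \<in> {2, 1, 0, - 1} \<or> ?power)"
  proof -
    consider "n < - 1" | "n > 1" "\<nexists>s. s\<^sup>2 = 4 * n + 1" | "n > 1" "\<exists>s. s\<^sup>2 = 4 * n + 1"
      using neg by fastforce
    then show ?thesis
    proof cases
      case 1
      then show ?thesis using rank_negative num_primes_ge_2_negative neg by auto
    next
      case 2
      then show ?thesis using rank_nonsquare_positive num_primes_ge_1 irreducible_Delta_iff by auto
    next
      case 3
      then obtain s where "s\<^sup>2 = 4 * n + 1" by blast
      then obtain m where m: "n = m * (m + 1)" "m > 0"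
        using square_discriminant 3(1) by (metis less_trans zero_less_one)
      \<comment> \<open>The value \<open>m = 1\<close> would be the finite case
        \<open>n = 2\<close>.\<close>
      have "m \<noteq> 1" using m(1) neg by auto
      then have "m > 1" using m(2) by simp
      then show ?thesis using rank_square[OF m] num_primes_ge_2_square[OF m(1)] not_irreducible_Delta[OF m] by auto
    qed
  qed
  show infinite: "infinite (carrier (unitary_quotient n))" if "\<not> (n \<in> {2, 1, 0, - 1} \<or> ?power)"
    using rank[OF that] infinite_unitary_quotient[of n "num_primes n"]
      infinite_unitary_quotient[of n "num_primes n - 1"] by fastforce
  show "finite (carrier (unitary_quotient n)) \<longleftrightarrow> n \<in> {2, 1, 0, - 1} \<or> ?power"
  proof
    assume "n \<in> {2, 1, 0, - 1} \<or> ?power"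
    then consider "n = - 1 \<or> n = 0"
      | "n = 1 \<or> n = 2 \<or> (\<exists>(p :: nat) k. Factorial_Ring.prime p \<and> k \<ge> 1 \<and> odd k \<and> n = - (int p ^ k))"
      | "\<exists>(p :: nat) k. Factorial_Ring.prime p \<and> k \<ge> 1 \<and> even k \<and> n = - (int p ^ k)"
      by blast
    then show "finite (carrier (unitary_quotient n))"
    proof cases
      case 1
      then show ?thesis using trivial by (simp add: trivial_group_def)
    next
      case 2
      then show ?thesis using finite_group_of_iso[OF cyclic2] by simp
    next
      case 3
      then show ?thesis using unitary_quotient_cyclic_4 finite_group_of_iso by (metis zero_less_numeral)
    qed
  qed (use infinite in blast)
  show "group_rank (unitary_quotient n) = enat (num_primes n)"
    if "\<not> (n \<in> {2, 1, 0, - 1} \<or> ?power)" "Factorial_Ring.irreducible (Delta n) \<and> n > 0"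
    using rank[OF that(1)] that(2) by auto
  show "group_rank (unitary_quotient n) = enat (num_primes n - 1)"
    if "\<not> (n \<in> {2, 1, 0, - 1} \<or> ?power)"
      "Factorial_Ring.irreducible (Delta n) \<and> n < 0 \<or> \<not> Factorial_Ring.irreducible (Delta n)"
    using rank[OF that(1)] that(2) by auto
qed

end
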